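(* For every constant $C>1$ there exists $\varepsilon_0=\varepsilon_0(C)>0$ such that the following holds. Let $D=D(C)$ and $\ell_0=\ell_0(C)$ be constants with $\ell_0\gg D\gg C$. Then for every integer $\ell\ge\ell_0$ and $k=D^2\ell^2$ there exists $p=p(C,\ell)\in(p_C,\tfrac12)$ such that in the random sphere graph $G_{k,p}(n)$, \[ P_{\mathrm{red},\ell}\le\Big(p_C-\varepsilon_0\tfrac{\ell}{\sqrt k}\Big)^{\binom{\ell}{2}}\quad\text{and}\quad \overline P_{\mathrm{blue},C\ell}\le\Big(1-p_C-\varepsilon_0\tfrac{\ell}{\sqrt k}\Big)^{\binom{C\ell}{2}}. \]
   Context: $p_C\in(0,1/2)$ is the unique solution of $C=\frac{\log p_C}{\log(1-p_C)}$. "$\ell_0\gg D\gg C$" means $D$ is sufficiently large in terms of $C$ and $\ell_0$ sufficiently large in terms of $D$ and $C$. $S^k$ is the unit sphere in $\mathbb{R}^{k+1}$ with its uniform probability measure $\mathbb P$. For $p\in(0,1/2]$, $c_{k,p}\ge 0$ is defined by $\mathbb P(\langle \mathbf x,\mathbf e\rangle\le -c_{k,p}/\sqrt k)=p$ for $\mathbf x$ uniform on $S^k$ and $\mathbf e$ any fixed unit vector. The random sphere graph $G_{k,p}(n)$ is the complete graph on $n$ independent uniform points $\mathbf x_1,\dots,\mathbf x_n$ of $S^k$, where the edge $\mathbf x_i\mathbf x_j$ is coloured red if $\langle\mathbf x_i,\mathbf x_j\rangle\le -c_{k,p}/\sqrt k$ and blue otherwise. For a positive integer $r$, $P_{\mathrm{red},r}$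 (resp. $\overline P_{\mathrm{blue},r}$) is the probability that $r$ independent uniform points of $S^k$, with edges coloured by the same rule, form a red (resp. blue) clique. Quantities such as $C\ell$ are treated as integers. *)

theory Defs
  imports "HOL-Probability.Probability" "HOL-Real_Asymp.Real_Asymp"
begin

definition p_crit :: "real \<Rightarrow> real" where
  "p_crit C = (THE p. 0 < p \<and> p < 1/2 \<and> C = ln p / ln (1 - p))"

lemma p_crit_ex1:
  fixes C :: real
  assumes "C > 1"
  shows "\<exists>!p. 0 < p \<and> p < 1/2 \<and> C = ln p / ln (1 - p)"
proof -
  let ?f = "\<lambda>p::real. ln p / ln (1 - p)"
  have mono: "?f q < ?f p" if "0 < p" "p < q" "q \<le> 1/2" for p q
  proof -
    have "- ln q < - ln p" "- ln (1 - p) < - ln (1 - q)" "0 < - ln (1 - p)" "0 < - ln q"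
      using that by auto
    then have "(- ln q) / (- ln (1 - q)) < (- ln p) / (- ln (1 - p))"
      by (intro frac_less) auto
    then show ?thesis by simp
  qed
  have "filterlim ?f at_top (at_right 0)" by real_asymp
  then have "eventually (\<lambda>p. ?f p > C) (at_right 0)"
    by (simp add: filterlim_at_top_dense)
  moreover have "eventually (\<lambda>p. p \<in> {0<..<1/2::real}) (at_right 0)"
    by (rule eventually_at_right_real) simp
  ultimately have "eventually (\<lambda>p. ?f p > C \<and> p \<in> {0<..<1/2}) (at_right 0)"
    by (rule eventually_conj)
  then obtain a where a: "?f a > C" "0 < a" "a < 1/2"
    using eventually_happens trivial_limit_at_right_real by fastforce
  have half: "?f (1/2) = 1" by simp
  have cont: "continuous_on {a..1/2} ?f"
    using a by (intro continuous_intros) auto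
  have "\<exists>p. a \<le> p \<and> p \<le> 1/2 \<and> ?f p = C"
    by (rule IVT2'[OF _ _ _ cont]) (use a half assms in auto)
  then obtain p where p: "a \<le> p" "p \<le> 1/2" "?f p = C" by blast
  have "p \<noteq> 1/2" using p half assms by auto
  show ?thesis
  proof (rule ex1I[of _ p])
    show "0 < p \<and> p < 1/2 \<and> C = ?f p" using p a \<open>p \<noteq> 1/2\<close> by auto
    fix q assume "0 < q \<and> q < 1/2 \<and> C = ?f q"
    then show "q = p" using mono[of p q] mono[of q p] p a by (cases p q rule: linorder_cases) auto
  qed
qed

text \<open>
  The dimension \<open>k\<close> varies inside the statement, so points of $\mathbb{R}^{k+1}$ are represented
  by the elements of \<open>{..k} \<rightarrow>\<^sub>E UNIV\<close>, i.e. real functions on \<open>{0, \<dots>, k}\<close> that are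
  \<open>undefined\<close> elsewhere; this is the space of \<open>Pi\<^sub>M {..k} (\<lambda>_. borel)\<close>.
\<close>

definition inner_on :: "nat \<Rightarrow> (nat \<Rightarrow> real) \<Rightarrow> (nat \<Rightarrow> real) \<Rightarrow> real" where
  "inner_on k x y = (\<Sum>i\<le>k. x i * y i)"

definition norm_on :: "nat \<Rightarrow> (nat \<Rightarrow> real) \<Rightarrow> real" where
  "norm_on k x = sqrt (inner_on k x x)"

definition unit_sphere :: "nat \<Rightarrow> (nat \<Rightarrow> real) set" where
  "unit_sphere k = {x \<in> {..k} \<rightarrow>\<^sub>E UNIV. norm_on k x = 1}"

definition unit_ball :: "nat \<Rightarrow> (nat \<Rightarrow> real) set" where
  "unit_ball k = {x \<in> {..k} \<rightarrow>\<^sub>E UNIV. norm_on k x \<le> 1}"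

definition normalize_on :: "nat \<Rightarrow> (nat \<Rightarrow> real) \<Rightarrow> nat \<Rightarrow> real" where
  "normalize_on k x = (\<lambda>i\<in>{..k}. x i / norm_on k x)"

text \<open>
  The uniform probability measure on the sphere, as normalised cone measure: the distribution of
  $x / |x|$ for $x$ uniform in the unit ball of $\mathbb{R}^{k+1}$. The restriction makes \<open>S\<^sup>k\<close>
  itself the underlying space; it only removes the image of the origin, which is a null set.
\<close>

definition uniform_sphere :: "nat \<Rightarrow> (nat \<Rightarrow> real) measure" where
  "uniform_sphere k = restrict_space
     (distr (uniform_measure (Pi\<^sub>M {..k} (\<lambda>_. lborel)) (unit_ball k))
            (Pi\<^sub>M {..k} (\<lambda>_. borel)) (normalize_on k))
     (unit_sphere k)"

lemma measurable_inner_on [measurable]: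
  assumes [measurable]: "f \<in> measurable M (Pi\<^sub>M {..k} (\<lambda>_. borel))"
    "g \<in> measurable M (Pi\<^sub>M {..k} (\<lambda>_. borel))"
  shows "(\<lambda>x. inner_on k (f x) (g x)) \<in> borel_measurable M"
  unfolding inner_on_def by measurable

lemma measurable_norm_on [measurable]:
  assumes [measurable]: "f \<in> measurable M (Pi\<^sub>M {..k} (\<lambda>_. borel))"
  shows "(\<lambda>x. norm_on k (f x)) \<in> borel_measurable M"
  unfolding norm_on_def by measurable

lemma norm_on_normalize_on: "norm_on k x \<noteq> 0 \<Longrightarrow> norm_on k (normalize_on k x) = 1"
proof -
  assume nz: "norm_on k x \<noteq> 0"
  have ge: "inner_on k x x \<ge> 0" unfolding inner_on_def by (intro sum_nonneg) auto
  have "inner_on k (normalize_on k x) (normalize_on k x) = inner_on k x x / (norm_on k x)\<^sup>2"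
    by (simp add: inner_on_def normalize_on_def sum_divide_distrib power2_eq_square)
  also have "(norm_on k x)\<^sup>2 = inner_on k x x" using ge by (simp add: norm_on_def)
  finally show ?thesis using nz by (simp add: norm_on_def)
qed

lemma space_uniform_sphere: "space (uniform_sphere k) = unit_sphere k"
  by (auto simp: uniform_sphere_def space_restrict_space space_PiM unit_sphere_def)

lemma sets_uniform_sphere:
  "sets (uniform_sphere k) = sets (restrict_space (Pi\<^sub>M {..k} (\<lambda>_. borel)) (unit_sphere k))"
  by (simp add: uniform_sphere_def sets_restrict_space)

lemma unit_sphere_sets: "unit_sphere k \<in> sets (Pi\<^sub>M {..k} (\<lambda>_. borel))"
proof -
  have "unit_sphere k = {x \<in> space (Pi\<^sub>M {..k} (\<lambda>_. borel)). norm_on k x = 1}"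
    by (auto simp: unit_sphere_def space_PiM)
  also have "\<dots> \<in> sets (Pi\<^sub>M {..k} (\<lambda>_. borel))" by measurable
  finally show ?thesis .
qed

lemma prob_space_uniform_sphere: "prob_space (uniform_sphere k)"
proof -
  let ?L = "Pi\<^sub>M {..k} (\<lambda>_. lborel) :: (nat \<Rightarrow> real) measure"
  let ?B = "Pi\<^sub>M {..k} (\<lambda>_. borel) :: (nat \<Rightarrow> real) measure"
  let ?U = "uniform_measure ?L (unit_ball k)"
  have setsL: "sets ?L = sets ?B" by (intro sets_PiM_cong) auto
  have id [measurable]: "(\<lambda>x. x) \<in> measurable ?L ?B"
    by (simp add: measurable_cong_sets[OF setsL refl])
  have ball: "unit_ball k = {x. sqrt (\<Sum>i\<in>{..k}. (x i)\<^sup>2) \<le> 1} \<inter> space ?L"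
    by (auto simp: unit_ball_def norm_on_def inner_on_def space_PiM power2_eq_square)
  have em: "emeasure ?L (unit_ball k) = ennreal (unit_ball_vol (real (card {..k})))"
    unfolding ball by (subst emeasure_cball_aux) auto
  interpret U: prob_space ?U
    by (rule prob_space_uniform_measure) (auto simp: em ennreal_eq_0_iff not_le)
  have nrm: "normalize_on k \<in> measurable ?U ?B"
    unfolding normalize_on_def by (rule measurable_restrict) measurable
  interpret product_sigma_finite "\<lambda>_::nat. lborel :: real measure" ..
  have pt: "{x \<in> space ?L. norm_on k x = 0} = PiE {..k} (\<lambda>_. {0})" (is "?Z = _")
  proof (intro set_eqI iffI)
    fix x assume "x \<in> {x \<in> space ?L. norm_on k x = 0}"
    then have x: "x \<in> {..k} \<rightarrow>\<^sub>E UNIV" and "(\<Sum>i\<le>k. x i * x i) = 0"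
      by (auto simp: norm_on_def inner_on_def space_PiM)
    then have "\<forall>i\<in>{..k}. x i * x i = 0" by (subst (asm) sum_nonneg_eq_0_iff) auto
    then show "x \<in> PiE {..k} (\<lambda>_. {0})" using x by (auto simp: PiE_iff extensional_def fun_eq_iff)
  qed (auto simp: norm_on_def inner_on_def space_PiM PiE_iff)
  have "emeasure ?L ?Z = 0" unfolding pt by (subst emeasure_PiM) (auto simp: prod_zero)
  moreover have "?Z \<in> sets ?L" by measurable
  ultimately have "AE x in ?L. norm_on k x \<noteq> 0" by (intro AE_I[of _ _ ?Z]) auto
  moreover have "unit_ball k \<in> sets ?L"
  proof -
    have "unit_ball k = {x \<in> space ?L. norm_on k x \<le> 1}" by (auto simp: unit_ball_def space_PiM)
    also have "\<dots> \<in> sets ?L" by measurable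
    finally show ?thesis .
  qed
  ultimately have "AE x in ?U. norm_on k x \<noteq> 0"
    by (intro AE_uniform_measureI) auto
  then have "AE x in ?U. normalize_on k x \<in> unit_sphere k"
    by eventually_elim (auto simp: unit_sphere_def norm_on_normalize_on, auto simp: normalize_on_def split: if_splits)
  then have AEd: "AE x in distr ?U ?B (normalize_on k). x \<in> unit_sphere k"
    by (subst AE_distr_iff[OF nrm]) (use unit_sphere_sets[of k] in \<open>auto simp: unit_sphere_def space_PiM\<close>)
  interpret N: prob_space "distr ?U ?B (normalize_on k)" by (rule U.prob_space_distr[OF nrm])
  have "emeasure (distr ?U ?B (normalize_on k)) (unit_sphere k) = 1"
    using AEd unit_sphere_sets[of k] by (intro N.emeasure_eq_1_AE) auto
  then show ?thesis
    unfolding uniform_sphere_def by (intro prob_space_restrict_space) (auto simp: unit_sphere_sets)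
qed

definition cap_const :: "nat \<Rightarrow> real \<Rightarrow> real" where
  "cap_const k p = (THE c. c \<ge> 0 \<and> (\<forall>e \<in> unit_sphere k.
     measure (uniform_sphere k) {x \<in> space (uniform_sphere k). inner_on k x e \<le> - c / sqrt k} = p))"

datatype colour = Red | Blue

definition edge_colour :: "nat \<Rightarrow> real \<Rightarrow> (nat \<Rightarrow> real) \<Rightarrow> (nat \<Rightarrow> real) \<Rightarrow> colour" where
  "edge_colour k p x y = (if inner_on k x y \<le> - cap_const k p / sqrt k then Red else Blue)"

definition sphere_points :: "nat \<Rightarrow> nat \<Rightarrow> (nat \<Rightarrow> nat \<Rightarrow> real) measure" where
  "sphere_points k n = Pi\<^sub>M {..<n} (\<lambda>_. uniform_sphere k)"

text \<open>
  A sample \<open>x\<close> from \<open>sphere_points k n\<close> determines the random sphere graph \<open>G\<^bsub>k,p\<^esub>(n)\<close>: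
  the vertices are the indices \<open>{..<n}\<close> and \<open>{i, j}\<close> is coloured according to the points
  \<open>x i\<close> and \<open>x j\<close>.
\<close>

definition sphere_graph ::
  "nat \<Rightarrow> real \<Rightarrow> (nat \<Rightarrow> nat \<Rightarrow> real) \<Rightarrow> nat \<Rightarrow> nat \<Rightarrow> colour" where
  "sphere_graph k p x i j = edge_colour k p (x i) (x j)"

definition mono_clique :: "(nat \<Rightarrow> nat \<Rightarrow> colour) \<Rightarrow> colour \<Rightarrow> nat set \<Rightarrow> bool" where
  "mono_clique G c V \<longleftrightarrow> (\<forall>i\<in>V. \<forall>j\<in>V. i \<noteq> j \<longrightarrow> G i j = c)"

definition P_red :: "nat \<Rightarrow> real \<Rightarrow> nat \<Rightarrow> real" where
  "P_red k p r = measure (sphere_points k r)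
     {x \<in> space (sphere_points k r). mono_clique (sphere_graph k p x) Red {..<r}}"

definition P_blue :: "nat \<Rightarrow> real \<Rightarrow> nat \<Rightarrow> real" where
  "P_blue k p r = measure (sphere_points k r)
     {x \<in> space (sphere_points k r). mono_clique (sphere_graph k p x) Blue {..<r}}"

lemma sets_mono_clique:
  "{x \<in> space (sphere_points k r). mono_clique (sphere_graph k p x) c {..<r}}
     \<in> sets (sphere_points k r)"
proof -
  have comp: "(\<lambda>x. x i) \<in> measurable (sphere_points k r) (Pi\<^sub>M {..k} (\<lambda>_. borel))" if "i < r" for i
  proof -
    have "(\<lambda>x. x i) \<in> measurable (sphere_points k r) (uniform_sphere k)"
      unfolding sphere_points_def using that by (intro measurable_component_singleton) auto
    moreover have "(\<lambda>x. x) \<in> measurable (uniform_sphere k) (Pi\<^sub>M {..k} (\<lambda>_. borel))"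
      by (subst measurable_cong_sets[OF sets_uniform_sphere refl])
         (simp add: measurable_restrict_space1)
    ultimately show ?thesis by (rule measurable_compose)
  qed
  have edge: "{x \<in> space (sphere_points k r). sphere_graph k p x i j = c} \<in> sets (sphere_points k r)"
    if "i < r" "j < r" for i j
  proof -
    note [measurable] = comp[OF that(1)] comp[OF that(2)]
    have "{x \<in> space (sphere_points k r). inner_on k (x i) (x j) \<le> - cap_const k p / sqrt k}
            \<in> sets (sphere_points k r)"
      "{x \<in> space (sphere_points k r). \<not> inner_on k (x i) (x j) \<le> - cap_const k p / sqrt k}
            \<in> sets (sphere_points k r)"
      by measurable
    then show ?thesis by (cases c) (simp_all add: sphere_graph_def edge_colour_def)
  qed
  show ?thesis unfolding mono_clique_def
    by (intro sets.sets_Collect_finite_All' sets.sets_Collect_finite_All sets.sets_Collect_imp) (auto simp: edge)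
qed

end

theory Submission
  imports Defs
begin

text \<open>
  Replace the points of the sphere by Gaussian vectors $g_1, \dots, g_n$ in $\mathbb{R}^{k+1}$, which
  costs only a factor $2^n$ because norms and directions are independent. Revealing one vertex at a
  time and rotating it onto a coordinate axis, the edge conditions become
  $A_{ij} \le t - k^{-1/2} \sum_{l} A_{il} A_{jl}$ (up to the sign of the colour) with independent
  standard normal $A_{ij}$. Since the normal distribution function $\Phi$ is log-concave,
  $\Phi(t - u) \le \Phi(t) e^{-\mu u}$ with $\mu = \Phi'(t) / \Phi(t)$, so integrating out one column
  leaves an exponential tilt of the remaining ones, and the integral over a column is a mean-field
  Gaussian integral. Altogether a clique on $n$ vertices has probability
  $\Phi(t)^{\binom n2} \exp(\mp \mu^3 n^3 / (6 \sqrt k) + \dots)$, with the sign $-$ for red and $+$ for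
  blue. Thus red cliques are rarer and blue ones more frequent than among independent edges. As
  $C p_C^2 < (1 - p_C)^2$, the gain for red exceeds the loss for blue, and increasing $p$ slightly
  beyond $p_C$ makes both bounds beat the independent ones by a factor $1 - \Theta(\ell / \sqrt k)$ per edge.
\<close>

section \<open>The standard normal distribution\<close>

text \<open>The obstacle is that a revealed vector has random length and that every step lowers the
  dimension. Both are met by keeping the scale \<open>sqrt k\<close> fixed: if \<open>u\<close> is
  the squared length divided by \<open>k\<close>, the exponent
  \<open>tilt_log t + hazard t * Y\<close> remains valid at a price proportional to
  \<open>|u - 1|\<close>. With \<open>m\<close> vertices left the price is O(m)
  \<open>|u - 1|\<close>; as \<open>m\<close> is O(sqrt k) and \<open>u - 1\<close> fluctuates on
  the scale 1 / sqrt k, its exponential moment is bounded. All such losses, and the factor 2 per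
  vertex, amount to exp(O(n)), which is negligible: \<open>D\<close> is fixed before
  \<open>l\<close>, so the gain sought is a constant factor on each edge. The exponent must be
  linear in the thresholds because the induction has to cover arbitrary ones, including those that
  depend on a random column. The next term, of order (n / sqrt k)^2 per edge, is not negligible and
  is beaten by a large \<open>D\<close>; hence \<open>\<epsilon>\<^sub>0\<close> comes from a
  derivative at 1 / D = 0. The probability \<open>p\<close> is not prescribed: a Gaussian threshold
  slightly above the quantile of p_C is fixed, and \<open>p\<close> is the measure of the
  corresponding cap.\<close>

abbreviation std_normal :: "real measure" where
  "std_normal \<equiv> std_normal_distribution"

definition Phi :: "real \<Rightarrow> real" where
  "Phi z = measure std_normal {..z}"

lemma prob_space_std_normal: "prob_space std_normal"
  by (rule prob_space_normal_density) simp

section \<open>Gaussian integrals with linear and quadratic exponential weights\<close>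

lemma nn_integral_std_normal:
  "f \<in> borel_measurable borel \<Longrightarrow>
    (\<integral>\<^sup>+x. f x \<partial>std_normal) = (\<integral>\<^sup>+x. ennreal (std_normal_density x) * f x \<partial>lborel)"
  by (subst nn_integral_density) auto

text \<open>Completing the square: the weight exp(\<theta> x) moves the mean of the Gaussian to
  \<theta>, up to a normalising factor.\<close>

lemma nn_integral_std_normal_shift:
  assumes [measurable]: "f \<in> borel_measurable borel"
  shows "(\<integral>\<^sup>+x. f x * ennreal (exp (\<theta> * x)) \<partial>std_normal)
       = ennreal (exp (\<theta>\<^sup>2 / 2)) * (\<integral>\<^sup>+x. f (x + \<theta>) \<partial>std_normal)"
proof -
  have "(\<integral>\<^sup>+x. f x * ennreal (exp (\<theta> * x)) \<partial>std_normal)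
      = (\<integral>\<^sup>+x. ennreal (std_normal_density x) * (f x * ennreal (exp (\<theta> * x))) \<partial>lborel)"
    by (rule nn_integral_std_normal) measurable
  also have "\<dots> = (\<integral>\<^sup>+x. ennreal (std_normal_density (\<theta> + 1 * x)) * (f (\<theta> + 1 * x) * ennreal (exp (\<theta> * (\<theta> + 1 * x)))) \<partial>lborel)"
    by (subst nn_integral_real_affine[of _ 1 \<theta>]) auto
  also have "\<dots> = (\<integral>\<^sup>+x. ennreal (exp (\<theta>\<^sup>2 / 2)) * (ennreal (std_normal_density x) * f (x + \<theta>)) \<partial>lborel)"
  proof (rule nn_integral_cong)
    fix x :: real
    have "exp (- (\<theta> + x)\<^sup>2 / 2) * exp (\<theta> * (\<theta> + x)) = exp (\<theta>\<^sup>2 / 2) * exp (- x\<^sup>2 / 2)"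
      unfolding exp_add[symmetric] by (rule arg_cong[of _ _ exp]) (simp add: power2_eq_square field_simps)
    then have "std_normal_density (\<theta> + x) * exp (\<theta> * (\<theta> + x)) = exp (\<theta>\<^sup>2 / 2) * std_normal_density x"
      by (simp add: std_normal_density_def)
    then have "ennreal (std_normal_density (\<theta> + x)) * ennreal (exp (\<theta> * (\<theta> + x)))
      = ennreal (exp (\<theta>\<^sup>2 / 2)) * ennreal (std_normal_density x)"
      by (simp flip: ennreal_mult)
    then show "ennreal (std_normal_density (\<theta> + 1 * x)) * (f (\<theta> + 1 * x) * ennreal (exp (\<theta> * (\<theta> + 1 * x))))
        = ennreal (exp (\<theta>\<^sup>2 / 2)) * (ennreal (std_normal_density x) * f (x + \<theta>))"
      by (simp add: mult_ac add.commute)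
  qed
  also have "\<dots> = ennreal (exp (\<theta>\<^sup>2 / 2)) * (\<integral>\<^sup>+x. f (x + \<theta>) \<partial>std_normal)"
    by (subst nn_integral_cmult) (auto simp: nn_integral_std_normal)
  finally show ?thesis .
qed

text \<open>Under the weight exp(\<alpha> x^2 / 2) a standard Gaussian becomes one of variance 1 /
  (1 - \<alpha>).\<close>

lemma nn_integral_std_normal_scale:
  assumes [measurable]: "f \<in> borel_measurable borel" and "\<alpha> < 1"
  shows "(\<integral>\<^sup>+x. f x * ennreal (exp (\<alpha> * x\<^sup>2 / 2)) \<partial>std_normal)
       = ennreal (1 / sqrt (1 - \<alpha>)) * (\<integral>\<^sup>+x. f (x / sqrt (1 - \<alpha>)) \<partial>std_normal)"
proof -
  define r where "r = sqrt (1 - \<alpha>)"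
  have r: "r > 0" "r\<^sup>2 = 1 - \<alpha>" using assms by (auto simp: r_def)
  have "(\<integral>\<^sup>+x. f x * ennreal (exp (\<alpha> * x\<^sup>2 / 2)) \<partial>std_normal)
      = (\<integral>\<^sup>+x. ennreal (std_normal_density x) * (f x * ennreal (exp (\<alpha> * x\<^sup>2 / 2))) \<partial>lborel)"
    by (rule nn_integral_std_normal) measurable
  also have "\<dots> = ennreal \<bar>1/r\<bar> * (\<integral>\<^sup>+x. ennreal (std_normal_density (0 + (1/r) * x)) * (f (0 + (1/r) * x) * ennreal (exp (\<alpha> * (0 + (1/r) * x)\<^sup>2 / 2))) \<partial>lborel)"
    by (rule nn_integral_real_affine) (use r in auto)
  also have "(\<integral>\<^sup>+x. ennreal (std_normal_density (0 + (1/r) * x)) * (f (0 + (1/r) * x) * ennreal (exp (\<alpha> * (0 + (1/r) * x)\<^sup>2 / 2))) \<partial>lborel)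
     = (\<integral>\<^sup>+x. (ennreal (std_normal_density x) * f (x / r)) \<partial>lborel)"
  proof (rule nn_integral_cong)
    fix x :: real
    have "exp (- (x / r)\<^sup>2 / 2) * exp (\<alpha> * (x / r)\<^sup>2 / 2) = exp (- x\<^sup>2 / 2)"
      unfolding exp_add[symmetric]
    proof (rule arg_cong[of _ _ exp])
      have "x\<^sup>2 = (x / r)\<^sup>2 * (1 - \<alpha>)" using assms(2) r by (simp add: power_divide)
      then show "- (x / r)\<^sup>2 / 2 + \<alpha> * (x / r)\<^sup>2 / 2 = - x\<^sup>2 / 2" by (simp add: algebra_simps)
    qed
    then have "std_normal_density (x / r) * exp (\<alpha> * (x / r)\<^sup>2 / 2) = std_normal_density x"
      by (simp add: std_normal_density_def)
    then have "ennreal (std_normal_density (x / r)) * ennreal (exp (\<alpha> * (x / r)\<^sup>2 / 2)) = ennreal (std_normal_density x)"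
      by (simp flip: ennreal_mult)
    then show "ennreal (std_normal_density (0 + (1/r) * x)) * (f (0 + (1/r) * x) * ennreal (exp (\<alpha> * (0 + (1/r) * x)\<^sup>2 / 2)))
        = ennreal (std_normal_density x) * f (x / r)"
      by (simp add: mult_ac)
  qed
  also have "\<dots> = (\<integral>\<^sup>+x. f (x / r) \<partial>std_normal)"
    by (rule nn_integral_std_normal[symmetric]) measurable
  finally show ?thesis using r by (simp add: r_def)
qed

lemma nn_integral_std_normal_exp:
  "(\<integral>\<^sup>+x. ennreal (exp (\<theta> * x)) \<partial>std_normal) = ennreal (exp (\<theta>\<^sup>2 / 2))"
proof -
  interpret prob_space std_normal by (rule prob_space_std_normal)
  show ?thesis using nn_integral_std_normal_shift[of "\<lambda>_. 1" \<theta>] emeasure_space_1 by simp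
qed

lemma nn_integral_std_normal_exp_square:
  assumes "\<alpha> < 1"
  shows "(\<integral>\<^sup>+x. ennreal (exp (\<alpha> * x\<^sup>2 / 2)) \<partial>std_normal) = ennreal (1 / sqrt (1 - \<alpha>))"
proof -
  interpret prob_space std_normal by (rule prob_space_std_normal)
  show ?thesis using nn_integral_std_normal_scale[of "\<lambda>_. 1" \<alpha>] assms emeasure_space_1 by simp
qed

lemma nn_integral_std_normal_exp_quadratic:
  assumes "\<alpha> < 1"
  shows "(\<integral>\<^sup>+x. ennreal (exp (\<alpha> * x\<^sup>2 / 2 + \<beta> * x)) \<partial>std_normal)
    = ennreal (1 / sqrt (1 - \<alpha>) * exp (\<beta>\<^sup>2 / (2 * (1 - \<alpha>))))"
proof -
  have "(\<integral>\<^sup>+x. ennreal (exp (\<alpha> * x\<^sup>2 / 2 + \<beta> * x)) \<partial>std_normal)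
    = (\<integral>\<^sup>+x. ennreal (exp (\<beta> * x)) * ennreal (exp (\<alpha> * x\<^sup>2 / 2)) \<partial>std_normal)"
    by (simp add: exp_add mult.commute flip: ennreal_mult)
  also have "\<dots> = ennreal (1 / sqrt (1 - \<alpha>)) * (\<integral>\<^sup>+x. ennreal (exp (\<beta> * (x / sqrt (1 - \<alpha>)))) \<partial>std_normal)"
    by (rule nn_integral_std_normal_scale) (use assms in auto)
  also have "(\<integral>\<^sup>+x. ennreal (exp (\<beta> * (x / sqrt (1 - \<alpha>)))) \<partial>std_normal) = ennreal (exp (\<beta>\<^sup>2 / (2 * (1 - \<alpha>))))"
    using nn_integral_std_normal_exp[of "\<beta> / sqrt (1 - \<alpha>)"] assms
    by (simp add: power_divide)
  finally show ?thesis using assms by (simp flip: ennreal_mult)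
qed

section \<open>The normal distribution function and its derivative\<close>

lemma ennreal_Phi: "ennreal (Phi z) = emeasure std_normal {..z}"
proof -
  interpret prob_space std_normal by (rule prob_space_std_normal)
  show ?thesis by (simp add: Phi_def emeasure_eq_measure)
qed

lemma Phi_nn_integral: "ennreal (Phi z) = (\<integral>\<^sup>+x. indicator {..z} x \<partial>std_normal)"
  by (simp add: ennreal_Phi)

lemma Phi_le_1: "Phi z \<le> 1"
proof -
  interpret prob_space std_normal by (rule prob_space_std_normal)
  show ?thesis by (simp add: Phi_def)
qed

lemma Phi_nonneg: "Phi z \<ge> 0"
  by (simp add: Phi_def)

text \<open>Markov's inequality for exp(-\<tau> x).\<close>

lemma Phi_chernoff:
  assumes "\<tau> \<ge> 0"
  shows "Phi z \<le> exp (\<tau> * z + \<tau>\<^sup>2 / 2)"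
proof -
  have "ennreal (Phi z) \<le> (\<integral>\<^sup>+x. ennreal (exp (\<tau> * z)) * ennreal (exp ((- \<tau>) * x)) \<partial>std_normal)"
    unfolding Phi_nn_integral
  proof (rule nn_integral_mono)
    fix x :: real
    show "indicator {..z} x \<le> ennreal (exp (\<tau> * z)) * ennreal (exp ((- \<tau>) * x))"
      using assms by (auto simp: indicator_def mult_left_mono simp flip: ennreal_mult exp_add)
  qed
  also have "\<dots> = ennreal (exp (\<tau> * z)) * ennreal (exp (\<tau>\<^sup>2 / 2))"
    by (subst nn_integral_cmult, simp, subst nn_integral_std_normal_exp) simp
  also have "\<dots> = ennreal (exp (\<tau> * z + \<tau>\<^sup>2 / 2))"
    by (simp add: exp_add ennreal_mult)
  finally show ?thesis by simp
qed

lemma Phi_diff: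
  assumes "a \<le> b"
  shows "Phi b - Phi a = integral {a..b} std_normal_density"
proof -
  interpret prob_space std_normal by (rule prob_space_std_normal)
  have cont: "continuous_on {a..b} std_normal_density"
    unfolding std_normal_density_def by (intro continuous_intros) auto
  have 1: "Phi b - Phi a = measure std_normal ({..b} - {..a})"
    unfolding Phi_def by (rule finite_measure_Diff[symmetric]) (use assms in auto)
  note 1
  also have "{..b} - {..a} = {a<..b}" by auto
  also have "ennreal (measure std_normal {a<..b}) = emeasure std_normal {a<..b}"
    by (simp add: emeasure_eq_measure)
  also have "\<dots> = (\<integral>\<^sup>+x. ennreal (std_normal_density x) * indicator {a<..b} x \<partial>lborel)"
    by (subst emeasure_density) auto
  also have "\<dots> = (\<integral>\<^sup>+x. ennreal (std_normal_density x) * indicator {a..b} x \<partial>lborel)"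
    by (rule nn_integral_cong_AE) (use AE_lborel_singleton[of a] in \<open>auto simp: indicator_def\<close>)
  also have "\<dots> = (\<integral>\<^sup>+x. ennreal (indicator {a..b} x *\<^sub>R std_normal_density x) \<partial>lborel)"
    by (intro nn_integral_cong) (auto simp: indicator_def)
  also have "\<dots> = ennreal (LINT x:{a..b}|lborel. std_normal_density x)"
    unfolding set_lebesgue_integral_def
    by (rule nn_integral_eq_integral)
       (auto intro!: integrable_mult_indicator AE_I2 scaleR_nonneg_nonneg simp del: real_scaleR_def)
  also have "(LINT x:{a..b}|lborel. std_normal_density x) = integral {a..b} std_normal_density"
    by (rule set_borel_integral_eq_integral)
       (auto simp: set_integrable_def intro!: integrable_mult_indicator simp del: real_scaleR_def)
  finally have eq: "ennreal (Phi b - Phi a) = ennreal (integral {a..b} std_normal_density)" .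
  have "0 \<le> Phi b - Phi a" unfolding 1 by simp
  moreover have "0 \<le> integral {a..b} std_normal_density"
    by (rule integral_nonneg[OF integrable_continuous_interval[OF cont]]) simp
  ultimately show ?thesis using eq by (simp add: ennreal_inj)
qed

lemma Phi_has_derivative: "(Phi has_real_derivative std_normal_density z) (at z)"
proof -
  have cont: "continuous_on {z-1..z+1} std_normal_density"
    unfolding std_normal_density_def by (intro continuous_intros) auto
  have "((\<lambda>u. integral {z-1..u} std_normal_density) has_real_derivative std_normal_density z) (at z within {z-1..z+1})"
    by (rule integral_has_real_derivative[OF cont]) auto
  then have "((\<lambda>u. Phi (z-1) + integral {z-1..u} std_normal_density) has_real_derivative std_normal_density z) (at z within {z-1..z+1})"
    by (auto intro!: derivative_eq_intros)
  moreover have "at z within {z-1..z+1} = at z"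
    by (rule at_within_interior) auto
  ultimately have *: "((\<lambda>u. Phi (z-1) + integral {z-1..u} std_normal_density) has_real_derivative std_normal_density z) (at z)"
    by simp
  show ?thesis
  proof (rule has_field_derivative_transform_within[OF *, of 1])
    fix x' assume "dist x' z < 1"
    then have "z - 1 \<le> x'" by (auto simp: dist_real_def)
    from Phi_diff[OF this] show "Phi (z - 1) + integral {z - 1..x'} std_normal_density = Phi x'"
      by simp
  qed auto
qed

lemma std_normal_density_pos: "std_normal_density x > 0"
  by (rule normal_density_pos) simp

lemma Phi_strict_mono: "a < b \<Longrightarrow> Phi a < Phi b"
  by (rule DERIV_pos_imp_increasing) (use Phi_has_derivative std_normal_density_pos in blast)+

lemma Phi_pos: "Phi z > 0"
  using Phi_strict_mono[of "z-1" z] Phi_nonneg[of "z-1"] by linarith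

lemma Phi_uminus: "Phi (- z) = 1 - Phi z"
proof -
  interpret prob_space std_normal by (rule prob_space_std_normal)
  have "emeasure std_normal {..-z} = (\<integral>\<^sup>+x. ennreal (std_normal_density x) * indicator {..-z} x \<partial>lborel)"
    by (subst emeasure_density) auto
  also have "\<dots> = (\<integral>\<^sup>+x. ennreal (std_normal_density (0 + (-1) * x)) * indicator {..-z} (0 + (-1) * x) \<partial>lborel)"
    by (subst nn_integral_real_affine[of _ "-1" 0]) auto
  also have "\<dots> = (\<integral>\<^sup>+x. ennreal (std_normal_density x) * indicator {z<..} x \<partial>lborel)"
    by (rule nn_integral_cong_AE)
       (use AE_lborel_singleton[of z] in \<open>auto simp: indicator_def std_normal_density_def\<close>)
  also have "\<dots> = emeasure std_normal {z<..}"
    by (subst emeasure_density) auto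
  finally have "measure std_normal {..-z} = measure std_normal {z<..}"
    by (simp add: emeasure_eq_measure)
  also have "{z<..} = space std_normal - {..z}" by auto
  also have "measure std_normal \<dots> = 1 - measure std_normal {..z}"
    by (rule prob_compl) auto
  finally show ?thesis by (simp add: Phi_def)
qed

lemma std_normal_density_uminus: "std_normal_density (- x) = std_normal_density x"
  by (simp add: std_normal_density_def)

lemma Phi_0: "Phi 0 = 1/2"
  using Phi_uminus[of 0] by simp

section \<open>Mills ratio and log-concavity\<close>

lemma std_normal_density_has_derivative:
  "(std_normal_density has_real_derivative (- x * std_normal_density x)) (at x)"
proof -
  have "((\<lambda>x. K * exp (- x\<^sup>2 / 2)) has_real_derivative (- x * (K * exp (- x\<^sup>2 / 2)))) (at x)" for K
    by (auto intro!: derivative_eq_intros)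
  then show ?thesis unfolding std_normal_density_def .
qed

text \<open>The left-hand side has derivative \<open>Phi\<close>, so it is nondecreasing and a
  negative value \<open>- e\<close> would persist everywhere to the left. There
  \<open>- x * Phi x\<close> would have to stay above \<open>e\<close>, against the decay given by
  \<open>Phi_chernoff\<close>.\<close>

lemma mills_ratio: "std_normal_density y + y * Phi y \<ge> 0"
proof (rule ccontr)
  let ?g = "\<lambda>y. std_normal_density y + y * Phi y"
  assume "\<not> ?g y \<ge> 0"
  then have neg: "?g y < 0" by simp
  define e where "e = - ?g y"
  have e: "e > 0" using neg by (simp add: e_def)
  have mono: "?g a \<le> ?g b" if "a \<le> b" for a b
  proof (rule DERIV_nonneg_imp_nondecreasing[OF that])
    fix x
    have "(?g has_real_derivative Phi x) (at x)"
      by (auto intro!: derivative_eq_intros Phi_has_derivative std_normal_density_has_derivative)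
    then show "\<exists>l. (?g has_real_derivative l) (at x) \<and> 0 \<le> l" using Phi_nonneg by blast
  qed
  have *: "e \<le> - x * exp (x + 1/2)" if "x \<le> min y 0" for x
  proof -
    have "?g x \<le> - e" using mono[of x y] that by (simp add: e_def)
    then have "e \<le> - x * Phi x" using std_normal_density_pos[of x] by simp
    also have "\<dots> \<le> - x * exp (1 * x + 1\<^sup>2/2)"
      by (intro mult_left_mono Phi_chernoff) (use that in auto)
    finally show ?thesis by simp
  qed
  have "((\<lambda>x::real. - x * exp (x + 1/2)) \<longlongrightarrow> 0) at_bot" by real_asymp
  then have "eventually (\<lambda>x::real. - x * exp (x + 1/2) < e) at_bot"
    using e by (rule order_tendstoD)
  moreover have "eventually (\<lambda>x. x \<le> min y 0) at_bot" by (rule eventually_le_at_bot)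
  ultimately have "eventually (\<lambda>x::real. False) at_bot"
    by eventually_elim (use * in force)
  then show False by simp
qed

text \<open>The derivative of ln \<open>Phi\<close>, known as the reversed hazard rate. Moreover
  \<open>- hazard t\<close> is the mean of a standard normal variable conditioned to lie below
  \<open>t\<close>, which is how it enters the mean-field estimates.\<close>

definition hazard :: "real \<Rightarrow> real" where
  "hazard t = std_normal_density t / Phi t"

lemma hazard_pos: "hazard t > 0"
  by (simp add: hazard_def Phi_pos std_normal_density_pos)

lemma hazard_has_derivative:
  "(hazard has_real_derivative - (std_normal_density x / (Phi x)\<^sup>2) * (std_normal_density x + x * Phi x)) (at x)"
  unfolding hazard_def[abs_def] using Phi_pos[of x]
  by (auto intro!: derivative_eq_intros Phi_has_derivative std_normal_density_has_derivative
      simp: power2_eq_square field_simps)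

text \<open>The derivative is a negative multiple of the expression in
  \<open>mills_ratio\<close>.\<close>

lemma hazard_antimono:
  assumes "s \<le> t" shows "hazard t \<le> hazard s"
proof (rule DERIV_nonpos_imp_nonincreasing[OF assms])
  fix x
  have "- (std_normal_density x / (Phi x)\<^sup>2) * (std_normal_density x + x * Phi x) \<le> 0"
    using mills_ratio[of x] std_normal_density_pos[of x] by (simp add: divide_nonneg_nonneg less_imp_le)
  then show "\<exists>l. (hazard has_real_derivative l) (at x) \<and> l \<le> 0"
    using hazard_has_derivative by blast
qed

text \<open>This is the log-concavity of \<open>Phi\<close>.\<close>

lemma Phi_tangent: "Phi y \<le> Phi t * exp (hazard t * (y - t))"
proof -
  let ?\<mu> = "hazard t"
  let ?F = "\<lambda>y. Phi y * exp (- ?\<mu> * y)"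
  have D: "(?F has_real_derivative exp (- ?\<mu> * x) * Phi x * (hazard x - ?\<mu>)) (at x)" for x
    using Phi_pos[of x]
    by (auto intro!: derivative_eq_intros Phi_has_derivative simp: hazard_def[of x] field_simps)
  \<comment> \<open>The derivative of \<open>?F\<close> has the sign of
    \<open>hazard x - ?\<mu>\<close>, so \<open>?F\<close> is largest at \<open>t\<close>.\<close>
  have "?F y \<le> ?F t"
  proof (cases "y \<le> t")
    case True
    show ?thesis
    proof (rule DERIV_nonneg_imp_nondecreasing[OF True])
      fix x assume "x \<le> t"
      then have "0 \<le> exp (- ?\<mu> * x) * Phi x * (hazard x - ?\<mu>)"
        using hazard_antimono[of x t] Phi_nonneg[of x] by simp
      then show "\<exists>l. (?F has_real_derivative l) (at x) \<and> 0 \<le> l" using D[of x] by blast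
    qed
  next
    case False
    show ?thesis
    proof (rule DERIV_nonpos_imp_nonincreasing[of t y])
      fix x assume "t \<le> x"
      then have "exp (- ?\<mu> * x) * Phi x * (hazard x - ?\<mu>) \<le> 0"
        using hazard_antimono[of t x] Phi_nonneg[of x] by (simp add: mult_nonneg_nonpos)
      then show "\<exists>l. (?F has_real_derivative l) (at x) \<and> l \<le> 0" using D[of x] by blast
    qed (use False in simp)
  qed
  then have "?F y * exp (?\<mu> * y) \<le> ?F t * exp (?\<mu> * y)" by (intro mult_right_mono) auto
  moreover have "?F y * exp (?\<mu> * y) = Phi y" by (simp add: mult.assoc flip: exp_add)
  moreover have "?F t * exp (?\<mu> * y) = Phi t * exp (?\<mu> * (y - t))"
    by (simp add: mult.assoc right_diff_distrib flip: exp_add)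
  ultimately show ?thesis by linarith
qed

text \<open>The tangent of ln \<open>Phi\<close> at \<open>t\<close> is the line of slope
  \<open>hazard t\<close> with this value at 0.\<close>

definition tilt_log :: "real \<Rightarrow> real" where
  "tilt_log t = ln (Phi t) - hazard t * t"

text \<open>Chosen to serve every case of \<open>ln_Phi_scaled_le\<close>: the square of
  \<open>hazard t\<close> pays for Chernoff bounds steeper than the tangent, the absolute value for
  rescaling the intercept.\<close>

definition tilt_slope :: "real \<Rightarrow> real" where
  "tilt_slope t = 2 * (hazard t)\<^sup>2 + \<bar>tilt_log t\<bar>"

lemma tilt_slope_nonneg: "tilt_slope t \<ge> 0"
  by (simp add: tilt_slope_def)

lemma ln_le_iff_le_exp: "0 < x \<Longrightarrow> ln x \<le> y \<longleftrightarrow> x \<le> exp (y::real)"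
  by (metis exp_le_cancel_iff exp_ln)

lemma ln_Phi_tangent: "ln (Phi z) \<le> tilt_log t + hazard t * z"
proof -
  have "ln (Phi z) \<le> ln (Phi t * exp (hazard t * (z - t)))"
    using Phi_tangent[of z t] Phi_pos by (subst ln_le_cancel_iff) auto
  also have "\<dots> = ln (Phi t) + hazard t * (z - t)"
    using Phi_pos[of t] by (simp add: ln_mult)
  finally show ?thesis by (simp add: tilt_log_def algebra_simps)
qed

lemma ln_Phi_chernoff: "\<tau> \<ge> 0 \<Longrightarrow> ln (Phi z) \<le> \<tau> * z + \<tau>\<^sup>2 / 2"
  using Phi_chernoff[of \<tau> z] Phi_pos[of z] by (subst ln_le_iff_le_exp) auto

text \<open>The bound at scale \<open>s\<close> interpolates between the tangent line (\<open>s = 1\<close>) and the Chernoff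
  bounds of slopes \<open>0\<close> and \<open>2 * hazard t\<close>.\<close>

lemma ln_Phi_scaled_le:
  assumes "s > 0"
  shows "ln (Phi z) \<le> tilt_log t + hazard t * (s * z) + tilt_slope t * \<bar>s\<^sup>2 - 1\<bar>"
proof -
  let ?\<mu> = "hazard t" and ?L = "tilt_log t" and ?x = "ln (Phi z)"
  have tangent: "?x \<le> ?L + ?\<mu> * z" by (rule ln_Phi_tangent)
  have mu: "?\<mu> > 0" by (rule hazard_pos)
  have L: "- ?L \<le> \<bar>?L\<bar>" "0 \<le> \<bar>?L\<bar>" by auto
  consider "s \<le> 1" | "1 \<le> s" "s \<le> 2" | "2 \<le> s" by linarith
  then show ?thesis
  proof cases
    case 1
    have s2: "1 - s \<le> \<bar>s\<^sup>2 - 1\<bar>"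
      using 1 assms by (simp add: abs_if power2_eq_square) (sos | (use mult_right_mono[of s 1 s] in linarith))
    have "s * ?x \<le> s * (?L + ?\<mu> * z)" using tangent assms by (intro mult_left_mono) auto
    moreover have "(1 - s) * ?x \<le> 0"
      using 1 Phi_le_1[of z] Phi_pos[of z] by (intro mult_nonneg_nonpos) auto
    moreover have "(1 - s) * (- ?L) \<le> \<bar>s\<^sup>2 - 1\<bar> * tilt_slope t"
    proof -
      have "(1 - s) * (- ?L) \<le> (1 - s) * \<bar>?L\<bar>" using 1 L by (intro mult_left_mono) auto
      also have "\<dots> \<le> \<bar>s\<^sup>2 - 1\<bar> * tilt_slope t"
        using s2 1 by (intro mult_mono) (auto simp: tilt_slope_def)
      finally show ?thesis .
    qed
    ultimately show ?thesis by (simp add: algebra_simps)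
  next
    case 2
    define w where "w = s - 1"
    have w: "0 \<le> w" "w \<le> 1" using 2 by (auto simp: w_def)
    have s2: "w \<le> \<bar>s\<^sup>2 - 1\<bar>" 
    proof -
      have "0 \<le> w\<^sup>2" by simp
      then have "w \<le> s\<^sup>2 - 1" using w by (simp add: w_def power2_eq_square algebra_simps)
      then show ?thesis by linarith
    qed
    have "(1 - w) * ?x \<le> (1 - w) * (?L + ?\<mu> * z)" using tangent w by (intro mult_left_mono) auto
    moreover have "w * ?x \<le> w * ((2 * ?\<mu>) * z + (2 * ?\<mu>)\<^sup>2 / 2)"
      using mu w by (intro mult_left_mono ln_Phi_chernoff) auto
    moreover have "w * (2 * ?\<mu>\<^sup>2 - ?L) \<le> \<bar>s\<^sup>2 - 1\<bar> * tilt_slope t"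
    proof -
      have "2 * ?\<mu>\<^sup>2 - ?L \<le> tilt_slope t" by (simp add: tilt_slope_def)
      then have "w * (2 * ?\<mu>\<^sup>2 - ?L) \<le> w * tilt_slope t" using w by (intro mult_left_mono)
      also have "\<dots> \<le> \<bar>s\<^sup>2 - 1\<bar> * tilt_slope t" using s2 tilt_slope_nonneg by (intro mult_right_mono)
      finally show ?thesis .
    qed
    ultimately show ?thesis by (simp add: algebra_simps w_def power2_eq_square)
  next
    \<comment> \<open>Beyond scale 2 there is no interpolation: one Chernoff bound of slope
      \<open>?\<mu> * s\<close> already has the right linear term, and its error is quadratic in
      \<open>s\<close>, hence of the order of \<open>s\<^sup>2 - 1\<close>.\<close>
    case 3
    have s4: "4 \<le> s\<^sup>2" using power_mono[of 2 s 2] 3 by simp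
    have "?x \<le> (?\<mu> * s) * z + (?\<mu> * s)\<^sup>2 / 2"
      using mu 3 by (intro ln_Phi_chernoff) auto
    moreover have "?\<mu>\<^sup>2 * (s\<^sup>2 / 2) \<le> ?\<mu>\<^sup>2 * (2 * (s\<^sup>2 - 1))"
      using s4 by (intro mult_left_mono) auto
    moreover have "1 * \<bar>?L\<bar> \<le> (s\<^sup>2 - 1) * \<bar>?L\<bar>"
      using s4 by (intro mult_right_mono) auto
    ultimately show ?thesis using s4 L
      by (simp add: tilt_slope_def algebra_simps)
  qed
qed

text \<open>With \<open>z = Y / sqrt u\<close> and \<open>s = sqrt u\<close> in
  \<open>ln_Phi_scaled_le\<close> the linear term becomes \<open>hazard t * Y\<close>, free of
  \<open>u\<close>. Thus one exponent serves for every length of the revealed vector, up to an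
  additive error.\<close>

lemma emeasure_scaled_halfline_le:
  assumes "u \<ge> 0"
  shows "emeasure std_normal {x. sqrt u * x \<le> Y}
    \<le> ennreal (exp (tilt_log t + hazard t * Y + tilt_slope t * \<bar>u - 1\<bar>))"
proof (cases "u = 0")
  \<comment> \<open>A revealed vector of length 0 makes the half-line everything or nothing,
    depending on the sign of \<open>Y\<close>.\<close>
  case True
  interpret prob_space std_normal by (rule prob_space_std_normal)
  show ?thesis
  proof (cases "Y \<ge> 0")
    case Y: True
    have "0 \<le> tilt_log t + hazard t * Y + tilt_slope t"
    proof -
      have "0 \<le> hazard t * Y" using Y hazard_pos[of t] by simp
      moreover have "0 \<le> tilt_log t + \<bar>tilt_log t\<bar>" by simp
      ultimately show ?thesis unfolding tilt_slope_def using zero_le_power2[of "hazard t"] by linarith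
    qed
    then have "1 \<le> exp (tilt_log t + hazard t * Y + tilt_slope t)" by simp
    then show ?thesis using True by (auto intro!: order_trans[OF emeasure_le_1])
  next
    case False
    then show ?thesis using True by simp
  qed
next
  case False
  then have u: "sqrt u > 0" using assms by simp
  then have "{x. sqrt u * x \<le> Y} = {..Y / sqrt u}" by (auto simp: field_simps)
  then have "emeasure std_normal {x. sqrt u * x \<le> Y} = ennreal (Phi (Y / sqrt u))"
    by (simp add: ennreal_Phi)
  also have "Phi (Y / sqrt u) \<le> exp (tilt_log t + hazard t * Y + tilt_slope t * \<bar>u - 1\<bar>)"
    using ln_Phi_scaled_le[OF u, of "Y / sqrt u" t] u Phi_pos[of "Y / sqrt u"] assms
    by (subst (asm) ln_le_iff_le_exp) auto
  finally show ?thesis by (simp add: ennreal_leI)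
qed

text \<open>The tilt moves the mean to \<theta> and thereby the threshold by
  \<open>sqrt u * \<theta>\<close>.\<close>

lemma nn_integral_scaled_halfline_tilt_le:
  assumes "u \<ge> 0"
  shows "(\<integral>\<^sup>+x. indicator {x. sqrt u * x \<le> Y} x * ennreal (exp (\<theta> * x)) \<partial>std_normal)
    \<le> ennreal (exp (\<theta>\<^sup>2 / 2 + tilt_log t + hazard t * (Y - sqrt u * \<theta>) + tilt_slope t * \<bar>u - 1\<bar>))"
proof -
  have "(\<integral>\<^sup>+x. indicator {x. sqrt u * x \<le> Y} x * ennreal (exp (\<theta> * x)) \<partial>std_normal)
    = ennreal (exp (\<theta>\<^sup>2 / 2)) * (\<integral>\<^sup>+x. indicator {x. sqrt u * x \<le> Y} (x + \<theta>) \<partial>std_normal)"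
    by (rule nn_integral_std_normal_shift) measurable
  also have "(\<integral>\<^sup>+x. indicator {x. sqrt u * x \<le> Y} (x + \<theta>) \<partial>std_normal)
    = (\<integral>\<^sup>+x. indicator {x. sqrt u * x \<le> Y - sqrt u * \<theta>} x \<partial>std_normal)"
    by (intro nn_integral_cong) (auto simp: indicator_def algebra_simps)
  also have "\<dots> = emeasure std_normal {x. sqrt u * x \<le> Y - sqrt u * \<theta>}"
    by (rule nn_integral_indicator) simp
  also have "ennreal (exp (\<theta>\<^sup>2 / 2)) * \<dots> \<le> ennreal (exp (\<theta>\<^sup>2 / 2)) *
     ennreal (exp (tilt_log t + hazard t * (Y - sqrt u * \<theta>) + tilt_slope t * \<bar>u - 1\<bar>))"
    by (intro mult_left_mono emeasure_scaled_halfline_le assms) simp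
  finally show ?thesis by (simp add: add.assoc flip: ennreal_mult exp_add)
qed

interpretation std: product_sigma_finite "\<lambda>_::nat. std_normal"
  by (intro product_sigma_finite.intro prob_space_imp_sigma_finite prob_space_std_normal)

text \<open>Turns the interaction of pairs into the square of one scalar, the column sum, which can
  then be linearised.\<close>

lemma sum_less_mult_eq:
  fixes A :: "nat \<Rightarrow> real"
  shows "(\<Sum>j<m. \<Sum>i<j. A i * A j) = ((\<Sum>i<m. A i)\<^sup>2 - (\<Sum>i<m. (A i)\<^sup>2)) / 2"
proof (induction m)
  case (Suc m)
  have "(\<Sum>i<m. A i * A m) = (\<Sum>i<m. A i) * A m" by (simp add: sum_distrib_right)
  then show ?case using Suc by (simp add: power2_eq_square field_simps)
qed simp

lemma inverse_one_minus_le: "0 \<le> y \<Longrightarrow> y \<le> 1/2 \<Longrightarrow> 1 / (1 - y) \<le> 1 + 2 * (y::real)"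
  by (simp add: field_simps) (use mult_left_mono[of y "1/2" y] in \<open>simp add: algebra_simps\<close>)

lemma inverse_sqrt_one_minus_le:
  assumes "0 \<le> y" "y \<le> 1/2"
  shows "1 / sqrt (1 - y) \<le> exp y"
proof -
  have "1 / sqrt (1 - y) = sqrt (1 / (1 - y))" by (simp add: real_sqrt_divide)
  also have "\<dots> \<le> sqrt (exp (2 * y))"
    using inverse_one_minus_le[OF assms] exp_ge_add_one_self[of "2 * y"]
    by (intro real_sqrt_le_mono) linarith
  also have "\<dots> = exp y" by (simp add: exp_double)
  finally show ?thesis .
qed

lemma sqrt_ge_one_minus_abs: "u \<ge> 0 \<Longrightarrow> 1 - \<bar>u - 1\<bar> \<le> sqrt u"
proof (cases "u \<le> 1")
  case True
  assume "u \<ge> 0"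
  then have "u * u \<le> u * 1" using True by (intro mult_left_mono) auto
  then have "u \<le> sqrt u" by (intro real_le_rsqrt) (simp add: power2_eq_square)
  then show ?thesis using True by simp
next
  case False
  then have "1 \<le> sqrt u" by simp
  then show ?thesis by linarith
qed

section \<open>Integrating out one column\<close>

text \<open>The contribution of one revealed vertex: \<open>A i\<close> is the coordinate of the
  \<open>i\<close>-th other vector along it, \<open>u\<close> its normalised squared length,
  \<open>Y\<close> the thresholds of its edges. The exponential records how a bound linear in the
  thresholds changes when the products \<open>A i * A j\<close> shift the remaining ones; the sign
  of \<gamma> is that of the colour.\<close>

definition column_integral :: "real \<Rightarrow> nat \<Rightarrow> real \<Rightarrow> (nat \<Rightarrow> real) \<Rightarrow> ennreal" where
  "column_integral \<gamma> m u Y = (\<integral>\<^sup>+A. (\<Prod>i<m. indicator {x. sqrt u * x \<le> Y i} (A i)) *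
      ennreal (exp (- \<gamma> * (\<Sum>j<m. \<Sum>i<j. A i * A j))) \<partial>Pi\<^sub>M {..<m} (\<lambda>_. std_normal))"

text \<open>The square of the column sum is linearised around its typical value \<open>- hazard t * m\<close>.\<close>

lemma column_integral_pos_le:
  assumes u: "u \<ge> 0" and \<gamma>: "0 < \<gamma>" "\<gamma> \<le> 1/2" "real m * \<gamma> \<le> 1/2"
  shows "column_integral \<gamma> m u Y \<le> ennreal (exp ((\<Sum>i<m. tilt_log t + hazard t * Y i)
    - (hazard t)\<^sup>2 * \<gamma> * (real m)\<^sup>2 / 2 + (hazard t)\<^sup>2 * \<gamma>\<^sup>2 * real m ^ 3
    + (1 + 2 * tilt_slope t) + (2 * tilt_slope t + (hazard t)\<^sup>2) * real m * \<bar>u - 1\<bar>))"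
proof -
  let ?I = "\<lambda>i. indicator {x. sqrt u * x \<le> Y i} :: real \<Rightarrow> ennreal"
  let ?\<mu> = "hazard t" and ?L = "tilt_log t" and ?M = "tilt_slope t"
  \<comment> \<open>\<open>- w\<close> is the mean of the column sum when every entry is conditioned
    to lie below \<open>t\<close>, and \<theta> is the slope of the tangent to the exponent at that
    point.\<close>
  define w where "w = ?\<mu> * real m"
  define \<theta> where "\<theta> = \<gamma> * w"
  define r where "r = sqrt (1 - \<gamma>)"
  \<comment> \<open>The diagonal weight \<open>\<gamma> * x\<^sup>2 / 2\<close> changes the variance
    to \<open>1 / (1 - \<gamma>)\<close>, which acts like replacing \<open>u\<close> by
    \<open>u'\<close>.\<close>
  define u' where "u' = u / (1 - \<gamma>)"
  have mu: "?\<mu> > 0" by (rule hazard_pos)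
  have M: "?M \<ge> 0" by (rule tilt_slope_nonneg)
  have th: "\<theta> \<ge> 0" using mu \<gamma> by (simp add: \<theta>_def w_def)
  have r: "r > 0" "r\<^sup>2 = 1 - \<gamma>" using \<gamma> by (auto simp: r_def)
  define E where "E i = \<gamma> + \<theta>\<^sup>2 + ?L + ?\<mu> * Y i - ?\<mu> * \<theta> * (1 - \<bar>u - 1\<bar>) + ?M * (2 * \<bar>u - 1\<bar> + 2 * \<gamma>)" for i
  have I: "(\<integral>\<^sup>+x. ?I i x * ennreal (exp (\<theta> * x + \<gamma> * x\<^sup>2 / 2)) \<partial>std_normal) \<le> ennreal (exp (E i))" for i
  proof -
    have "(\<integral>\<^sup>+x. ?I i x * ennreal (exp (\<theta> * x + \<gamma> * x\<^sup>2 / 2)) \<partial>std_normal)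
       = (\<integral>\<^sup>+x. (?I i x * ennreal (exp (\<theta> * x))) * ennreal (exp (\<gamma> * x\<^sup>2 / 2)) \<partial>std_normal)"
      by (simp add: exp_add ennreal_mult mult.assoc)
    also have "\<dots> = ennreal (1 / r) * (\<integral>\<^sup>+x. ?I i (x / r) * ennreal (exp (\<theta> * (x / r))) \<partial>std_normal)"
      unfolding r_def by (rule nn_integral_std_normal_scale) (use \<gamma> in auto)
    also have "(\<integral>\<^sup>+x. ?I i (x / r) * ennreal (exp (\<theta> * (x / r))) \<partial>std_normal)
       = (\<integral>\<^sup>+x. indicator {x. sqrt u' * x \<le> Y i} x * ennreal (exp ((\<theta> / r) * x)) \<partial>std_normal)"
      by (intro nn_integral_cong) (auto simp: indicator_def u'_def real_sqrt_divide r_def)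
    also have "ennreal (1 / r) * \<dots> \<le> ennreal (1 / r) *
        ennreal (exp ((\<theta> / r)\<^sup>2 / 2 + ?L + ?\<mu> * (Y i - sqrt u' * (\<theta> / r)) + ?M * \<bar>u' - 1\<bar>))"
      by (intro mult_left_mono nn_integral_scaled_halfline_tilt_le) (use u \<gamma> in \<open>simp_all add: u'_def\<close>)
    also have "\<dots> \<le> ennreal (exp \<gamma> * exp ((\<theta> / r)\<^sup>2 / 2 + ?L + ?\<mu> * (Y i - sqrt u' * (\<theta> / r)) + ?M * \<bar>u' - 1\<bar>))"
      using inverse_sqrt_one_minus_le[of \<gamma>] \<gamma>
      by (subst ennreal_mult) (auto intro!: mult_right_mono ennreal_leI simp: r_def)
    also have "\<dots> \<le> ennreal (exp (E i))"
    proof (rule ennreal_leI)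
      have inv: "1 \<le> 1 / (1 - \<gamma>)" "1 / (1 - \<gamma>) \<le> 2" using \<gamma> by (auto simp: field_simps)
      have 1: "(\<theta> / r)\<^sup>2 / 2 \<le> \<theta>\<^sup>2"
      proof -
        have "(\<theta> / r)\<^sup>2 / 2 = \<theta>\<^sup>2 * (1 / (1 - \<gamma>)) / 2" using r by (simp add: power_divide)
        also have "\<dots> \<le> \<theta>\<^sup>2 * 2 / 2" using inv by (intro divide_right_mono mult_left_mono) auto
        finally show ?thesis by simp
      qed
      have "sqrt u' * (\<theta> / r) = (sqrt u * \<theta>) * (1 / (1 - \<gamma>))"
        using \<gamma> by (simp add: u'_def r_def real_sqrt_divide)
      also have "\<dots> \<ge> (sqrt u * \<theta>) * 1" using inv u th by (intro mult_left_mono) auto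
      finally have "sqrt u * \<theta> \<le> sqrt u' * (\<theta> / r)" by simp
      moreover have "(1 - \<bar>u - 1\<bar>) * \<theta> \<le> sqrt u * \<theta>"
        using sqrt_ge_one_minus_abs[OF u] th by (intro mult_right_mono)
      ultimately have "?\<mu> * ((1 - \<bar>u - 1\<bar>) * \<theta>) \<le> ?\<mu> * (sqrt u' * (\<theta> / r))"
        using mu by (intro mult_left_mono) auto
      then have 2: "?\<mu> * (Y i - sqrt u' * (\<theta> / r)) \<le> ?\<mu> * Y i - ?\<mu> * \<theta> * (1 - \<bar>u - 1\<bar>)"
        by (simp add: algebra_simps)
      have "u' - 1 = (u - 1 + \<gamma>) * (1 / (1 - \<gamma>))" using \<gamma> by (simp add: u'_def field_simps)
      then have "\<bar>u' - 1\<bar> = \<bar>u - 1 + \<gamma>\<bar> * (1 / (1 - \<gamma>))" using \<gamma> by (simp add: abs_mult)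
      also have "\<dots> \<le> (\<bar>u - 1\<bar> + \<gamma>) * 2" using inv \<gamma> by (intro mult_mono) auto
      finally have 3: "?M * \<bar>u' - 1\<bar> \<le> ?M * (2 * \<bar>u - 1\<bar> + 2 * \<gamma>)"
        using M by (intro mult_left_mono) auto
      show "exp \<gamma> * exp ((\<theta> / r)\<^sup>2 / 2 + ?L + ?\<mu> * (Y i - sqrt u' * (\<theta> / r)) + ?M * \<bar>u' - 1\<bar>) \<le> exp (E i)"
        unfolding exp_add[symmetric] E_def using 1 2 3 by simp
    qed
    finally show ?thesis .
  qed
  \<comment> \<open>This is \<open>0 \<le> (?T + w)\<^sup>2\<close>. The squares of the entries
    appear because the sum on the left runs over distinct pairs only.\<close>
  have pt: "- \<gamma> * (\<Sum>j<m. \<Sum>i<j. A i * A j) \<le> \<gamma> * w\<^sup>2 / 2 + (\<Sum>i<m. \<theta> * A i + \<gamma> * (A i)\<^sup>2 / 2)" for A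
  proof -
    let ?T = "\<Sum>i<m. A i"
    have "0 \<le> \<gamma> / 2 * (?T + w)\<^sup>2" using \<gamma> by simp
    moreover have "(\<Sum>i<m. \<theta> * A i + \<gamma> * (A i)\<^sup>2 / 2) = \<theta> * ?T + \<gamma> / 2 * (\<Sum>i<m. (A i)\<^sup>2)"
      by (simp add: sum.distrib sum_distrib_left)
    ultimately show ?thesis
      unfolding sum_less_mult_eq by (simp add: \<theta>_def power2_eq_square field_simps)
  qed
  have "column_integral \<gamma> m u Y \<le> (\<integral>\<^sup>+A. ennreal (exp (\<gamma> * w\<^sup>2 / 2)) *
     (\<Prod>i<m. ?I i (A i) * ennreal (exp (\<theta> * A i + \<gamma> * (A i)\<^sup>2 / 2))) \<partial>Pi\<^sub>M {..<m} (\<lambda>_. std_normal))"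
    unfolding column_integral_def
  proof (rule nn_integral_mono)
    fix A :: "nat \<Rightarrow> real"
    have "ennreal (exp (- \<gamma> * (\<Sum>j<m. \<Sum>i<j. A i * A j))) \<le> ennreal (exp (\<gamma> * w\<^sup>2 / 2)) * (\<Prod>i<m. ennreal (exp (\<theta> * A i + \<gamma> * (A i)\<^sup>2 / 2)))"
      using pt[of A] by (simp add: prod_ennreal flip: ennreal_mult exp_sum exp_add)
    then have "(\<Prod>i<m. ?I i (A i)) * ennreal (exp (- \<gamma> * (\<Sum>j<m. \<Sum>i<j. A i * A j)))
      \<le> (\<Prod>i<m. ?I i (A i)) * (ennreal (exp (\<gamma> * w\<^sup>2 / 2)) * (\<Prod>i<m. ennreal (exp (\<theta> * A i + \<gamma> * (A i)\<^sup>2 / 2))))"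
      by (intro mult_left_mono) auto
    then show "(\<Prod>i<m. ?I i (A i)) * ennreal (exp (- \<gamma> * (\<Sum>j<m. \<Sum>i<j. A i * A j)))
      \<le> ennreal (exp (\<gamma> * w\<^sup>2 / 2)) * (\<Prod>i<m. ?I i (A i) * ennreal (exp (\<theta> * A i + \<gamma> * (A i)\<^sup>2 / 2)))"
      by (simp add: prod.distrib mult_ac)
  qed
  also have "\<dots> = ennreal (exp (\<gamma> * w\<^sup>2 / 2)) *
     (\<Prod>i<m. \<integral>\<^sup>+x. ?I i x * ennreal (exp (\<theta> * x + \<gamma> * x\<^sup>2 / 2)) \<partial>std_normal)"
    by (subst nn_integral_cmult, measurable, subst std.product_nn_integral_prod) auto
  also have "\<dots> \<le> ennreal (exp (\<gamma> * w\<^sup>2 / 2)) * (\<Prod>i<m. ennreal (exp (E i)))"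
    by (intro mult_left_mono prod_mono_ennreal I) auto
  also have "\<dots> = ennreal (exp (\<gamma> * w\<^sup>2 / 2 + (\<Sum>i<m. E i)))"
    by (simp add: prod_ennreal exp_sum exp_add ennreal_mult prod_nonneg)
  also have "\<dots> \<le> ennreal (exp ((\<Sum>i<m. ?L + ?\<mu> * Y i)
    - ?\<mu>\<^sup>2 * \<gamma> * (real m)\<^sup>2 / 2 + ?\<mu>\<^sup>2 * \<gamma>\<^sup>2 * real m ^ 3
    + (1 + 2 * ?M) + (2 * ?M + ?\<mu>\<^sup>2) * real m * \<bar>u - 1\<bar>))"
  \<comment> \<open>The gain is the balance of \<open>\<gamma> * w\<^sup>2 / 2\<close> against
    \<open>real m * ?\<mu> * \<theta>\<close>, which equals \<open>\<gamma> * w\<^sup>2\<close>; the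
    \<open>m\<close> terms \<open>\<theta>\<^sup>2\<close> give the cubic error.\<close>
  proof (intro ennreal_leI, unfold exp_le_cancel_iff)
    have "(\<Sum>i<m. E i) = (\<Sum>i<m. ?L + ?\<mu> * Y i) + real m * (\<gamma> + \<theta>\<^sup>2 - ?\<mu> * \<theta> * (1 - \<bar>u - 1\<bar>) + ?M * (2 * \<bar>u - 1\<bar> + 2 * \<gamma>))"
      by (simp add: E_def sum.distrib sum_subtractf algebra_simps)
    moreover have "(real m * \<gamma>) * (1 + 2 * ?M) \<le> 1 * (1 + 2 * ?M)" using \<gamma> M by (intro mult_right_mono) auto
    moreover have "(real m * \<gamma>) * (?\<mu>\<^sup>2 * real m * \<bar>u - 1\<bar>) \<le> 1 * (?\<mu>\<^sup>2 * real m * \<bar>u - 1\<bar>)"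
      using \<gamma> by (intro mult_right_mono) auto
    ultimately show "\<gamma> * w\<^sup>2 / 2 + (\<Sum>i<m. E i) \<le> (\<Sum>i<m. ?L + ?\<mu> * Y i)
    - ?\<mu>\<^sup>2 * \<gamma> * (real m)\<^sup>2 / 2 + ?\<mu>\<^sup>2 * \<gamma>\<^sup>2 * real m ^ 3
    + (1 + 2 * ?M) + (2 * ?M + ?\<mu>\<^sup>2) * real m * \<bar>u - 1\<bar>"
      by (simp add: \<theta>_def w_def algebra_simps power2_eq_square power3_eq_cube)
  qed
  finally show ?thesis .
qed

text \<open>Here the square of the column sum is linearised by a Gaussian (Hubbard--Stratonovich)
  integral over an auxiliary variable.\<close>

lemma column_integral_neg_le:
  assumes u: "u \<ge> 0" and \<gamma>: "0 < \<gamma>" "real m * \<gamma> \<le> 1/2"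
  shows "column_integral (- \<gamma>) m u Y \<le> ennreal (exp ((\<Sum>i<m. tilt_log t + hazard t * Y i)
    + (hazard t)\<^sup>2 * \<gamma> * (real m)\<^sup>2 / 2 + (hazard t)\<^sup>2 * \<gamma>\<^sup>2 * real m ^ 3
    + (1 + 2 * tilt_slope t) + (2 * tilt_slope t + (hazard t)\<^sup>2) * real m * \<bar>u - 1\<bar>))"
proof -
  let ?I = "\<lambda>i. indicator {x. sqrt u * x \<le> Y i} :: real \<Rightarrow> ennreal"
  let ?\<mu> = "hazard t" and ?L = "tilt_log t" and ?M = "tilt_slope t"
  let ?P = "Pi\<^sub>M {..<m} (\<lambda>_. std_normal)"
  interpret N: prob_space std_normal by (rule prob_space_std_normal)
  interpret P: prob_space ?P by (intro prob_space_PiM prob_space_std_normal)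
  interpret PN: pair_sigma_finite ?P std_normal ..
  have mu: "?\<mu> > 0" by (rule hazard_pos)
  have M: "?M \<ge> 0" by (rule tilt_slope_nonneg)
  define S where "S = (\<Sum>i<m. ?L + ?\<mu> * Y i)"
  \<comment> \<open>For this sign of the interaction the squares of the entries only help and are
    dropped.\<close>
  have "column_integral (- \<gamma>) m u Y \<le> (\<integral>\<^sup>+A. (\<Prod>i<m. ?I i (A i)) *
      ennreal (exp ((sqrt \<gamma> * (\<Sum>i<m. A i))\<^sup>2 / 2)) \<partial>?P)"
    unfolding column_integral_def
  proof (intro nn_integral_mono mult_left_mono ennreal_leI)
    fix A :: "nat \<Rightarrow> real"
    have "0 \<le> \<gamma> / 2 * (\<Sum>i<m. (A i)\<^sup>2)" using \<gamma> by (intro mult_nonneg_nonneg sum_nonneg) auto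
    then show "exp (- (- \<gamma>) * (\<Sum>j<m. \<Sum>i<j. A i * A j)) \<le> exp ((sqrt \<gamma> * (\<Sum>i<m. A i))\<^sup>2 / 2)"
      using \<gamma> by (simp add: sum_less_mult_eq power_mult_distrib right_diff_distrib diff_divide_distrib)
  qed auto
  also have "\<dots> = (\<integral>\<^sup>+A. (\<integral>\<^sup>+h. (\<Prod>i<m. ?I i (A i)) *
      ennreal (exp (sqrt \<gamma> * (\<Sum>i<m. A i) * h)) \<partial>std_normal) \<partial>?P)"
    by (subst nn_integral_cmult) (auto simp: nn_integral_std_normal_exp)
  also have "\<dots> = (\<integral>\<^sup>+h. (\<integral>\<^sup>+A. (\<Prod>i<m. ?I i (A i)) *
      ennreal (exp (sqrt \<gamma> * (\<Sum>i<m. A i) * h)) \<partial>?P) \<partial>std_normal)"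
    by (rule PN.Fubini'[symmetric]) measurable
  also have "\<dots> = (\<integral>\<^sup>+h. (\<integral>\<^sup>+A. (\<Prod>i<m. ?I i (A i) * ennreal (exp ((sqrt \<gamma> * h) * A i))) \<partial>?P) \<partial>std_normal)"
    by (intro nn_integral_cong)
       (simp add: prod.distrib prod_ennreal sum_distrib_left sum_distrib_right mult_ac flip: exp_sum)
  also have "\<dots> = (\<integral>\<^sup>+h. (\<Prod>i<m. \<integral>\<^sup>+x. ?I i x * ennreal (exp ((sqrt \<gamma> * h) * x)) \<partial>std_normal) \<partial>std_normal)"
    by (subst std.product_nn_integral_prod) auto
  also have "\<dots> \<le> (\<integral>\<^sup>+h. (\<Prod>i<m. ennreal (exp ((sqrt \<gamma> * h)\<^sup>2 / 2 + ?L + ?\<mu> * (Y i - sqrt u * (sqrt \<gamma> * h)) + ?M * \<bar>u - 1\<bar>))) \<partial>std_normal)"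
    by (intro nn_integral_mono prod_mono_ennreal nn_integral_scaled_halfline_tilt_le u)
  \<comment> \<open>A single Gaussian integral in \<open>h\<close> is left. Each entry contributes
    \<open>\<gamma> * h\<^sup>2 / 2\<close>, so it is finite only for
    \<open>real m * \<gamma> < 1\<close>, and the factor \<open>1 / (1 - real m * \<gamma>)\<close>
    is the source of the cubic error.\<close>
  also have "\<dots> = (\<integral>\<^sup>+h. ennreal (exp (S + real m * ?M * \<bar>u - 1\<bar>)) * ennreal (exp ((real m * \<gamma>) * h\<^sup>2 / 2 + (- real m * ?\<mu> * sqrt u * sqrt \<gamma>) * h)) \<partial>std_normal)"
  proof (rule nn_integral_cong)
    fix h :: real
    have "(\<Sum>i<m. (sqrt \<gamma> * h)\<^sup>2 / 2 + ?L + ?\<mu> * (Y i - sqrt u * (sqrt \<gamma> * h)) + ?M * \<bar>u - 1\<bar>)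
       = S + real m * ?M * \<bar>u - 1\<bar> + ((real m * \<gamma>) * h\<^sup>2 / 2 + (- real m * ?\<mu> * sqrt u * sqrt \<gamma>) * h)"
      using \<gamma> by (simp add: S_def sum.distrib sum_subtractf power_mult_distrib algebra_simps)
    then show "(\<Prod>i<m. ennreal (exp ((sqrt \<gamma> * h)\<^sup>2 / 2 + ?L + ?\<mu> * (Y i - sqrt u * (sqrt \<gamma> * h)) + ?M * \<bar>u - 1\<bar>)))
       = ennreal (exp (S + real m * ?M * \<bar>u - 1\<bar>)) * ennreal (exp ((real m * \<gamma>) * h\<^sup>2 / 2 + (- real m * ?\<mu> * sqrt u * sqrt \<gamma>) * h))"
      by (simp add: prod_ennreal flip: exp_sum ennreal_mult exp_add)
  qed
  also have "\<dots> = ennreal (exp (S + real m * ?M * \<bar>u - 1\<bar>)) * ennreal (1 / sqrt (1 - real m * \<gamma>) *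
      exp ((- real m * ?\<mu> * sqrt u * sqrt \<gamma>)\<^sup>2 / (2 * (1 - real m * \<gamma>))))"
    by (subst nn_integral_cmult, simp, subst nn_integral_std_normal_exp_quadratic) (use \<gamma> in auto)
  also have "\<dots> \<le> ennreal (exp (S + real m * ?M * \<bar>u - 1\<bar>)) * ennreal (exp (real m * \<gamma>) *
      exp ((- real m * ?\<mu> * sqrt u * sqrt \<gamma>)\<^sup>2 / (2 * (1 - real m * \<gamma>))))"
    using \<gamma> inverse_sqrt_one_minus_le[of "real m * \<gamma>"]
    by (intro mult_left_mono ennreal_leI mult_right_mono) auto
  also have "\<dots> = ennreal (exp (S + real m * ?M * \<bar>u - 1\<bar> + real m * \<gamma> +
      (- real m * ?\<mu> * sqrt u * sqrt \<gamma>)\<^sup>2 / (2 * (1 - real m * \<gamma>))))"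
    by (simp add: add.assoc flip: exp_add ennreal_mult)
  also have "\<dots> \<le> ennreal (exp (S + ?\<mu>\<^sup>2 * \<gamma> * (real m)\<^sup>2 / 2 + ?\<mu>\<^sup>2 * \<gamma>\<^sup>2 * real m ^ 3
    + (1 + 2 * ?M) + (2 * ?M + ?\<mu>\<^sup>2) * real m * \<bar>u - 1\<bar>))"
  proof (intro ennreal_leI, unfold exp_le_cancel_iff)
    let ?y = "real m * \<gamma>"
    let ?Q = "?\<mu>\<^sup>2 * \<gamma> * (real m)\<^sup>2 / 2 + ?\<mu>\<^sup>2 * \<gamma>\<^sup>2 * real m ^ 3"
    have Q0: "?Q \<ge> 0" using \<gamma> by simp
    have "(- real m * ?\<mu> * sqrt u * sqrt \<gamma>)\<^sup>2 / (2 * (1 - ?y)) = ?\<mu>\<^sup>2 * \<gamma> * (real m)\<^sup>2 / 2 * u * (1 / (1 - ?y))"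
      using u \<gamma> by (simp add: power_mult_distrib)
    also have "\<dots> \<le> ?\<mu>\<^sup>2 * \<gamma> * (real m)\<^sup>2 / 2 * u * (1 + 2 * ?y)"
      using u \<gamma> by (intro mult_left_mono inverse_one_minus_le) auto
    also have "\<dots> = ?Q * u" by (simp add: algebra_simps power2_eq_square power3_eq_cube)
    also have "\<dots> \<le> ?Q * (1 + \<bar>u - 1\<bar>)" using Q0 by (intro mult_left_mono) auto
    also have "\<dots> = ?Q + ?Q * \<bar>u - 1\<bar>" by (simp add: algebra_simps)
    also have "?Q * \<bar>u - 1\<bar> \<le> (?\<mu>\<^sup>2 * real m) * \<bar>u - 1\<bar>"
    proof (rule mult_right_mono)
      have "?Q = (?\<mu>\<^sup>2 * real m) * (?y / 2 + ?y\<^sup>2)" by (simp add: algebra_simps power2_eq_square power3_eq_cube)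
      also have "?y\<^sup>2 \<le> (1/2)\<^sup>2" using \<gamma> by (intro power_mono) auto
      then have "(?\<mu>\<^sup>2 * real m) * (?y / 2 + ?y\<^sup>2) \<le> (?\<mu>\<^sup>2 * real m) * 1"
        using \<gamma> by (intro mult_left_mono) (auto simp: power2_eq_square)
      finally show "?Q \<le> ?\<mu>\<^sup>2 * real m" by simp
    qed simp
    finally have 1: "(- real m * ?\<mu> * sqrt u * sqrt \<gamma>)\<^sup>2 / (2 * (1 - ?y)) \<le> ?Q + (?\<mu>\<^sup>2 * real m) * \<bar>u - 1\<bar>" by simp
    have 2: "0 \<le> real m * ?M * \<bar>u - 1\<bar>" using M by simp
    show "S + real m * ?M * \<bar>u - 1\<bar> + real m * \<gamma> + (- real m * ?\<mu> * sqrt u * sqrt \<gamma>)\<^sup>2 / (2 * (1 - ?y))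
      \<le> S + ?\<mu>\<^sup>2 * \<gamma> * (real m)\<^sup>2 / 2 + ?\<mu>\<^sup>2 * \<gamma>\<^sup>2 * real m ^ 3
      + (1 + 2 * ?M) + (2 * ?M + ?\<mu>\<^sup>2) * real m * \<bar>u - 1\<bar>"
    proof -
      have "(2 * ?M + ?\<mu>\<^sup>2) * real m * \<bar>u - 1\<bar> = 2 * (real m * ?M * \<bar>u - 1\<bar>) + (?\<mu>\<^sup>2 * real m) * \<bar>u - 1\<bar>"
        by (simp add: algebra_simps)
      then show ?thesis using 1 2 \<gamma>(2) M by linarith
    qed
  qed
  finally show ?thesis unfolding S_def .
qed

section \<open>Gaussian vectors and rotations\<close>

definition gauss :: "nat \<Rightarrow> (nat \<Rightarrow> real) measure" where
  "gauss k = Pi\<^sub>M {..k} (\<lambda>_. std_normal)"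

definition gauss_points :: "nat \<Rightarrow> nat \<Rightarrow> (nat \<Rightarrow> nat \<Rightarrow> real) measure" where
  "gauss_points k n = Pi\<^sub>M {..<n} (\<lambda>_. gauss k)"

lemma sets_gauss[measurable_cong]: "sets (gauss k) = sets (Pi\<^sub>M {..k} (\<lambda>_. borel))"
  unfolding gauss_def by (intro sets_PiM_cong) auto

lemma sets_gauss_points[measurable_cong]:
  "sets (gauss_points k n) = sets (Pi\<^sub>M {..<n} (\<lambda>_. Pi\<^sub>M {..k} (\<lambda>_. borel)))"
  unfolding gauss_points_def by (intro sets_PiM_cong) (auto simp: sets_gauss)

lemma space_gauss: "space (gauss k) = {..k} \<rightarrow>\<^sub>E UNIV"
  by (simp add: gauss_def space_PiM)

lemma space_gauss_points: "space (gauss_points k n) = {..<n} \<rightarrow>\<^sub>E ({..k} \<rightarrow>\<^sub>E UNIV)"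
  by (simp add: gauss_points_def space_PiM space_gauss)

lemma prob_space_gauss: "prob_space (gauss k)"
  unfolding gauss_def by (intro prob_space_PiM prob_space_std_normal)

lemma prob_space_gauss_points: "prob_space (gauss_points k n)"
  unfolding gauss_points_def by (intro prob_space_PiM prob_space_gauss)

lemma product_sigma_finite_gauss: "product_sigma_finite (\<lambda>_::nat. gauss k)"
  by (intro product_sigma_finite.intro prob_space_imp_sigma_finite prob_space_gauss)

lemma inner_on_self_nonneg: "inner_on k x x \<ge> 0"
  unfolding inner_on_def by (intro sum_nonneg) auto

lemma norm_on_nonneg: "norm_on k x \<ge> 0"
  by (simp add: norm_on_def inner_on_self_nonneg)

lemma norm_on_square: "(norm_on k x)\<^sup>2 = inner_on k x x"
  by (simp add: norm_on_def inner_on_self_nonneg)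

lemma inner_on_Suc: "inner_on (Suc k) x y = inner_on k x y + x (Suc k) * y (Suc k)"
  by (simp add: inner_on_def)

section \<open>Exponential moments of the squared length\<close>

lemma gauss_nn_integral_exp_norm:
  assumes "\<alpha> < 1"
  shows "(\<integral>\<^sup>+v. ennreal (exp (\<alpha> * inner_on k v v / 2)) \<partial>gauss k) = ennreal ((1 / sqrt (1 - \<alpha>)) ^ Suc k)"
proof -
  have "(\<integral>\<^sup>+v. ennreal (exp (\<alpha> * inner_on k v v / 2)) \<partial>gauss k)
    = (\<integral>\<^sup>+v. (\<Prod>i\<le>k. ennreal (exp (\<alpha> * (v i)\<^sup>2 / 2))) \<partial>gauss k)"
    by (simp add: inner_on_def prod_ennreal sum_distrib_left sum_divide_distrib power2_eq_square flip: exp_sum)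
  also have "\<dots> = (\<Prod>i\<le>k. ennreal (1 / sqrt (1 - \<alpha>)))"
    unfolding gauss_def using assms
    by (subst std.product_nn_integral_prod) (auto simp: nn_integral_std_normal_exp_square)
  finally show ?thesis by (simp add: ennreal_power assms less_imp_le flip: power_Suc)
qed

text \<open>The term \<open>x / 2\<close> is exact to first order. When the bound is raised to the
  power of the dimension, this term cancels against the mean of the squared length and only the
  quadratic error is multiplied.\<close>

lemma inverse_sqrt_one_minus_le_exp:
  assumes "\<bar>x\<bar> \<le> 1/2"
  shows "1 / sqrt (1 - x) \<le> exp (x / 2 + x\<^sup>2)"
proof -
  have "- x - 2 * x\<^sup>2 \<le> ln (1 - x)"
  proof (cases "x \<ge> 0")
    case True
    then show ?thesis using assms by (intro ln_one_minus_pos_lower_bound) auto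
  next
    case False
    then have "- x - x\<^sup>2 \<le> ln (1 - x)" using ln_one_plus_pos_lower_bound[of "- x"] assms by simp
    moreover have "0 \<le> x\<^sup>2" by simp
    ultimately show ?thesis by linarith
  qed
  then have "exp (- x - 2 * x\<^sup>2) \<le> 1 - x" using assms by (subst (asm) ln_ge_iff) auto
  then have "(1 / sqrt (1 - x))\<^sup>2 \<le> 1 / exp (- x - 2 * x\<^sup>2)"
    using assms by (subst power_divide) (auto intro!: divide_left_mono mult_pos_pos)
  also have "\<dots> = exp (2 * (x / 2 + x\<^sup>2))"
    by (simp add: field_simps flip: exp_add)
  also have "\<dots> = (exp (x / 2 + x\<^sup>2))\<^sup>2" by (rule exp_double)
  finally show ?thesis by (rule power2_le_imp_le) simp
qed

text \<open>The squared length has mean \<open>Suc k\<close>, whereas \<open>\<kappa>\<close> stays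
  fixed as the dimension drops: the first error term is this mismatch, the second comes from the
  variance. For \<open>c\<close> of order \<open>\<kappa>\<close> both are bounded as long as the
  dimension differs from \<open>\<kappa>\<^sup>2\<close> by O(\<open>\<kappa>\<close>).\<close>

lemma gauss_nn_integral_exp_norm_deviation:
  assumes "\<kappa> > 0" "c \<ge> 0" "4 * c \<le> \<kappa>\<^sup>2"
  shows "(\<integral>\<^sup>+v. ennreal (exp (c * \<bar>inner_on k v v / \<kappa>\<^sup>2 - 1\<bar>)) \<partial>gauss k)
    \<le> ennreal (2 * exp (c * \<bar>real (Suc k) - \<kappa>\<^sup>2\<bar> / \<kappa>\<^sup>2 + 4 * real (Suc k) * (c / \<kappa>\<^sup>2)\<^sup>2))"
proof -
  define E where "E = c * \<bar>real (Suc k) - \<kappa>\<^sup>2\<bar> / \<kappa>\<^sup>2 + 4 * real (Suc k) * (c / \<kappa>\<^sup>2)\<^sup>2"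
  have one_side: "(\<integral>\<^sup>+v. ennreal (exp (b * (inner_on k v v / \<kappa>\<^sup>2 - 1))) \<partial>gauss k) \<le> ennreal (exp E)"
    if b: "\<bar>b\<bar> = c" for b
  proof -
    define x where "x = 2 * b / \<kappa>\<^sup>2"
    have x: "\<bar>x\<bar> \<le> 1/2" using assms b by (simp add: x_def abs_mult field_simps)
    have "(\<integral>\<^sup>+v. ennreal (exp (b * (inner_on k v v / \<kappa>\<^sup>2 - 1))) \<partial>gauss k)
      = (\<integral>\<^sup>+v. ennreal (exp (- b)) * ennreal (exp (x * inner_on k v v / 2)) \<partial>gauss k)"
      by (intro nn_integral_cong) (simp add: x_def right_diff_distrib flip: ennreal_mult exp_add)
    also have "\<dots> = ennreal (exp (- b)) * ennreal ((1 / sqrt (1 - x)) ^ Suc k)"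
      using x by (subst nn_integral_cmult) (auto simp: gauss_nn_integral_exp_norm simp del: power_Suc)
    also have "\<dots> = ennreal (exp (- b) * (1 / sqrt (1 - x)) ^ Suc k)"
      using x by (subst ennreal_mult) auto
    also have "\<dots> \<le> ennreal (exp (- b) * exp (x / 2 + x\<^sup>2) ^ Suc k)"
      using x by (intro ennreal_leI mult_left_mono power_mono inverse_sqrt_one_minus_le_exp) auto
    also have "exp (- b) * exp (x / 2 + x\<^sup>2) ^ Suc k = exp (- b + real (Suc k) * (x / 2 + x\<^sup>2))"
      by (simp only: exp_of_nat_mult[symmetric] exp_add[symmetric])
    also have "- b + real (Suc k) * (x / 2 + x\<^sup>2) = b * (real (Suc k) - \<kappa>\<^sup>2) / \<kappa>\<^sup>2 + 4 * real (Suc k) * (b / \<kappa>\<^sup>2)\<^sup>2"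
    proof -
      have "- b + d * (2 * b / \<kappa>\<^sup>2 / 2 + (2 * b / \<kappa>\<^sup>2)\<^sup>2) = b * (d - \<kappa>\<^sup>2) / \<kappa>\<^sup>2 + 4 * d * (b / \<kappa>\<^sup>2)\<^sup>2" for d
        using assms(1) by (simp add: power_divide right_diff_distrib diff_divide_distrib distrib_left mult_ac)
      then show ?thesis unfolding x_def .
    qed
    also have "b * (real (Suc k) - \<kappa>\<^sup>2) \<le> c * \<bar>real (Suc k) - \<kappa>\<^sup>2\<bar>"
      using abs_ge_self[of "b * (real (Suc k) - \<kappa>\<^sup>2)"] b by (simp add: abs_mult)
    also have "(b / \<kappa>\<^sup>2)\<^sup>2 = (c / \<kappa>\<^sup>2)\<^sup>2"
      using b power2_abs[of b] by (simp add: power_divide)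
    finally show ?thesis using assms(1) by (simp add: E_def divide_right_mono)
  qed
  have "(\<integral>\<^sup>+v. ennreal (exp (c * \<bar>inner_on k v v / \<kappa>\<^sup>2 - 1\<bar>)) \<partial>gauss k)
     \<le> (\<integral>\<^sup>+v. ennreal (exp (c * (inner_on k v v / \<kappa>\<^sup>2 - 1))) + ennreal (exp ((- c) * (inner_on k v v / \<kappa>\<^sup>2 - 1))) \<partial>gauss k)"
  proof (rule nn_integral_mono)
    fix v
    have *: "exp (c * \<bar>y\<bar>) \<le> exp (c * y) + exp ((- c) * y)" for y
      by (cases "y \<ge> 0") auto
    show "ennreal (exp (c * \<bar>inner_on k v v / \<kappa>\<^sup>2 - 1\<bar>)) \<le> ennreal (exp (c * (inner_on k v v / \<kappa>\<^sup>2 - 1))) + ennreal (exp ((- c) * (inner_on k v v / \<kappa>\<^sup>2 - 1)))"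
      unfolding ennreal_plus[OF exp_ge_zero exp_ge_zero, symmetric] by (rule ennreal_leI[OF *])
  qed
  also have "\<dots> = (\<integral>\<^sup>+v. ennreal (exp (c * (inner_on k v v / \<kappa>\<^sup>2 - 1))) \<partial>gauss k)
     + (\<integral>\<^sup>+v. ennreal (exp ((- c) * (inner_on k v v / \<kappa>\<^sup>2 - 1))) \<partial>gauss k)"
    by (intro nn_integral_add) measurable
  also have "\<dots> \<le> ennreal (exp E) + ennreal (exp E)"
    using assms by (intro add_mono one_side) auto
  also have "\<dots> = ennreal (2 * exp E)" by (simp flip: ennreal_plus)
  finally show ?thesis by (simp add: E_def)
qed

section \<open>Rotation invariance\<close>

lemma nn_integral_lborel_rotation:
  fixes H :: "real \<times> real \<Rightarrow> ennreal"
  assumes [measurable]: "H \<in> borel_measurable (borel \<Otimes>\<^sub>M borel)" and cs: "c\<^sup>2 + s\<^sup>2 = 1"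
  shows "(\<integral>\<^sup>+a. \<integral>\<^sup>+b. H (c * a - s * b, s * a + c * b) \<partial>lborel \<partial>lborel) = (\<integral>\<^sup>+a. \<integral>\<^sup>+b. H (a, b) \<partial>lborel \<partial>lborel)"
    (is "?I = ?J")
proof (cases "c = 0")
  \<comment> \<open>One variable is changed at a time: for fixed \<open>b\<close> the substitution
    in the first argument turns the second into \<open>(s * a + b) / c\<close>, and then that one is
    substituted. The two Jacobian factors are inverse to each other.\<close>
  case False
  have "?I = (\<integral>\<^sup>+b. \<integral>\<^sup>+a. H (c * a - s * b, s * a + c * b) \<partial>lborel \<partial>lborel)"
    by (rule lborel_pair.Fubini') measurable
  then have "\<bar>c\<bar> * ?I = (\<integral>\<^sup>+b. \<bar>c\<bar> * (\<integral>\<^sup>+a. H (c * a - s * b, s * a + c * b) \<partial>lborel) \<partial>lborel)"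
    by (simp add: nn_integral_cmult)
  also have "\<dots> = (\<integral>\<^sup>+b. \<integral>\<^sup>+a. H (a, (s * a + b) / c) \<partial>lborel \<partial>lborel)"
  proof (rule nn_integral_cong)
    fix b :: real
    have "(\<integral>\<^sup>+a. H (a, (s * a + b) / c) \<partial>lborel) = \<bar>c\<bar> * (\<integral>\<^sup>+a. H (- s * b + c * a, (s * (- s * b + c * a) + b) / c) \<partial>lborel)"
      by (rule nn_integral_real_affine) (use False in auto)
    moreover have "(s * (- s * b + c * a) + b) / c = s * a + c * b" for a
    proof -
      have "s * (- s * b + c * a) + b = c * (s * a) + (1 - s\<^sup>2) * b"
        by (simp add: algebra_simps power2_eq_square)
      also have "1 - s\<^sup>2 = c\<^sup>2" using cs by simp
      finally show ?thesis using False by (simp add: power2_eq_square field_simps)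
    qed
    ultimately have "(\<integral>\<^sup>+a. H (a, (s * a + b) / c) \<partial>lborel) = \<bar>c\<bar> * (\<integral>\<^sup>+a. H (- s * b + c * a, s * a + c * b) \<partial>lborel)"
      by simp
    then show "\<bar>c\<bar> * (\<integral>\<^sup>+a. H (c * a - s * b, s * a + c * b) \<partial>lborel) = (\<integral>\<^sup>+a. H (a, (s * a + b) / c) \<partial>lborel)"
      by simp
  qed
  also have "\<dots> = (\<integral>\<^sup>+a. \<integral>\<^sup>+b. H (a, (s * a + b) / c) \<partial>lborel \<partial>lborel)"
    by (rule lborel_pair.Fubini') measurable
  also have "\<dots> = (\<integral>\<^sup>+a. \<bar>c\<bar> * \<integral>\<^sup>+b. H (a, b) \<partial>lborel \<partial>lborel)"
  proof (rule nn_integral_cong)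
    fix a :: real
    have "(\<integral>\<^sup>+b. H (a, b) \<partial>lborel) = \<bar>1/c\<bar> * (\<integral>\<^sup>+b. H (a, s * a / c + (1/c) * b) \<partial>lborel)"
      by (rule nn_integral_real_affine) (use False in auto)
    then have "\<bar>c\<bar> * (\<integral>\<^sup>+b. H (a, b) \<partial>lborel) = ennreal (\<bar>c\<bar> * \<bar>1/c\<bar>) * (\<integral>\<^sup>+b. H (a, s * a / c + (1/c) * b) \<partial>lborel)"
      unfolding ennreal_mult[OF abs_ge_zero abs_ge_zero] mult.assoc by (rule arg_cong)
    moreover have "\<bar>c\<bar> * \<bar>1/c\<bar> = 1" using False by simp
    ultimately show "(\<integral>\<^sup>+b. H (a, (s * a + b) / c) \<partial>lborel) = \<bar>c\<bar> * (\<integral>\<^sup>+b. H (a, b) \<partial>lborel)"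
      by (simp add: add_divide_distrib)
  qed
  also have "\<dots> = \<bar>c\<bar> * ?J" by (simp add: nn_integral_cmult)
  finally show ?thesis using False by (simp add: ennreal_mult_cancel_left)
next
  case True
  then have s: "\<bar>s\<bar> = 1" "s \<noteq> 0" using cs by (auto simp: power2_eq_1_iff)
  have "?I = (\<integral>\<^sup>+a. \<integral>\<^sup>+b. H (b, s * a) \<partial>lborel \<partial>lborel)"
  proof (rule nn_integral_cong)
    fix a :: real
    have "(\<integral>\<^sup>+b. H (b, s * a) \<partial>lborel) = \<bar>- s\<bar> * (\<integral>\<^sup>+b. H (0 + (- s) * b, s * a) \<partial>lborel)"
      by (rule nn_integral_real_affine) (use s in auto)
    then show "(\<integral>\<^sup>+b. H (c * a - s * b, s * a + c * b) \<partial>lborel) = (\<integral>\<^sup>+b. H (b, s * a) \<partial>lborel)"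
      using True s by simp
  qed
  also have "\<dots> = (\<integral>\<^sup>+b. \<integral>\<^sup>+a. H (b, s * a) \<partial>lborel \<partial>lborel)"
    by (rule lborel_pair.Fubini') measurable
  also have "\<dots> = ?J"
  proof (rule nn_integral_cong)
    fix b :: real
    have "(\<integral>\<^sup>+a. H (b, a) \<partial>lborel) = \<bar>s\<bar> * (\<integral>\<^sup>+a. H (b, 0 + s * a) \<partial>lborel)"
      by (rule nn_integral_real_affine) (use s in auto)
    then show "(\<integral>\<^sup>+a. H (b, s * a) \<partial>lborel) = (\<integral>\<^sup>+a. H (b, a) \<partial>lborel)" using s by simp
  qed
  finally show ?thesis .
qed

lemma nn_integral_std_normal_rotation:
  fixes F :: "real \<times> real \<Rightarrow> ennreal"
  assumes [measurable]: "F \<in> borel_measurable (borel \<Otimes>\<^sub>M borel)" and cs: "c\<^sup>2 + s\<^sup>2 = 1"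
  shows "(\<integral>\<^sup>+a. \<integral>\<^sup>+b. F (c * a - s * b, s * a + c * b) \<partial>std_normal \<partial>std_normal)
    = (\<integral>\<^sup>+a. \<integral>\<^sup>+b. F (a, b) \<partial>std_normal \<partial>std_normal)"
proof -
  define H where "H = (\<lambda>(a, b). ennreal (std_normal_density a * std_normal_density b) * F (a, b))"
  have [measurable]: "H \<in> borel_measurable (borel \<Otimes>\<^sub>M borel)" unfolding H_def by measurable
  have two: "(\<integral>\<^sup>+a. \<integral>\<^sup>+b. G a b \<partial>std_normal \<partial>std_normal)
      = (\<integral>\<^sup>+a. \<integral>\<^sup>+b. ennreal (std_normal_density a * std_normal_density b) * G a b \<partial>lborel \<partial>lborel)"
    if [measurable]: "case_prod G \<in> borel_measurable (borel \<Otimes>\<^sub>M borel)" for G :: "real \<Rightarrow> real \<Rightarrow> ennreal"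
  proof -
    have "(\<integral>\<^sup>+a. \<integral>\<^sup>+b. G a b \<partial>std_normal \<partial>std_normal)
      = (\<integral>\<^sup>+a. \<integral>\<^sup>+b. ennreal (std_normal_density b) * G a b \<partial>lborel \<partial>std_normal)"
      by (intro nn_integral_cong nn_integral_std_normal) measurable
    also have "\<dots> = (\<integral>\<^sup>+a. ennreal (std_normal_density a) * \<integral>\<^sup>+b. ennreal (std_normal_density b) * G a b \<partial>lborel \<partial>lborel)"
      by (intro nn_integral_std_normal) measurable
    also have "\<dots> = (\<integral>\<^sup>+a. \<integral>\<^sup>+b. ennreal (std_normal_density a) * (ennreal (std_normal_density b) * G a b) \<partial>lborel \<partial>lborel)"
      by (intro nn_integral_cong nn_integral_cmult[symmetric]) measurable
    finally show ?thesis by (simp add: ennreal_mult mult.assoc)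
  qed
  have "std_normal_density (c * a - s * b) * std_normal_density (s * a + c * b) = std_normal_density a * std_normal_density b" for a b
  proof -
    have "(c * a - s * b)\<^sup>2 + (s * a + c * b)\<^sup>2 = (c\<^sup>2 + s\<^sup>2) * (a\<^sup>2 + b\<^sup>2)"
      by (simp add: power2_eq_square algebra_simps)
    then have "exp (- (c * a - s * b)\<^sup>2 / 2) * exp (- (s * a + c * b)\<^sup>2 / 2) = exp (- a\<^sup>2 / 2) * exp (- b\<^sup>2 / 2)"
      unfolding exp_add[symmetric] using cs by (intro arg_cong[of _ _ exp]) simp
    then show ?thesis by (simp add: std_normal_density_def)
  qed
  then have "(\<integral>\<^sup>+a. \<integral>\<^sup>+b. F (c * a - s * b, s * a + c * b) \<partial>std_normal \<partial>std_normal)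
    = (\<integral>\<^sup>+a. \<integral>\<^sup>+b. H (c * a - s * b, s * a + c * b) \<partial>lborel \<partial>lborel)"
    by (subst two) (auto simp: H_def)
  also have "\<dots> = (\<integral>\<^sup>+a. \<integral>\<^sup>+b. H (a, b) \<partial>lborel \<partial>lborel)"
    by (rule nn_integral_lborel_rotation) (use cs in auto)
  also have "\<dots> = (\<integral>\<^sup>+a. \<integral>\<^sup>+b. F (a, b) \<partial>std_normal \<partial>std_normal)"
    by (subst two) (auto simp: H_def)
  finally show ?thesis .
qed

definition givens :: "nat \<Rightarrow> nat \<Rightarrow> real \<Rightarrow> real \<Rightarrow> (nat \<Rightarrow> real) \<Rightarrow> nat \<Rightarrow> real" where
  "givens i j c s x = x(i := c * x i - s * x j, j := s * x i + c * x j)"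

lemma measurable_givens:
  assumes "i \<le> k" "j \<le> k"
  shows "givens i j c s \<in> measurable (gauss k) (gauss k)"
  unfolding givens_def[abs_def] gauss_def
  by (intro measurable_fun_upd[where J = "{..k}"]) (use assms in auto)

lemma inner_on_remove2:
  assumes "i \<le> k" "j \<le> k" "i \<noteq> j"
  shows "inner_on k x y = x i * y i + x j * y j + (\<Sum>l\<in>{..k} - {i, j}. x l * y l)"
proof -
  have "{..k} = insert i (insert j ({..k} - {i, j}))" using assms by auto
  then have "inner_on k x y = (\<Sum>l\<in>insert i (insert j ({..k} - {i, j})). x l * y l)"
    by (simp only: inner_on_def)
  then show ?thesis using assms by simp
qed

lemma inner_on_givens:
  assumes "i \<le> k" "j \<le> k" "i \<noteq> j" "c\<^sup>2 + s\<^sup>2 = 1"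
  shows "inner_on k (givens i j c s x) (givens i j c s y) = inner_on k x y"
proof -
  have "(\<Sum>l\<in>{..k} - {i, j}. givens i j c s x l * givens i j c s y l) = (\<Sum>l\<in>{..k} - {i, j}. x l * y l)"
    by (intro sum.cong) (auto simp: givens_def)
  moreover have "(c * x i - s * x j) * (c * y i - s * y j) + (s * x i + c * x j) * (s * y i + c * y j)
      = (c\<^sup>2 + s\<^sup>2) * (x i * y i + x j * y j)"
    by (simp add: power2_eq_square algebra_simps)
  ultimately show ?thesis using assms
    by (simp add: inner_on_remove2[of i k j] givens_def)
qed

lemma nn_integral_gauss_givens:
  assumes ij: "i \<le> k" "j \<le> k" "i \<noteq> j" "c\<^sup>2 + s\<^sup>2 = 1" and f[measurable]: "f \<in> borel_measurable (gauss k)"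
  shows "(\<integral>\<^sup>+x. f (givens i j c s x) \<partial>gauss k) = (\<integral>\<^sup>+x. f x \<partial>gauss k)"
proof -
  define I where "I = {..k} - {i, j}"
  have I: "{..k} = insert j (insert i I)" "finite I" "i \<notin> I" "j \<notin> insert i I" "finite (insert i I)"
    using ij by (auto simp: I_def)
  have gk: "gauss k = Pi\<^sub>M (insert j (insert i I)) (\<lambda>_. std_normal)"
    unfolding gauss_def I(1) by simp
  have split: "(\<integral>\<^sup>+x. g x \<partial>gauss k) = (\<integral>\<^sup>+x. \<integral>\<^sup>+a. \<integral>\<^sup>+b. g (x(i := a, j := b)) \<partial>std_normal \<partial>std_normal \<partial>Pi\<^sub>M I (\<lambda>_. std_normal))"
    if g: "g \<in> borel_measurable (gauss k)" for g
  proof -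
    have [measurable]: "g \<in> borel_measurable (Pi\<^sub>M (insert j (insert i I)) (\<lambda>_. std_normal))"
      using g by (simp add: gk)
    have [measurable]: "(\<lambda>x. \<integral>\<^sup>+b. g (x(j := b)) \<partial>std_normal) \<in> borel_measurable (Pi\<^sub>M (insert i I) (\<lambda>_. std_normal))"
      by (rule std.sigma_finite_measures[THEN sigma_finite_measure.borel_measurable_nn_integral]) measurable
    show ?thesis unfolding gk
      by (subst std.product_nn_integral_insert[OF I(5,4)], measurable,
          subst std.product_nn_integral_insert[OF I(2,3)], measurable)
  qed
  have "(\<integral>\<^sup>+x. f (givens i j c s x) \<partial>gauss k)
    = (\<integral>\<^sup>+x. \<integral>\<^sup>+a. \<integral>\<^sup>+b. f (givens i j c s (x(i := a, j := b))) \<partial>std_normal \<partial>std_normal \<partial>Pi\<^sub>M I (\<lambda>_. std_normal))"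
    by (rule split[OF measurable_compose[OF measurable_givens[OF ij(1,2)] f]])
  also have "\<dots> = (\<integral>\<^sup>+x. \<integral>\<^sup>+a. \<integral>\<^sup>+b. f (x(i := a, j := b)) \<partial>std_normal \<partial>std_normal \<partial>Pi\<^sub>M I (\<lambda>_. std_normal))"
  proof (rule nn_integral_cong)
    fix x assume x: "x \<in> space (Pi\<^sub>M I (\<lambda>_. std_normal))"
    define F where "F = (\<lambda>(a, b). f (x(i := a, j := b)))"
    have [measurable]: "f \<in> borel_measurable (Pi\<^sub>M (insert j (insert i I)) (\<lambda>_. borel))"
      using f sets_gauss[of k] by (simp add: I(1) cong: measurable_cong_sets)
    have [measurable]: "(\<lambda>p. x(i := fst p, j := snd p)) \<in> measurable (borel \<Otimes>\<^sub>M borel) (Pi\<^sub>M (insert j (insert i I)) (\<lambda>_. borel))"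
    proof (rule measurable_fun_upd[where J = "insert i I"])
      have c: "(\<lambda>p. x) \<in> measurable (borel \<Otimes>\<^sub>M borel) (Pi\<^sub>M I (\<lambda>_. borel))"
        using x by (intro measurable_const) (simp add: space_PiM)
      show "(\<lambda>p. x(i := fst p)) \<in> measurable (borel \<Otimes>\<^sub>M borel) (Pi\<^sub>M (insert i I) (\<lambda>_. borel))"
        by (rule measurable_fun_upd[OF _ c]) auto
    qed auto
    have [measurable]: "F \<in> borel_measurable (borel \<Otimes>\<^sub>M borel)"
      unfolding F_def case_prod_beta by measurable
    have "f (givens i j c s (x(i := a, j := b))) = F (c * a - s * b, s * a + c * b)" for a b
      using ij by (auto simp: F_def givens_def intro!: arg_cong[of _ _ f])
    then show "(\<integral>\<^sup>+a. \<integral>\<^sup>+b. f (givens i j c s (x(i := a, j := b))) \<partial>std_normal \<partial>std_normal)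
      = (\<integral>\<^sup>+a. \<integral>\<^sup>+b. f (x(i := a, j := b)) \<partial>std_normal \<partial>std_normal)"
      using nn_integral_std_normal_rotation[of F c s] ij by (simp add: F_def)
  qed
  also have "\<dots> = (\<integral>\<^sup>+x. f x \<partial>gauss k)" by (rule split[symmetric]) measurable
  finally show ?thesis .
qed

text \<open>Orthogonal maps are not available on \<open>{..k} \<rightarrow>\<^sub>E UNIV\<close> with \<open>k\<close> varying, so the required one is
  composed of rotations in the planes spanned by the coordinates \<open>i\<close> and \<open>k\<close>.\<close>

lemma gauss_rotation:
  assumes k: "k > 0" and \<sigma>: "\<sigma> = 1 \<or> \<sigma> = (-1::real)"
  obtains R where "R \<in> measurable (gauss k) (gauss k)" "distr (gauss k) (gauss k) R = gauss k"
    "\<And>x y. inner_on k (R x) (R y) = inner_on k x y"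
    "\<And>x. inner_on k x v = \<sigma> * norm_on k v * R x k"
proof -
  \<comment> \<open>The coordinates of the image of \<open>v\<close> are cleared one by one. The
    sign condition holds only from the first step on, and \<open>k > 0\<close> guarantees that there
    is one.\<close>
  define P where "P m R \<longleftrightarrow> R \<in> measurable (gauss k) (gauss k) \<and> distr (gauss k) (gauss k) R = gauss k
    \<and> (\<forall>x y. inner_on k (R x) (R y) = inner_on k x y) \<and> (\<forall>i<m. R v i = 0) \<and> (m > 0 \<longrightarrow> \<sigma> * R v k \<ge> 0)" for m R
  have "\<exists>R. P m R" if "m \<le> k" for m using that
  proof (induction m)
    case 0
    show ?case by (rule exI[of _ "\<lambda>x. x"]) (simp add: P_def distr_id2)
  next
    case (Suc m)
    then obtain R where R: "P m R" by auto
    define a b r where "a = R v m" and "b = R v k" and "r = sqrt (a\<^sup>2 + b\<^sup>2)"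
    show ?case
    proof (cases "r = 0")
      case True
      then have "a = 0" "b = 0" by (auto simp: r_def sum_power2_eq_zero_iff)
      then have "P (Suc m) R" using R by (auto simp: P_def a_def b_def less_Suc_eq)
      then show ?thesis by blast
    next
      case False
      then have r: "r > 0" "r\<^sup>2 = a\<^sup>2 + b\<^sup>2" by (auto simp: r_def order_less_le)
      \<comment> \<open>This rotation sends \<open>(a, b)\<close> to
        \<open>(0, \<sigma> * r)\<close>: the length is collected in the last coordinate with the
        prescribed sign.\<close>
      define c s where "c = \<sigma> * b / r" and "s = \<sigma> * a / r"
      have s2: "\<sigma> * \<sigma> = 1" using \<sigma> by auto
      have cs: "c\<^sup>2 + s\<^sup>2 = 1"
      proof -
        have "c\<^sup>2 + s\<^sup>2 = (\<sigma> * \<sigma>) * (b\<^sup>2 + a\<^sup>2) / r\<^sup>2" by (simp add: c_def s_def power2_eq_square add_divide_distrib distrib_left mult_ac)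
        also have "b\<^sup>2 + a\<^sup>2 = r\<^sup>2" using r by simp
        finally show ?thesis using r(1) unfolding s2 by simp
      qed
      have mk: "m \<le> k" "m \<noteq> k" using Suc.prems by auto
      define R' where "R' = (\<lambda>x. givens m k c s (R x))"
      have Rm[measurable]: "R \<in> measurable (gauss k) (gauss k)" using R by (simp add: P_def)
      have gm[measurable]: "givens m k c s \<in> measurable (gauss k) (gauss k)" using mk by (intro measurable_givens) auto
      have g: "distr (gauss k) (gauss k) (givens m k c s) = gauss k"
      proof (rule measure_eqI)
        fix A assume "A \<in> sets (distr (gauss k) (gauss k) (givens m k c s))"
        then have [measurable]: "A \<in> sets (gauss k)" by simp
        have "emeasure (distr (gauss k) (gauss k) (givens m k c s)) A = (\<integral>\<^sup>+x. indicator A x \<partial>distr (gauss k) (gauss k) (givens m k c s))"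
          by simp
        also have "\<dots> = (\<integral>\<^sup>+x. indicator A (givens m k c s x) \<partial>gauss k)"
          by (rule nn_integral_distr) measurable
        also have "\<dots> = (\<integral>\<^sup>+x. indicator A x \<partial>gauss k)"
          using mk cs by (intro nn_integral_gauss_givens) auto
        finally show "emeasure (distr (gauss k) (gauss k) (givens m k c s)) A = emeasure (gauss k) A" by simp
      qed simp
      have "P (Suc m) R'" unfolding P_def
      proof (intro conjI allI impI)
        show "R' \<in> measurable (gauss k) (gauss k)" unfolding R'_def by measurable
        have "distr (gauss k) (gauss k) R' = distr (distr (gauss k) (gauss k) R) (gauss k) (givens m k c s)"
          by (subst distr_distr) (auto simp: R'_def comp_def)
        also have "\<dots> = gauss k" using R g by (simp add: P_def)
        finally show "distr (gauss k) (gauss k) R' = gauss k" .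
        show "inner_on k (R' x) (R' y) = inner_on k x y" for x y
          using R mk cs by (simp add: R'_def inner_on_givens P_def)
        show "R' v i = 0" if "i < Suc m" for i
        proof (cases "i = m")
          case True
          have "c * a - s * b = 0" by (simp add: c_def s_def)
          then show ?thesis using True mk by (simp add: R'_def givens_def a_def b_def)
        next
          case False
          then show ?thesis using that mk R by (simp add: R'_def givens_def P_def)
        qed
        have "\<sigma> * (s * a + c * b) = (\<sigma> * \<sigma>) * (a\<^sup>2 + b\<^sup>2) / r" by (simp add: c_def s_def power2_eq_square add_divide_distrib distrib_left mult_ac)
        also have "\<dots> \<ge> 0" using s2 r by simp
        finally show "0 \<le> \<sigma> * R' v k" by (simp add: R'_def givens_def a_def b_def)
      qed
      then show ?thesis by blast
    qed
  qed
  then obtain R where R: "P k R" by auto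
  have single: "inner_on k x (R v) = x k * R v k" for x
  proof -
    have "inner_on k x (R v) = (\<Sum>i\<le>k. if i = k then x k * R v k else 0)"
      unfolding inner_on_def by (intro sum.cong) (use R in \<open>auto simp: P_def\<close>)
    then show ?thesis by simp
  qed
  have s2: "\<sigma> * \<sigma> = 1" using \<sigma> by auto
  have "inner_on k v v = inner_on k (R v) (R v)" using R by (simp only: P_def)
  also have "\<dots> = (\<sigma> * \<sigma>) * (R v k * R v k)" unfolding single s2 by simp
  also have "\<dots> = (\<sigma> * R v k)\<^sup>2" by (simp only: power2_eq_square mult_ac)
  finally have "norm_on k v = \<bar>\<sigma> * R v k\<bar>" by (simp only: norm_on_def real_sqrt_abs)
  also have "\<dots> = \<sigma> * R v k" by (rule abs_of_nonneg) (use R k in \<open>simp add: P_def\<close>)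
  finally have "\<sigma> * norm_on k v = (\<sigma> * \<sigma>) * R v k" by simp
  then have "R v k = \<sigma> * norm_on k v" unfolding s2 by simp
  then have "inner_on k x v = \<sigma> * norm_on k v * R x k" for x
    using single[of "R x"] R by (simp add: P_def mult.commute)
  then show thesis using R that[of R] by (simp add: P_def)
qed

section \<open>Cliques among Gaussian vectors\<close>

lemma gauss_Suc_nn_integral:
  assumes f[measurable]: "f \<in> borel_measurable (gauss (Suc k))"
  shows "(\<integral>\<^sup>+y. f y \<partial>gauss (Suc k)) = (\<integral>\<^sup>+a. \<integral>\<^sup>+y. f (y(Suc k := a)) \<partial>gauss k \<partial>std_normal)"
proof -
  have eq: "gauss (Suc k) = Pi\<^sub>M (insert (Suc k) {..k}) (\<lambda>_. std_normal)"
    unfolding gauss_def atMost_Suc ..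
  show ?thesis
    using std.product_nn_integral_insert_rev[of "{..k}" "Suc k" f] f unfolding eq gauss_def[of k] by simp
qed

lemma measurable_append_coordinate:
  "(\<lambda>(A, x). \<lambda>i\<in>{..<n}. (x i)(Suc k := A i)) \<in>
     measurable (Pi\<^sub>M {..<n} (\<lambda>_. std_normal) \<Otimes>\<^sub>M gauss_points k n) (gauss_points (Suc k) n)"
  unfolding case_prod_beta gauss_points_def
proof (rule measurable_restrict)
  fix i assume i: "i \<in> {..<n}"
  have m1: "(\<lambda>p. snd p i) \<in> measurable (Pi\<^sub>M {..<n} (\<lambda>_. std_normal) \<Otimes>\<^sub>M Pi\<^sub>M {..<n} (\<lambda>_. gauss k)) (gauss k)"
    using i by measurable
  have m2: "(\<lambda>p. fst p i) \<in> measurable (Pi\<^sub>M {..<n} (\<lambda>_. std_normal) \<Otimes>\<^sub>M Pi\<^sub>M {..<n} (\<lambda>_. gauss k)) std_normal"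
    using i by measurable
  show "(\<lambda>p. (snd p i)(Suc k := fst p i)) \<in>
      measurable (Pi\<^sub>M {..<n} (\<lambda>_. std_normal) \<Otimes>\<^sub>M Pi\<^sub>M {..<n} (\<lambda>_. gauss k)) (gauss (Suc k))"
    unfolding gauss_def by (rule measurable_fun_upd[OF _ m1[unfolded gauss_def] m2[unfolded gauss_def]]) auto
qed

text \<open>Exchanges the product over points with the product over coordinates. On boxes both
  measures factor over the points, which leaves \<open>gauss_Suc_nn_integral\<close> for a single
  point.\<close>

lemma gauss_points_Suc_eq_distr:
  "gauss_points (Suc k) n = distr (Pi\<^sub>M {..<n} (\<lambda>_. std_normal) \<Otimes>\<^sub>M gauss_points k n) (gauss_points (Suc k) n)
     (\<lambda>(A, x). \<lambda>i\<in>{..<n}. (x i)(Suc k := A i))" (is "_ = distr ?P _ ?T")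
proof -
  interpret G': product_sigma_finite "\<lambda>_::nat. gauss (Suc k)" by (rule product_sigma_finite_gauss)
  interpret G: product_sigma_finite "\<lambda>_::nat. gauss k" by (rule product_sigma_finite_gauss)
  interpret S: prob_space "Pi\<^sub>M {..<n} (\<lambda>_. std_normal)" by (intro prob_space_PiM prob_space_std_normal)
  interpret GP: prob_space "gauss_points k n" by (rule prob_space_gauss_points)
  interpret pair_sigma_finite "Pi\<^sub>M {..<n} (\<lambda>_. std_normal)" "gauss_points k n" ..
  note T[measurable] = measurable_append_coordinate[where n = n and k = k]
  have "distr ?P (gauss_points (Suc k) n) ?T = Pi\<^sub>M {..<n} (\<lambda>_. gauss (Suc k))"
  proof (rule G'.PiM_eqI)
    fix B assume B: "\<And>i. i \<in> {..<n} \<Longrightarrow> B i \<in> sets (gauss (Suc k))"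
    have upd: "(\<lambda>(a, y). y(Suc k := a)) \<in> measurable (std_normal \<Otimes>\<^sub>M gauss k) (gauss (Suc k))"
      unfolding case_prod_beta gauss_def by (rule measurable_fun_upd[where J = "{..k}"]) auto
    have ind: "(\<lambda>p. indicator (B i) ((snd p)(Suc k := fst p)) :: ennreal) \<in> borel_measurable (std_normal \<Otimes>\<^sub>M gauss k)" if "i < n" for i
      using measurable_compose[OF upd borel_measurable_indicator[of "B i"]] B that by (simp add: case_prod_beta)
    have [measurable]: "Pi\<^sub>E {..<n} B \<in> sets (gauss_points (Suc k) n)"
      unfolding gauss_points_def using B by (intro sets_PiM_I_finite) auto
    have "emeasure (distr ?P (gauss_points (Suc k) n) ?T) (Pi\<^sub>E {..<n} B)
      = (\<integral>\<^sup>+p. indicator (Pi\<^sub>E {..<n} B) p \<partial>distr ?P (gauss_points (Suc k) n) ?T)"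
      by simp
    also have "\<dots> = (\<integral>\<^sup>+p. indicator (Pi\<^sub>E {..<n} B) (?T p) \<partial>?P)"
      using nn_integral_distr[OF T, of "indicator (Pi\<^sub>E {..<n} B)"] by simp
    also have "\<dots> = (\<integral>\<^sup>+A. \<integral>\<^sup>+x. indicator (Pi\<^sub>E {..<n} B) (?T (A, x)) \<partial>gauss_points k n \<partial>Pi\<^sub>M {..<n} (\<lambda>_. std_normal))"
      by (rule GP.nn_integral_fst[symmetric]) measurable
    also have "\<dots> = (\<integral>\<^sup>+A. \<integral>\<^sup>+x. (\<Prod>i<n. indicator (B i) ((x i)(Suc k := A i))) \<partial>gauss_points k n \<partial>Pi\<^sub>M {..<n} (\<lambda>_. std_normal))"
    proof (intro nn_integral_cong)
      fix A :: "nat \<Rightarrow> real" and x :: "nat \<Rightarrow> nat \<Rightarrow> real"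
      show "indicator (Pi\<^sub>E {..<n} B) (?T (A, x)) = (\<Prod>i<n. indicator (B i) ((x i)(Suc k := A i)) :: ennreal)"
      proof (cases "\<forall>i<n. (x i)(Suc k := A i) \<in> B i")
        case True
        then show ?thesis by (simp add: PiE_iff)
      next
        case False
        then obtain i where "i < n" "(x i)(Suc k := A i) \<notin> B i" by blast
        then show ?thesis by (auto simp: indicator_def PiE_iff intro!: prod_zero[symmetric])
      qed
    qed
    also have "\<dots> = (\<integral>\<^sup>+A. (\<Prod>i<n. \<integral>\<^sup>+y. indicator (B i) (y(Suc k := A i)) \<partial>gauss k) \<partial>Pi\<^sub>M {..<n} (\<lambda>_. std_normal))"
    proof (intro nn_integral_cong)
      fix A :: "nat \<Rightarrow> real"
      have "(\<lambda>y. indicator (B i) (y(Suc k := A i)) :: ennreal) \<in> borel_measurable (gauss k)" if "i < n" for i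
        using measurable_compose[OF measurable_Pair1'[of "A i" std_normal "gauss k"] ind[OF that]] by simp
      then show "(\<integral>\<^sup>+x. (\<Prod>i<n. indicator (B i) ((x i)(Suc k := A i))) \<partial>gauss_points k n)
        = (\<Prod>i<n. \<integral>\<^sup>+y. indicator (B i) (y(Suc k := A i)) \<partial>gauss k)"
        unfolding gauss_points_def by (intro G.product_nn_integral_prod) auto
    qed
    also have "\<dots> = (\<Prod>i<n. \<integral>\<^sup>+a. \<integral>\<^sup>+y. indicator (B i) (y(Suc k := a)) \<partial>gauss k \<partial>std_normal)"
    proof (rule std.product_nn_integral_prod)
      fix i assume "i \<in> {..<n}"
      show "(\<lambda>a. \<integral>\<^sup>+y. indicator (B i) (y(Suc k := a)) \<partial>gauss k) \<in> borel_measurable std_normal"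
        using sigma_finite_measure.borel_measurable_nn_integral[OF G.sigma_finite_measures, of "\<lambda>a y. indicator (B i) (y(Suc k := a))" std_normal] ind[of i] \<open>i \<in> {..<n}\<close>
        by (simp add: case_prod_beta')
    qed simp
    also have "\<dots> = (\<Prod>i<n. emeasure (gauss (Suc k)) (B i))"
      using B by (intro prod.cong refl) (simp flip: gauss_Suc_nn_integral)
    finally show "emeasure (distr ?P (gauss_points (Suc k) n) ?T) (Pi\<^sub>E {..<n} B) = (\<Prod>i<n. emeasure (gauss (Suc k)) (B i))" .
  qed (simp_all add: gauss_points_def)
  then show ?thesis by (simp add: gauss_points_def)
qed

lemma gauss_points_Suc_nn_integral:
  assumes f[measurable]: "f \<in> borel_measurable (gauss_points (Suc k) n)"
  shows "(\<integral>\<^sup>+x. f x \<partial>gauss_points (Suc k) n)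
    = (\<integral>\<^sup>+A. \<integral>\<^sup>+x. f (\<lambda>i\<in>{..<n}. (x i)(Suc k := A i)) \<partial>gauss_points k n \<partial>Pi\<^sub>M {..<n} (\<lambda>_. std_normal))"
proof -
  interpret GP: prob_space "gauss_points k n" by (rule prob_space_gauss_points)
  note [measurable] = measurable_append_coordinate[where n = n and k = k]
  have "(\<integral>\<^sup>+x. f x \<partial>gauss_points (Suc k) n)
    = (\<integral>\<^sup>+p. f (case p of (A, x) \<Rightarrow> \<lambda>i\<in>{..<n}. (x i)(Suc k := A i)) \<partial>(Pi\<^sub>M {..<n} (\<lambda>_. std_normal) \<Otimes>\<^sub>M gauss_points k n))"
    by (subst gauss_points_Suc_eq_distr, subst nn_integral_distr[OF measurable_append_coordinate]) auto
  also have "\<dots> = (\<integral>\<^sup>+A. \<integral>\<^sup>+x. f (\<lambda>i\<in>{..<n}. (x i)(Suc k := A i)) \<partial>gauss_points k n \<partial>Pi\<^sub>M {..<n} (\<lambda>_. std_normal))"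
    by (subst GP.nn_integral_fst[symmetric])
       (auto intro!: measurable_compose[OF measurable_append_coordinate f])
  finally show ?thesis .
qed

lemma nn_integral_gauss_points_map:
  assumes R[measurable]: "R \<in> measurable (gauss k) (gauss k)" and d: "distr (gauss k) (gauss k) R = gauss k"
    and f[measurable]: "f \<in> borel_measurable (gauss_points k n)"
  shows "(\<integral>\<^sup>+x. f (\<lambda>i\<in>{..<n}. R (x i)) \<partial>gauss_points k n) = (\<integral>\<^sup>+x. f x \<partial>gauss_points k n)"
proof -
  have "distr (gauss_points k n) (gauss_points k n) (compose {..<n} R) = gauss_points k n"
    unfolding gauss_points_def
    by (subst distr_PiM_finite_prob_space') (auto simp: d prob_space_gauss)
  then have "(\<integral>\<^sup>+x. f x \<partial>gauss_points k n) = (\<integral>\<^sup>+x. f x \<partial>distr (gauss_points k n) (gauss_points k n) (compose {..<n} R))"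
    by simp
  also have "\<dots> = (\<integral>\<^sup>+x. f (compose {..<n} R x) \<partial>gauss_points k n)"
  proof (rule nn_integral_distr)
    show "compose {..<n} R \<in> measurable (gauss_points k n) (gauss_points k n)"
      unfolding compose_def gauss_points_def by (rule measurable_restrict) measurable
  qed simp
  finally show ?thesis by (simp add: compose_def)
qed

text \<open>Red cliques correspond to \<open>\<sigma> = 1\<close> and blue ones to \<open>\<sigma> = -1\<close>. The thresholds depend on
  the edge because revealing a vertex shifts them.\<close>

definition clique_event :: "nat \<Rightarrow> nat \<Rightarrow> real \<Rightarrow> real \<Rightarrow> (nat \<Rightarrow> nat \<Rightarrow> real) \<Rightarrow> (nat \<Rightarrow> nat \<Rightarrow> real) set" where
  "clique_event k n \<sigma> \<kappa> Y =
     {x \<in> space (gauss_points k n). \<forall>j<n. \<forall>i<j. \<sigma> * inner_on k (x i) (x j) \<le> \<kappa> * Y i j}"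

lemma measurable_gauss_points_component:
  "i < n \<Longrightarrow> (\<lambda>x. x i) \<in> measurable (gauss_points k n) (Pi\<^sub>M {..k} (\<lambda>_. borel))"
  unfolding gauss_points_def measurable_cong_sets[OF refl sets_gauss[symmetric]]
  by (intro measurable_component_singleton) simp

lemma sets_clique_event: "clique_event k n \<sigma> \<kappa> Y \<in> sets (gauss_points k n)"
proof -
  have "clique_event k n \<sigma> \<kappa> Y = {x \<in> space (gauss_points k n). \<forall>j\<in>{..<n}. \<forall>i\<in>{..<j}. \<sigma> * inner_on k (x i) (x j) \<le> \<kappa> * Y i j}"
    by (auto simp: clique_event_def)
  also have "\<dots> \<in> sets (gauss_points k n)"
  proof (intro sets.sets_Collect_finite_All)
    fix j i assume "j \<in> {..<n}" "i \<in> {..<j}"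
    then have "i < n" "j < n" by auto
    note [measurable] = this[THEN measurable_gauss_points_component]
    show "{x \<in> space (gauss_points k n). \<sigma> * inner_on k (x i) (x j) \<le> \<kappa> * Y i j} \<in> sets (gauss_points k n)"
      by measurable
  qed auto
  finally show ?thesis .
qed

text \<open>The price of revealing a vertex while \<open>m\<close> others remain. \<open>B\<close>
  averages over its length, and \<open>(real m)\<^sup>2 / 2\<close> counts, to leading order, the
  triangles at that vertex.\<close>

definition level_factor :: "real \<Rightarrow> real \<Rightarrow> real \<Rightarrow> real \<Rightarrow> nat \<Rightarrow> real" where
  "level_factor t \<sigma> \<kappa> B m = B * exp (- \<sigma> * hazard t ^ 3 * (real m)\<^sup>2 / (2 * \<kappa>) + hazard t ^ 4 * real m ^ 3 / \<kappa>\<^sup>2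
     + (1 + 2 * tilt_slope t))"

text \<open>Here \<gamma> is \<open>hazard t / \<kappa>\<close> because shifting a threshold by
  \<open>A i * A j / \<kappa>\<close> changes the exponent with slope
  \<open>hazard t\<close>.\<close>

lemma column_integral_le:
  assumes u: "u \<ge> 0" and \<sigma>: "\<sigma> = 1 \<or> \<sigma> = -1" and \<kappa>: "\<kappa> > 0" "2 * hazard t \<le> \<kappa>" "2 * real m * hazard t \<le> \<kappa>"
  shows "column_integral (\<sigma> * (hazard t / \<kappa>)) m u Y \<le> ennreal (exp ((\<Sum>i<m. tilt_log t + hazard t * Y i)
    - \<sigma> * hazard t ^ 3 * (real m)\<^sup>2 / (2 * \<kappa>) + hazard t ^ 4 * real m ^ 3 / \<kappa>\<^sup>2
    + (1 + 2 * tilt_slope t) + (2 * tilt_slope t + (hazard t)\<^sup>2) * real m * \<bar>u - 1\<bar>))"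
proof -
  define g where "g = hazard t / \<kappa>"
  have g: "0 < g" "g \<le> 1/2" "real m * g \<le> 1/2"
    using \<kappa> hazard_pos[of t] by (auto simp: g_def field_simps)
  have e: "(hazard t)\<^sup>2 * g * (real m)\<^sup>2 / 2 = hazard t ^ 3 * (real m)\<^sup>2 / (2 * \<kappa>)"
    "(hazard t)\<^sup>2 * g\<^sup>2 * real m ^ 3 = hazard t ^ 4 * real m ^ 3 / \<kappa>\<^sup>2"
    by (simp_all add: g_def power2_eq_square power3_eq_cube power4_eq_xxxx)
  from \<sigma> show ?thesis
  proof
    assume "\<sigma> = 1"
    then show ?thesis using column_integral_pos_le[OF u g, of Y t] unfolding e by (simp add: g_def)
  next
    assume "\<sigma> = -1"
    then show ?thesis using column_integral_neg_le[OF u g(1,3), of Y t] unfolding e by (simp add: g_def)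
  qed
qed

text \<open>Reveal the last vertex \<open>v\<close> and rotate it onto the last coordinate axis. The other vertices
  then split into their coordinate along \<open>v\<close>, which decides the edges at \<open>v\<close>, and an independent
  Gaussian vector of one dimension less, for which the thresholds have moved by the products of those
  coordinates. The exponential weights reproduce themselves under this step.\<close>

lemma clique_event_emeasure_Suc_le:
  assumes \<sigma>: "\<sigma> = 1 \<or> \<sigma> = -1" and \<kappa>: "\<kappa> > 0" "2 * hazard t \<le> \<kappa>" "2 * real n * hazard t \<le> \<kappa>"
    and B: "B \<ge> 0" "(\<integral>\<^sup>+v. ennreal (exp ((2 * tilt_slope t + (hazard t)\<^sup>2) * real n
        * \<bar>inner_on (Suc k) v v / \<kappa>\<^sup>2 - 1\<bar>)) \<partial>gauss (Suc k)) \<le> ennreal B"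
    and K: "K \<ge> 0" "\<And>Y. emeasure (gauss_points k n) (clique_event k n \<sigma> \<kappa> Y)
        \<le> ennreal (K * exp (\<Sum>j<n. \<Sum>i<j. tilt_log t + hazard t * Y i j))"
  shows "emeasure (gauss_points (Suc k) (Suc n)) (clique_event (Suc k) (Suc n) \<sigma> \<kappa> Y)
    \<le> ennreal (K * level_factor t \<sigma> \<kappa> B n * exp (\<Sum>j<Suc n. \<Sum>i<j. tilt_log t + hazard t * Y i j))"
proof -
  let ?\<mu> = "hazard t" and ?L = "tilt_log t"
  let ?P = "Pi\<^sub>M {..<n} (\<lambda>_. std_normal)"
  define W where "W = (\<Sum>j<n. \<Sum>i<j. ?L + ?\<mu> * Y i j)"
  define c2 where "c2 = 2 * tilt_slope t + ?\<mu>\<^sup>2"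
  define E where "E = (\<Sum>i<n. ?L + ?\<mu> * Y i n) - \<sigma> * ?\<mu> ^ 3 * (real n)\<^sup>2 / (2 * \<kappa>) + ?\<mu> ^ 4 * real n ^ 3 / \<kappa>\<^sup>2
    + (1 + 2 * tilt_slope t)"
  have s2: "\<sigma> * \<sigma> = 1" using \<sigma> by auto
  interpret G: product_sigma_finite "\<lambda>_::nat. gauss (Suc k)" by (rule product_sigma_finite_gauss)
  define S where "S = clique_event (Suc k) (Suc n) \<sigma> \<kappa> Y"
  have S[measurable]: "S \<in> sets (gauss_points (Suc k) (Suc n))" unfolding S_def by (rule sets_clique_event)
  have gp: "gauss_points (Suc k) (Suc n) = Pi\<^sub>M (insert n {..<n}) (\<lambda>_. gauss (Suc k))"
    by (simp add: gauss_points_def lessThan_Suc)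
  \<comment> \<open>For a fixed last vertex \<open>v\<close> the bound depends on \<open>v\<close>
    through its length alone, so that averaging over \<open>v\<close> later needs only the moment
    bound \<open>B\<close>.\<close>
  have slice: "(\<integral>\<^sup>+x. indicator S (x(n := v)) \<partial>gauss_points (Suc k) n)
      \<le> ennreal (K * exp W) * ennreal (exp (E + c2 * real n * \<bar>inner_on (Suc k) v v / \<kappa>\<^sup>2 - 1\<bar>))"
    if v: "v \<in> space (gauss (Suc k))" for v
  proof -
    define \<rho> where "\<rho> = norm_on (Suc k) v"
    define u where "u = inner_on (Suc k) v v / \<kappa>\<^sup>2"
    have u: "u \<ge> 0" by (simp add: u_def inner_on_self_nonneg)
    have su: "sqrt u = \<rho> / \<kappa>" using \<kappa> by (simp add: u_def \<rho>_def norm_on_def real_sqrt_divide)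
    obtain R where R[measurable]: "R \<in> measurable (gauss (Suc k)) (gauss (Suc k))"
      and dR: "distr (gauss (Suc k)) (gauss (Suc k)) R = gauss (Suc k)"
      and RR: "\<And>x y. inner_on (Suc k) (R x) (R y) = inner_on (Suc k) x y"
      and Rv: "\<And>x. inner_on (Suc k) x v = \<sigma> * norm_on (Suc k) v * R x (Suc k)"
      using gauss_rotation[of "Suc k" \<sigma> v] \<sigma> by auto
    \<comment> \<open>The event after the rotation. The sign in \<open>Rv\<close> cancels the sign
      of the colour, so the edges at \<open>v\<close> give half-lines of the same orientation for
      both colours.\<close>
    define Q where "Q = {y \<in> space (gauss_points (Suc k) n). (\<forall>i<n. \<rho> * y i (Suc k) \<le> \<kappa> * Y i n) \<and>
        (\<forall>j<n. \<forall>i<j. \<sigma> * inner_on (Suc k) (y i) (y j) \<le> \<kappa> * Y i j)}"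
    have Q[measurable]: "Q \<in> sets (gauss_points (Suc k) n)"
    proof -
      have "{y \<in> space (gauss_points (Suc k) n). \<rho> * y i (Suc k) \<le> \<kappa> * Y i n} \<in> sets (gauss_points (Suc k) n)" if "i < n" for i
      proof -
        have "(\<lambda>y. y i) \<in> measurable (gauss_points (Suc k) n) (Pi\<^sub>M {..Suc k} (\<lambda>_. borel))"
          using that by (rule measurable_gauss_points_component)
        from measurable_compose[OF this measurable_component_singleton[of "Suc k"]]
        have [measurable]: "(\<lambda>y. y i (Suc k)) \<in> borel_measurable (gauss_points (Suc k) n)" by simp
        show ?thesis by measurable
      qed
      then have "{y \<in> space (gauss_points (Suc k) n). \<forall>i\<in>{..<n}. \<rho> * y i (Suc k) \<le> \<kappa> * Y i n} \<in> sets (gauss_points (Suc k) n)"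
        by (intro sets.sets_Collect_finite_All) auto
      from sets.Int[OF this sets_clique_event[of "Suc k" n \<sigma> \<kappa> Y]]
      show ?thesis unfolding Q_def clique_event_def by (rule back_subst[of "\<lambda>A. A \<in> _"]) auto
    qed
    have "(\<integral>\<^sup>+x. indicator S (x(n := v)) \<partial>gauss_points (Suc k) n)
      = (\<integral>\<^sup>+x. indicator Q (\<lambda>i\<in>{..<n}. R (x i)) \<partial>gauss_points (Suc k) n)"
    proof (rule nn_integral_cong)
      fix x assume x: "x \<in> space (gauss_points (Suc k) n)"
      have "x(n := v) \<in> space (gauss_points (Suc k) (Suc n))"
        using x v by (auto simp: space_gauss_points space_gauss PiE_iff extensional_def)
      moreover have "(\<lambda>i\<in>{..<n}. R (x i)) \<in> space (gauss_points (Suc k) n)"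
        using x measurable_space[OF R] by (auto simp: space_gauss_points space_gauss PiE_iff)
      moreover have "\<sigma> * inner_on (Suc k) (x i) v = \<rho> * R (x i) (Suc k)" for i
        unfolding Rv \<rho>_def using s2 by (simp add: mult.assoc[symmetric])
      ultimately have "x(n := v) \<in> S \<longleftrightarrow> (\<lambda>i\<in>{..<n}. R (x i)) \<in> Q"
        by (auto simp: S_def clique_event_def Q_def RR less_Suc_eq)
      then show "indicator S (x(n := v)) = (indicator Q (\<lambda>i\<in>{..<n}. R (x i)) :: ennreal)"
        by (simp add: indicator_def)
    qed
    also have "\<dots> = (\<integral>\<^sup>+x. indicator Q x \<partial>gauss_points (Suc k) n)"
      by (rule nn_integral_gauss_points_map[OF R dR]) measurable
    also have "\<dots> = (\<integral>\<^sup>+A. \<integral>\<^sup>+x. indicator Q (\<lambda>i\<in>{..<n}. (x i)(Suc k := A i)) \<partial>gauss_points k n \<partial>?P)"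
      by (rule gauss_points_Suc_nn_integral) measurable
    also have "\<dots> \<le> (\<integral>\<^sup>+A. ennreal (K * exp W) * ((\<Prod>i<n. indicator {x. sqrt u * x \<le> Y i n} (A i)) *
        ennreal (exp (- (\<sigma> * (?\<mu> / \<kappa>)) * (\<Sum>j<n. \<Sum>i<j. A i * A j)))) \<partial>?P)"
    proof (rule nn_integral_mono)
      fix A :: "nat \<Rightarrow> real"
      \<comment> \<open>Splitting off the last coordinate removes \<open>A i * A j\<close> from the
        inner products. As \<open>K\<close> holds for arbitrary thresholds, the new ones may depend
        on the column.\<close>
      let ?Y = "\<lambda>i j. Y i j - \<sigma> * (A i * A j) / \<kappa>"
      let ?ind = "(\<Prod>i<n. indicator {x. sqrt u * x \<le> Y i n} (A i)) :: ennreal"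
      have "(\<integral>\<^sup>+x. indicator Q (\<lambda>i\<in>{..<n}. (x i)(Suc k := A i)) \<partial>gauss_points k n)
        \<le> (\<integral>\<^sup>+x. ?ind * indicator (clique_event k n \<sigma> \<kappa> ?Y) x \<partial>gauss_points k n)"
      proof (rule nn_integral_mono)
        fix x assume x: "x \<in> space (gauss_points k n)"
        show "indicator Q (\<lambda>i\<in>{..<n}. (x i)(Suc k := A i)) \<le> ?ind * indicator (clique_event k n \<sigma> \<kappa> ?Y) x"
        proof (cases "(\<lambda>i\<in>{..<n}. (x i)(Suc k := A i)) \<in> Q")
          case True
          have "\<sigma> * inner_on k (x i) (x j) \<le> \<kappa> * ?Y i j" if "i < j" "j < n" for i j
          proof -
            have "\<sigma> * inner_on (Suc k) ((x i)(Suc k := A i)) ((x j)(Suc k := A j)) \<le> \<kappa> * Y i j"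
              using True that by (auto simp: Q_def)
            moreover have "inner_on (Suc k) ((x i)(Suc k := A i)) ((x j)(Suc k := A j)) = inner_on k (x i) (x j) + A i * A j"
              by (simp add: inner_on_Suc) (simp add: inner_on_def)
            ultimately show ?thesis using \<kappa> by (simp add: algebra_simps)
          qed
          then have "x \<in> clique_event k n \<sigma> \<kappa> ?Y" using x by (auto simp: clique_event_def)
          moreover have "sqrt u * A i \<le> Y i n" if "i < n" for i
          proof -
            have "\<rho> * A i \<le> \<kappa> * Y i n" using True that by (auto simp: Q_def)
            then show ?thesis using \<kappa> by (simp add: su field_simps)
          qed
          ultimately show ?thesis by (simp add: indicator_def)
        qed simp
      qed
      also have "\<dots> = ?ind * emeasure (gauss_points k n) (clique_event k n \<sigma> \<kappa> ?Y)"
        by (subst nn_integral_cmult) (auto intro!: borel_measurable_indicator sets_clique_event simp: nn_integral_indicator[OF sets_clique_event])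
      also have "\<dots> \<le> ?ind * ennreal (K * exp (\<Sum>j<n. \<Sum>i<j. ?L + ?\<mu> * ?Y i j))"
        by (intro mult_left_mono K(2)) simp
      \<comment> \<open>By linearity the shift factors out, as exactly the weight of
        \<open>column_integral\<close>.\<close>
      also have "(\<Sum>j<n. \<Sum>i<j. ?L + ?\<mu> * ?Y i j) = W + - (\<sigma> * (?\<mu> / \<kappa>)) * (\<Sum>j<n. \<Sum>i<j. A i * A j)"
        unfolding W_def sum_distrib_left sum.distrib[symmetric]
        by (intro sum.cong refl) (simp add: algebra_simps)
      also have "ennreal (K * exp (W + - (\<sigma> * (?\<mu> / \<kappa>)) * (\<Sum>j<n. \<Sum>i<j. A i * A j)))
         = ennreal (K * exp W) * ennreal (exp (- (\<sigma> * (?\<mu> / \<kappa>)) * (\<Sum>j<n. \<Sum>i<j. A i * A j)))"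
        using K(1) unfolding exp_add by (subst ennreal_mult[symmetric]) (auto simp: mult.assoc)
      finally show "(\<integral>\<^sup>+x. indicator Q (\<lambda>i\<in>{..<n}. (x i)(Suc k := A i)) \<partial>gauss_points k n)
         \<le> ennreal (K * exp W) * (?ind * ennreal (exp (- (\<sigma> * (?\<mu> / \<kappa>)) * (\<Sum>j<n. \<Sum>i<j. A i * A j))))"
        by (simp only: mult.left_commute[of "ennreal (K * exp W)"])
    qed
    also have "\<dots> = ennreal (K * exp W) * column_integral (\<sigma> * (?\<mu> / \<kappa>)) n u (\<lambda>i. Y i n)"
      unfolding column_integral_def by (rule nn_integral_cmult) measurable
    also have "\<dots> \<le> ennreal (K * exp W) * ennreal (exp (E + c2 * real n * \<bar>u - 1\<bar>))"
      unfolding E_def c2_def using column_integral_le[OF u \<sigma> \<kappa>, of "\<lambda>i. Y i n"] by (intro mult_left_mono) auto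
    finally show ?thesis by (simp add: u_def)
  qed
  have "emeasure (gauss_points (Suc k) (Suc n)) S = (\<integral>\<^sup>+x. indicator S x \<partial>gauss_points (Suc k) (Suc n))"
    by simp
  also have "\<dots> = (\<integral>\<^sup>+v. \<integral>\<^sup>+x. indicator S (x(n := v)) \<partial>gauss_points (Suc k) n \<partial>gauss (Suc k))"
    using S unfolding gp gauss_points_def[of "Suc k" n]
    by (intro G.product_nn_integral_insert_rev) auto
  also have "\<dots> \<le> (\<integral>\<^sup>+v. ennreal (K * exp W * exp E) * ennreal (exp (c2 * real n * \<bar>inner_on (Suc k) v v / \<kappa>\<^sup>2 - 1\<bar>)) \<partial>gauss (Suc k))"
    using K(1) by (intro nn_integral_mono order_trans[OF slice])
      (auto simp: exp_add ennreal_mult mult.assoc)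
  also have "\<dots> \<le> ennreal (K * exp W * exp E) * ennreal B"
    using B(2) unfolding c2_def
    by (subst nn_integral_cmult) (auto intro!: mult_left_mono)
  also have "\<dots> = ennreal (K * exp W * exp E * B)"
    using K(1) B(1) by (subst ennreal_mult) auto
  also have "K * exp W * exp E * B = K * level_factor t \<sigma> \<kappa> B n * exp (\<Sum>j<Suc n. \<Sum>i<j. ?L + ?\<mu> * Y i j)"
  proof -
    have "(\<Sum>j<Suc n. \<Sum>i<j. ?L + ?\<mu> * Y i j) = W + (\<Sum>i<n. ?L + ?\<mu> * Y i n)" by (simp add: W_def)
    then show ?thesis unfolding level_factor_def E_def by (simp add: mult_ac flip: exp_add)
  qed
  finally show ?thesis by (simp add: S_def)
qed

text \<open>Each step adds a vertex and a dimension at the same scale \<kappa>, so the moment bound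
  \<open>B\<close> is required uniformly for the dimensions between \<open>k0\<close> and
  \<open>k0 + N\<close>. The induction starts without vertices, where a probability is bounded by
  1.\<close>

lemma clique_event_emeasure_le:
  assumes \<sigma>: "\<sigma> = 1 \<or> \<sigma> = -1" and \<kappa>: "\<kappa> > 0" "2 * hazard t \<le> \<kappa>" "2 * real N * hazard t \<le> \<kappa>"
    and B: "B \<ge> 0" "\<And>m k'. m \<le> N \<Longrightarrow> k0 \<le> k' \<Longrightarrow> k' \<le> k0 + N \<Longrightarrow>
      (\<integral>\<^sup>+v. ennreal (exp ((2 * tilt_slope t + (hazard t)\<^sup>2) * real m
        * \<bar>inner_on k' v v / \<kappa>\<^sup>2 - 1\<bar>)) \<partial>gauss k') \<le> ennreal B"
    and n: "n \<le> N"
  shows "emeasure (gauss_points (k0 + n) n) (clique_event (k0 + n) n \<sigma> \<kappa> Y)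
    \<le> ennreal ((\<Prod>m<n. level_factor t \<sigma> \<kappa> B m) * exp (\<Sum>j<n. \<Sum>i<j. tilt_log t + hazard t * Y i j))"
  using n
proof (induction n arbitrary: Y)
  case 0
  interpret prob_space "gauss_points (k0 + 0) 0" by (rule prob_space_gauss_points)
  show ?case using emeasure_le_1 by simp
next
  case (Suc n)
  have "2 * real n * hazard t \<le> \<kappa>"
  proof -
    have "real n * (2 * hazard t) \<le> real N * (2 * hazard t)"
      using Suc.prems hazard_pos[of t] by (intro mult_right_mono) auto
    then show ?thesis using \<kappa> by simp
  qed
  then have "emeasure (gauss_points (Suc (k0 + n)) (Suc n)) (clique_event (Suc (k0 + n)) (Suc n) \<sigma> \<kappa> Y)
    \<le> ennreal ((\<Prod>m<n. level_factor t \<sigma> \<kappa> B m) * level_factor t \<sigma> \<kappa> B n * exp (\<Sum>j<Suc n. \<Sum>i<j. tilt_log t + hazard t * Y i j))"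
    using Suc B \<sigma> \<kappa>
    by (intro clique_event_emeasure_Suc_le) (auto intro!: prod_nonneg simp: level_factor_def)
  then show ?case by simp
qed

section \<open>Uniform points on the sphere as normalised Gaussian vectors\<close>

abbreviation lebesgue_on_coords :: "nat \<Rightarrow> (nat \<Rightarrow> real) measure" where
  "lebesgue_on_coords k \<equiv> Pi\<^sub>M {..k} (\<lambda>_. lborel)"

interpretation lborel_prod: product_sigma_finite "\<lambda>_::nat. lborel :: real measure" ..

text \<open>The density is a function of the norm alone; this is the source of the independence of
  norm and direction.\<close>

lemma gauss_eq_density:
  "gauss k = density (lebesgue_on_coords k) (\<lambda>x. ennreal ((1 / sqrt (2 * pi)) ^ Suc k * exp (- (norm_on k x)\<^sup>2 / 2)))"
proof -
  let ?d = "\<lambda>x. \<Prod>i\<le>k. ennreal (std_normal_density (x i))"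
  have "density (lebesgue_on_coords k) ?d = Pi\<^sub>M {..k} (\<lambda>_. std_normal)"
  proof (rule std.PiM_eqI)
    show "sets (density (lebesgue_on_coords k) ?d) = sets (Pi\<^sub>M {..k} (\<lambda>_. std_normal))"
      by (simp, intro sets_PiM_cong) auto
    fix A assume A: "\<And>i. i \<in> {..k} \<Longrightarrow> A i \<in> sets std_normal"
    then have [measurable]: "Pi\<^sub>E {..k} A \<in> sets (lebesgue_on_coords k)" by (intro sets_PiM_I_finite) auto
    have "emeasure (density (lebesgue_on_coords k) ?d) (Pi\<^sub>E {..k} A) = (\<integral>\<^sup>+x. ?d x * indicator (Pi\<^sub>E {..k} A) x \<partial>lebesgue_on_coords k)"
      by (rule emeasure_density) measurable
    also have "\<dots> = (\<integral>\<^sup>+x. (\<Prod>i\<le>k. ennreal (std_normal_density (x i)) * indicator (A i) (x i)) \<partial>lebesgue_on_coords k)"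
    proof (rule nn_integral_cong)
      fix x assume "x \<in> space (lebesgue_on_coords k)"
      then have x: "x \<in> extensional {..k}" by (auto simp: space_PiM PiE_iff)
      have "indicator (Pi\<^sub>E {..k} A) x = (\<Prod>i\<le>k. indicator (A i) (x i) :: ennreal)"
      proof (cases "\<forall>i\<le>k. x i \<in> A i")
        case True
        then show ?thesis using x by (simp add: PiE_iff)
      next
        case False
        then obtain i where "i \<le> k" "x i \<notin> A i" by blast
        then show ?thesis by (auto simp: indicator_def PiE_iff intro!: prod_zero[symmetric])
      qed
      then show "?d x * indicator (Pi\<^sub>E {..k} A) x = (\<Prod>i\<le>k. ennreal (std_normal_density (x i)) * indicator (A i) (x i))"
        by (simp add: prod.distrib)
    qed
    also have "\<dots> = (\<Prod>i\<le>k. \<integral>\<^sup>+x. ennreal (std_normal_density x) * indicator (A i) x \<partial>lborel)"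
      using A by (intro lborel_prod.product_nn_integral_prod) auto
    also have "\<dots> = (\<Prod>i\<le>k. emeasure std_normal (A i))"
      using A by (intro prod.cong) (auto simp: emeasure_density)
    finally show "emeasure (density (lebesgue_on_coords k) ?d) (Pi\<^sub>E {..k} A) = (\<Prod>i\<in>{..k}. emeasure std_normal (A i))" .
  qed simp
  moreover have "?d x = ennreal ((1 / sqrt (2 * pi)) ^ Suc k * exp (- (norm_on k x)\<^sup>2 / 2))" for x
  proof -
    have "(\<Prod>i\<le>k. std_normal_density (x i)) = (\<Prod>i\<le>k. 1 / sqrt (2 * pi)) * exp (\<Sum>i\<le>k. - (x i)\<^sup>2 / 2)"
      unfolding std_normal_density_def prod.distrib by (simp add: exp_sum)
    also have "(\<Sum>i\<le>k. - (x i)\<^sup>2 / 2) = - (norm_on k x)\<^sup>2 / 2"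
      unfolding norm_on_square inner_on_def by (simp add: power2_eq_square sum_negf flip: sum_divide_distrib)
    also have "(\<Prod>i\<le>k. 1 / sqrt (2 * pi)) = (1 / sqrt (2 * pi)) ^ Suc k" by (simp only: prod_constant card_atMost)
    finally show ?thesis unfolding prod_ennreal[OF normal_density_nonneg] by (simp only:)
  qed
  ultimately show ?thesis by (simp add: gauss_def)
qed

lemma sets_lebesgue_on_coords [measurable_cong]: "sets (lebesgue_on_coords k) = sets (Pi\<^sub>M {..k} (\<lambda>_. borel))"
  by (intro sets_PiM_cong) auto

lemma measurable_normalize_on [measurable]:
  "normalize_on k \<in> measurable (lebesgue_on_coords k) (Pi\<^sub>M {..k} (\<lambda>_. borel))"
  unfolding normalize_on_def by (rule measurable_restrict) measurable

section \<open>Scaling of Lebesgue measure and polar decomposition\<close>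

lemma emeasure_lborel_scale:
  assumes "s > 0" "A \<in> sets borel"
  shows "emeasure lborel A = ennreal s * emeasure lborel {x::real. s * x \<in> A}"
proof -
  have [measurable]: "A \<in> sets borel" by fact
  have "emeasure lborel A = (\<integral>\<^sup>+x. indicator A x \<partial>lborel)" using assms by simp
  also have "\<dots> = \<bar>s\<bar> * (\<integral>\<^sup>+x. indicator A (0 + s * x) \<partial>lborel)"
    by (rule nn_integral_real_affine) (use assms in auto)
  also have "(\<integral>\<^sup>+x. indicator A (0 + s * x) \<partial>lborel) = (\<integral>\<^sup>+x. indicator {x. s * x \<in> A} x \<partial>lborel)"
    by (intro nn_integral_cong) (simp add: indicator_def)
  also have "\<dots> = emeasure lborel {x::real. s * x \<in> A}" by (rule nn_integral_indicator) measurable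
  finally show ?thesis using assms by simp
qed

lemma lebesgue_on_coords_scale:
  assumes s: "s > 0"
  shows "scale_measure (ennreal (s ^ Suc k)) (distr (lebesgue_on_coords k) (lebesgue_on_coords k) (\<lambda>x. \<lambda>i\<in>{..k}. s * x i))
    = lebesgue_on_coords k"
proof (rule lborel_prod.PiM_eqI)
  let ?T = "\<lambda>x. \<lambda>i\<in>{..k}. s * x i"
  have T[measurable]: "?T \<in> measurable (lebesgue_on_coords k) (lebesgue_on_coords k)"
    by (rule measurable_restrict) measurable
  fix A :: "nat \<Rightarrow> real set" assume A: "\<And>i. i \<in> {..k} \<Longrightarrow> A i \<in> sets lborel"
  have A': "{x. s * x \<in> A i} \<in> sets lborel" if "i \<le> k" for i
  proof -
    have [measurable]: "A i \<in> sets borel" using A that by simp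
    show ?thesis by measurable
  qed
  have "emeasure (distr (lebesgue_on_coords k) (lebesgue_on_coords k) ?T) (Pi\<^sub>E {..k} A)
    = emeasure (lebesgue_on_coords k) (?T -` Pi\<^sub>E {..k} A \<inter> space (lebesgue_on_coords k))"
    using A by (intro emeasure_distr T sets_PiM_I_finite) auto
  also have "?T -` Pi\<^sub>E {..k} A \<inter> space (lebesgue_on_coords k) = Pi\<^sub>E {..k} (\<lambda>i. {x. s * x \<in> A i})"
    by (auto simp: space_PiM PiE_iff)
  also have "emeasure (lebesgue_on_coords k) \<dots> = (\<Prod>i\<le>k. emeasure lborel {x. s * x \<in> A i})"
    using A' by (intro lborel_prod.emeasure_PiM) auto
  finally have "emeasure (scale_measure (ennreal (s ^ Suc k)) (distr (lebesgue_on_coords k) (lebesgue_on_coords k) ?T)) (Pi\<^sub>E {..k} A)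
    = ennreal (s ^ Suc k) * (\<Prod>i\<le>k. emeasure lborel {x. s * x \<in> A i})"
    by (simp only: emeasure_scale_measure)
  also have "\<dots> = (\<Prod>i\<le>k. ennreal s) * (\<Prod>i\<le>k. emeasure lborel {x. s * x \<in> A i})"
  proof -
    have "ennreal (s ^ Suc k) = (\<Prod>i\<le>k. ennreal s)"
      unfolding prod_constant card_atMost by (rule ennreal_power[symmetric]) (use s in simp)
    then show ?thesis by (simp only:)
  qed
  also have "(\<Prod>i\<le>k. ennreal s) * (\<Prod>i\<le>k. emeasure lborel {x. s * x \<in> A i}) = (\<Prod>i\<le>k. ennreal s * emeasure lborel {x. s * x \<in> A i})"
    by (simp only: prod.distrib)
  also have "\<dots> = (\<Prod>i\<le>k. emeasure lborel (A i))"
    using A s by (intro prod.cong emeasure_lborel_scale[symmetric]) auto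
  finally show "emeasure (scale_measure (ennreal (s ^ Suc k)) (distr (lebesgue_on_coords k) (lebesgue_on_coords k) ?T)) (Pi\<^sub>E {..k} A)
    = (\<Prod>i\<in>{..k}. emeasure lborel (A i))" .
qed simp_all

text \<open>The sector over \<open>A\<close> in the ball of radius \<open>s\<close>. For
  \<open>s = 1\<close> its share of the ball is the uniform measure of \<open>A\<close>.\<close>

definition cone_ball :: "nat \<Rightarrow> (nat \<Rightarrow> real) set \<Rightarrow> real \<Rightarrow> (nat \<Rightarrow> real) set" where
  "cone_ball k A s = {x \<in> {..k} \<rightarrow>\<^sub>E UNIV. norm_on k x \<le> s \<and> normalize_on k x \<in> A}"

lemma sets_cone_ball:
  assumes [measurable]: "A \<in> sets (Pi\<^sub>M {..k} (\<lambda>_. borel))"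
  shows "cone_ball k A s \<in> sets (lebesgue_on_coords k)"
proof -
  have "cone_ball k A s = {x \<in> space (lebesgue_on_coords k). norm_on k x \<le> s \<and> normalize_on k x \<in> A}"
    by (auto simp: cone_ball_def space_PiM)
  also have "\<dots> \<in> sets (lebesgue_on_coords k)" by measurable
  finally show ?thesis .
qed

lemma norm_on_scale: "norm_on k (\<lambda>i\<in>{..k}. s * x i) = \<bar>s\<bar> * norm_on k x"
proof -
  have "inner_on k (\<lambda>i\<in>{..k}. s * x i) (\<lambda>i\<in>{..k}. s * x i) = s\<^sup>2 * inner_on k x x"
    unfolding inner_on_def sum_distrib_left by (intro sum.cong) (simp_all add: power2_eq_square)
  then show ?thesis unfolding norm_on_def by (simp only: real_sqrt_mult real_sqrt_abs)
qed

lemma normalize_on_scale: "s > 0 \<Longrightarrow> normalize_on k (\<lambda>i\<in>{..k}. s * x i) = normalize_on k x"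
  by (auto simp: normalize_on_def norm_on_scale fun_eq_iff)

lemma emeasure_cone_ball:
  assumes A: "A \<in> sets (Pi\<^sub>M {..k} (\<lambda>_. borel))" and s: "s > 0"
  shows "emeasure (lebesgue_on_coords k) (cone_ball k A s) = ennreal (s ^ Suc k) * emeasure (lebesgue_on_coords k) (cone_ball k A 1)"
proof -
  let ?T = "\<lambda>x. \<lambda>i\<in>{..k}. s * x i"
  have T: "?T \<in> measurable (lebesgue_on_coords k) (lebesgue_on_coords k)"
    by (rule measurable_restrict) measurable
  have "emeasure (lebesgue_on_coords k) (cone_ball k A s)
    = ennreal (s ^ Suc k) * emeasure (distr (lebesgue_on_coords k) (lebesgue_on_coords k) ?T) (cone_ball k A s)"
    using emeasure_scale_measure[of "ennreal (s ^ Suc k)" _ "cone_ball k A s"]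
    by (subst lebesgue_on_coords_scale[OF s, symmetric])
  also have "emeasure (distr (lebesgue_on_coords k) (lebesgue_on_coords k) ?T) (cone_ball k A s)
    = emeasure (lebesgue_on_coords k) (?T -` cone_ball k A s \<inter> space (lebesgue_on_coords k))"
    by (rule emeasure_distr[OF T sets_cone_ball[OF A]])
  also have "?T -` cone_ball k A s \<inter> space (lebesgue_on_coords k) = cone_ball k A 1"
  proof (rule set_eqI)
    fix x
    have "\<bar>s\<bar> * norm_on k x \<le> s \<longleftrightarrow> norm_on k x \<le> 1"
      using s mult_le_cancel_left_pos[of s "norm_on k x" 1] by simp
    moreover have "?T x \<in> {..k} \<rightarrow>\<^sub>E UNIV" by (rule restrict_PiE_iff[THEN iffD2]) simp
    ultimately show "x \<in> ?T -` cone_ball k A s \<inter> space (lebesgue_on_coords k) \<longleftrightarrow> x \<in> cone_ball k A 1"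
      unfolding vimage_def cone_ball_def space_PiM Int_iff mem_Collect_eq norm_on_scale normalize_on_scale[OF s]
      by auto
  qed
  finally show ?thesis .
qed

lemma norm_on_eq_0_iff:
  "x \<in> {..k} \<rightarrow>\<^sub>E UNIV \<Longrightarrow> norm_on k x = 0 \<longleftrightarrow> x \<in> PiE {..k} (\<lambda>_. {0})"
  by (auto simp: norm_on_def inner_on_def sum_nonneg_eq_0_iff PiE_iff extensional_def fun_eq_iff)

lemma emeasure_cone_ball_nonpos:
  assumes A: "A \<in> sets (Pi\<^sub>M {..k} (\<lambda>_. borel))" and s: "s \<le> 0"
  shows "emeasure (lebesgue_on_coords k) (cone_ball k A s) = 0"
proof -
  have "cone_ball k A s \<subseteq> PiE {..k} (\<lambda>_. {0})"
  proof
    fix x assume x: "x \<in> cone_ball k A s"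
    then have "norm_on k x = 0" using s norm_on_nonneg[of k x] by (auto simp: cone_ball_def)
    then show "x \<in> PiE {..k} (\<lambda>_. {0})" using x norm_on_eq_0_iff[of x k] by (auto simp: cone_ball_def)
  qed
  moreover have "emeasure (lebesgue_on_coords k) (PiE {..k} (\<lambda>_. {0})) = 0"
    by (subst lborel_prod.emeasure_PiM) (auto simp: prod_zero)
  moreover have "PiE {..k} (\<lambda>_. {0}) \<in> sets (lebesgue_on_coords k)"
    by (intro sets_PiM_I_finite) auto
  ultimately show ?thesis by (metis emeasure_mono le_zero_eq)
qed

lemma unit_ball_eq_cone_ball: "unit_ball k = cone_ball k ({..k} \<rightarrow>\<^sub>E UNIV) 1"
  by (auto simp: unit_ball_def cone_ball_def normalize_on_def)

lemma emeasure_unit_ball: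
  "emeasure (lebesgue_on_coords k) (unit_ball k) \<noteq> 0" "emeasure (lebesgue_on_coords k) (unit_ball k) \<noteq> \<infinity>"
proof -
  have ball: "unit_ball k = {x. sqrt (\<Sum>i\<in>{..k}. (x i)\<^sup>2) \<le> 1} \<inter> space (lebesgue_on_coords k)"
    by (auto simp: unit_ball_def norm_on_def inner_on_def space_PiM power2_eq_square)
  have "emeasure (lebesgue_on_coords k) (unit_ball k) = ennreal (unit_ball_vol (real (card {..k})))"
    unfolding ball by (subst emeasure_cball_aux) auto
  then show "emeasure (lebesgue_on_coords k) (unit_ball k) \<noteq> 0" "emeasure (lebesgue_on_coords k) (unit_ball k) \<noteq> \<infinity>"
    by (auto simp: ennreal_eq_0_iff not_le)
qed

lemma emeasure_uniform_sphere:
  assumes A: "A \<in> sets (uniform_sphere k)"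
  shows "emeasure (uniform_sphere k) A = emeasure (lebesgue_on_coords k) (cone_ball k A 1) / emeasure (lebesgue_on_coords k) (unit_ball k)"
    and "A \<in> sets (Pi\<^sub>M {..k} (\<lambda>_. borel))"
proof -
  let ?U = "uniform_measure (lebesgue_on_coords k) (unit_ball k)"
  let ?B = "Pi\<^sub>M {..k} (\<lambda>_. borel) :: (nat \<Rightarrow> real) measure"
  have sub: "A \<subseteq> unit_sphere k" using sets.sets_into_space[OF A] by (simp add: space_uniform_sphere)
  show A': "A \<in> sets ?B"
    using A unit_sphere_sets[of k] unfolding sets_uniform_sphere
    by (subst (asm) sets_restrict_space_iff) (auto simp: space_PiM unit_sphere_def)
  have nrm: "normalize_on k \<in> measurable ?U ?B" by simp
  have ball: "unit_ball k \<in> sets (lebesgue_on_coords k)"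
    unfolding unit_ball_eq_cone_ball by (rule sets_cone_ball) (simp add: sets_PiM_I_finite)
  have "emeasure (uniform_sphere k) A = emeasure (distr ?U ?B (normalize_on k)) A"
    unfolding uniform_sphere_def using sub unit_sphere_sets[of k]
    by (intro emeasure_restrict_space) (auto simp: space_PiM unit_sphere_def)
  also have "\<dots> = emeasure ?U (normalize_on k -` A \<inter> space ?U)"
    by (rule emeasure_distr[OF nrm A'])
  also have "\<dots> = emeasure (lebesgue_on_coords k) (unit_ball k \<inter> (normalize_on k -` A \<inter> space ?U)) / emeasure (lebesgue_on_coords k) (unit_ball k)"
    using measurable_sets[OF nrm A'] ball by (intro emeasure_uniform_measure) auto
  also have "unit_ball k \<inter> (normalize_on k -` A \<inter> space ?U) = cone_ball k A 1"
    by (auto simp: unit_ball_def cone_ball_def space_PiM)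
  finally show "emeasure (uniform_sphere k) A = emeasure (lebesgue_on_coords k) (cone_ball k A 1) / emeasure (lebesgue_on_coords k) (unit_ball k)" .
qed

text \<open>Polar coordinates without a surface measure: restricted to the cone over
  \<open>A\<close> or not, the norm has sector volumes as its distribution function. By homogeneity
  these are proportional for all radii, hence so are the two image measures.\<close>

lemma radial_integral:
  assumes A: "A \<in> sets (uniform_sphere k)" and h[measurable]: "h \<in> borel_measurable borel"
  shows "(\<integral>\<^sup>+x. indicator A (normalize_on k x) * h (norm_on k x) \<partial>lebesgue_on_coords k)
    = emeasure (uniform_sphere k) A * (\<integral>\<^sup>+x. h (norm_on k x) \<partial>lebesgue_on_coords k)"
proof -
  let ?L = "lebesgue_on_coords k"
  let ?\<alpha> = "emeasure (uniform_sphere k) A"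
  note A'[measurable] = emeasure_uniform_sphere(2)[OF A]
  have [measurable]: "norm_on k \<in> borel_measurable ?L" by measurable
  define N where "N S = distr (density ?L (\<lambda>x. indicator S (normalize_on k x))) borel (norm_on k)" for S
  have N: "emeasure (N S) {..s} = emeasure ?L (cone_ball k S s)" if [measurable]: "S \<in> sets (Pi\<^sub>M {..k} (\<lambda>_. borel))" for S s
  proof -
    have "emeasure (N S) {..s} = emeasure (density ?L (\<lambda>x. indicator S (normalize_on k x))) (norm_on k -` {..s} \<inter> space ?L)"
      unfolding N_def by (subst emeasure_distr) auto
    also have "\<dots> = (\<integral>\<^sup>+x. indicator S (normalize_on k x) * indicator (norm_on k -` {..s} \<inter> space ?L) x \<partial>?L)"
      by (rule emeasure_density) measurable
    also have "\<dots> = (\<integral>\<^sup>+x. indicator (cone_ball k S s) x \<partial>?L)"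
      by (intro nn_integral_cong) (auto simp: indicator_def cone_ball_def space_PiM)
    also have "\<dots> = emeasure ?L (cone_ball k S s)" using sets_cone_ball[OF that] by simp
    finally show ?thesis .
  qed
  let ?F = "{..k} \<rightarrow>\<^sub>E UNIV :: (nat \<Rightarrow> real) set"
  have F[measurable]: "?F \<in> sets (Pi\<^sub>M {..k} (\<lambda>_. borel))" by (simp add: sets_PiM_I_finite)
  have \<alpha>: "emeasure ?L (cone_ball k A 1) = ?\<alpha> * emeasure ?L (cone_ball k ?F 1)"
    using emeasure_uniform_sphere(1)[OF A] emeasure_unit_ball[of k]
    by (simp add: unit_ball_eq_cone_ball ennreal_divide_times ennreal_divide_self top.not_eq_extremum)
  have eq: "emeasure (N A) {..s} = ?\<alpha> * emeasure (N ?F) {..s}" for s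
  proof (cases "s > 0")
    case True
    then show ?thesis using emeasure_cone_ball[OF A' True] emeasure_cone_ball[OF F True] \<alpha>
      by (simp add: N[OF A'] N[OF F] mult_ac del: power_Suc)
  next
    case False
    then show ?thesis using emeasure_cone_ball_nonpos[OF A', of s] emeasure_cone_ball_nonpos[OF F, of s]
      by (simp add: N[OF A'] N[OF F])
  qed
  have "N A = scale_measure ?\<alpha> (N ?F)"
  proof (rule measure_eqI_generator_eq[where E = "range (\<lambda>s. {..s})" and \<Omega> = UNIV and A = "\<lambda>n. {..real n}"])
    show "Int_stable (range (\<lambda>s::real. {..s}))"
      by (auto simp: Int_stable_def)
    show "sets (N A) = sigma_sets UNIV (range (\<lambda>s. {..s}))"
      by (simp add: N_def borel_eq_atMost)
    show "sets (scale_measure ?\<alpha> (N ?F)) = sigma_sets UNIV (range (\<lambda>s. {..s}))"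
      by (simp add: N_def borel_eq_atMost)
    show "(\<Union>n. {..real n}) = UNIV" by (auto intro: real_arch_simple)
    show "emeasure (N A) {..real n} \<noteq> \<infinity>" for n
    proof (cases "n = 0")
      case True
      then show ?thesis using emeasure_cone_ball_nonpos[OF A', of 0] by (simp add: N[OF A'])
    next
      case False
      have "emeasure ?L (cone_ball k A 1) \<le> emeasure ?L (unit_ball k)"
        unfolding unit_ball_eq_cone_ball
        by (intro emeasure_mono sets_cone_ball F) (auto simp: cone_ball_def normalize_on_def)
      then have "emeasure ?L (cone_ball k A 1) < \<infinity>"
        using emeasure_unit_ball(2)[of k] by (auto simp: less_top[symmetric] top_unique)
      then show ?thesis using emeasure_cone_ball[OF A', of "real n"] False
        by (simp add: N[OF A'] ennreal_mult_eq_top_iff del: power_Suc)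
    qed
  qed (auto simp: eq)
  then have "(\<integral>\<^sup>+r. h r \<partial>N A) = ?\<alpha> * (\<integral>\<^sup>+r. h r \<partial>N ?F)"
    by (simp add: nn_integral_scale_measure N_def)
  moreover have "(\<integral>\<^sup>+r. h r \<partial>N S) = (\<integral>\<^sup>+x. indicator S (normalize_on k x) * h (norm_on k x) \<partial>?L)"
    if [measurable]: "S \<in> sets (Pi\<^sub>M {..k} (\<lambda>_. borel))" for S
    unfolding N_def by (subst nn_integral_distr, measurable, subst nn_integral_density) auto
  moreover have "indicator ?F (normalize_on k x) = (1::ennreal)" for x
    by (simp add: normalize_on_def)
  ultimately show ?thesis using A' F by simp
qed

text \<open>Since the Gaussian density depends on the norm only, it can be made part of the radial
  weight \<open>h\<close>.\<close>

lemma gauss_norm_direction_indep: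
  assumes A: "A \<in> sets (uniform_sphere k)" and \<Gamma>[measurable]: "\<Gamma> \<in> sets borel"
  shows "emeasure (gauss k) {x \<in> space (gauss k). normalize_on k x \<in> A \<and> norm_on k x \<in> \<Gamma>}
    = emeasure (uniform_sphere k) A * emeasure (gauss k) {x \<in> space (gauss k). norm_on k x \<in> \<Gamma>}"
proof -
  let ?L = "lebesgue_on_coords k"
  note A'[measurable] = emeasure_uniform_sphere(2)[OF A]
  define h where "h r = ennreal ((1 / sqrt (2 * pi)) ^ Suc k * exp (- r\<^sup>2 / 2)) * indicator \<Gamma> r" for r
  have [measurable]: "h \<in> borel_measurable borel" unfolding h_def by measurable
  have g: "emeasure (gauss k) {x \<in> space (gauss k). P x} = (\<integral>\<^sup>+x. ennreal ((1 / sqrt (2 * pi)) ^ Suc k * exp (- (norm_on k x)\<^sup>2 / 2)) * indicator {x. P x} x \<partial>?L)"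
    if "{x \<in> space (gauss k). P x} \<in> sets (gauss k)" for P
  proof -
    have "{x \<in> space (gauss k). P x} \<in> sets ?L" using that sets_gauss sets_lebesgue_on_coords by simp
    then have "emeasure (gauss k) {x \<in> space (gauss k). P x} = (\<integral>\<^sup>+x. ennreal ((1 / sqrt (2 * pi)) ^ Suc k * exp (- (norm_on k x)\<^sup>2 / 2)) * indicator {x \<in> space (gauss k). P x} x \<partial>?L)"
      by (subst gauss_eq_density, subst emeasure_density) auto
    also have "\<dots> = (\<integral>\<^sup>+x. ennreal ((1 / sqrt (2 * pi)) ^ Suc k * exp (- (norm_on k x)\<^sup>2 / 2)) * indicator {x. P x} x \<partial>?L)"
      by (intro nn_integral_cong) (auto simp: indicator_def space_gauss space_PiM)
    finally show ?thesis .
  qed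
  have nm: "normalize_on k \<in> measurable (gauss k) (Pi\<^sub>M {..k} (\<lambda>_. borel))"
    using measurable_normalize_on[of k] by (simp add: measurable_cong_sets[OF sets_gauss refl] measurable_cong_sets[OF sets_lebesgue_on_coords refl])
  note [measurable] = nm
  have m1: "{x \<in> space (gauss k). normalize_on k x \<in> A \<and> norm_on k x \<in> \<Gamma>} \<in> sets (gauss k)"
    by measurable
  have m2: "{x \<in> space (gauss k). norm_on k x \<in> \<Gamma>} \<in> sets (gauss k)"
    by measurable
  have "emeasure (gauss k) {x \<in> space (gauss k). normalize_on k x \<in> A \<and> norm_on k x \<in> \<Gamma>}
    = (\<integral>\<^sup>+x. indicator A (normalize_on k x) * h (norm_on k x) \<partial>?L)"
    unfolding g[OF m1] by (intro nn_integral_cong) (simp add: h_def indicator_def)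
  also have "\<dots> = emeasure (uniform_sphere k) A * (\<integral>\<^sup>+x. h (norm_on k x) \<partial>?L)"
    by (rule radial_integral[OF A]) measurable
  also have "(\<integral>\<^sup>+x. h (norm_on k x) \<partial>?L) = emeasure (gauss k) {x \<in> space (gauss k). norm_on k x \<in> \<Gamma>}"
    unfolding g[OF m2] by (intro nn_integral_cong) (simp add: h_def indicator_def)
  finally show ?thesis .
qed

definition basis_vector :: "nat \<Rightarrow> nat \<Rightarrow> real" where
  "basis_vector k = (\<lambda>i\<in>{..k}. if i = k then 1 else 0)"

text \<open>Unlike \<open>normalize_on\<close> this lands on the sphere for every argument, the
  origin included, and so is a map into \<open>uniform_sphere\<close>.\<close>

definition sphere_proj :: "nat \<Rightarrow> (nat \<Rightarrow> real) \<Rightarrow> nat \<Rightarrow> real" where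
  "sphere_proj k x = (if norm_on k x = 0 then basis_vector k else normalize_on k x)"

lemma inner_on_basis_vector: "inner_on k x (basis_vector k) = x k"
proof -
  have "inner_on k x (basis_vector k) = (\<Sum>i\<le>k. if i = k then x k else 0)"
    unfolding inner_on_def basis_vector_def by (intro sum.cong) auto
  then show ?thesis by simp
qed

lemma basis_vector_in_unit_sphere: "basis_vector k \<in> unit_sphere k"
  using inner_on_basis_vector[of k "basis_vector k"]
  by (auto simp: unit_sphere_def norm_on_def) (auto simp: basis_vector_def split: if_splits)

lemma sphere_proj_in_unit_sphere: "sphere_proj k x \<in> unit_sphere k"
proof (cases "norm_on k x = 0")
  case False
  have "normalize_on k x \<in> {..k} \<rightarrow>\<^sub>E UNIV" by (simp add: normalize_on_def)
  then show ?thesis using False by (simp add: sphere_proj_def unit_sphere_def norm_on_normalize_on)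
qed (simp add: sphere_proj_def basis_vector_in_unit_sphere)

lemma measurable_normalize_on_gauss [measurable]:
  "normalize_on k \<in> measurable (gauss k) (Pi\<^sub>M {..k} (\<lambda>_. borel))"
  using measurable_normalize_on[of k]
  by (simp add: measurable_cong_sets[OF sets_gauss refl] measurable_cong_sets[OF sets_lebesgue_on_coords refl])

lemma measurable_norm_on_gauss [measurable]: "norm_on k \<in> borel_measurable (gauss k)"
  by measurable

lemma measurable_sphere_proj: "sphere_proj k \<in> measurable (gauss k) (uniform_sphere k)"
proof -
  have "basis_vector k \<in> space (Pi\<^sub>M {..k} (\<lambda>_. borel))" by (simp add: basis_vector_def space_PiM)
  then have "sphere_proj k \<in> measurable (gauss k) (Pi\<^sub>M {..k} (\<lambda>_. borel))"
    unfolding sphere_proj_def[abs_def] by (intro measurable_If measurable_normalize_on_gauss) auto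
  then show ?thesis
    unfolding measurable_cong_sets[OF refl sets_uniform_sphere]
    by (intro measurable_restrict_space2) (auto simp: sphere_proj_in_unit_sphere)
qed

definition norm_shell :: "nat \<Rightarrow> real set \<Rightarrow> (nat \<Rightarrow> real) set" where
  "norm_shell k \<Gamma> = {x \<in> space (gauss k). norm_on k x \<in> \<Gamma>}"

lemma sets_norm_shell [measurable]: "\<Gamma> \<in> sets borel \<Longrightarrow> norm_shell k \<Gamma> \<in> sets (gauss k)"
  using measurable_sets[OF measurable_norm_on_gauss, of \<Gamma> k]
  by (simp add: norm_shell_def vimage_def Int_def conj_commute)

text \<open>By independence, conditioning on the norm leaves the direction uniform. The assumption
  \<open>0 \<notin> \<Gamma>\<close> keeps out the default value of
  \<open>sphere_proj\<close>.\<close>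

lemma uniform_sphere_eq_distr:
  assumes \<Gamma>: "\<Gamma> \<in> sets borel" "0 \<notin> \<Gamma>" and pos: "emeasure (gauss k) (norm_shell k \<Gamma>) \<noteq> 0"
  shows "distr (uniform_measure (gauss k) (norm_shell k \<Gamma>)) (uniform_sphere k) (sphere_proj k) = uniform_sphere k"
proof (rule measure_eqI)
  let ?G = "uniform_measure (gauss k) (norm_shell k \<Gamma>)"
  interpret prob_space "gauss k" by (rule prob_space_gauss)
  fix A assume "A \<in> sets (distr ?G (uniform_sphere k) (sphere_proj k))"
  then have A: "A \<in> sets (uniform_sphere k)" by simp
  have pm: "sphere_proj k \<in> measurable ?G (uniform_sphere k)"
    using measurable_sphere_proj by simp
  have "emeasure (distr ?G (uniform_sphere k) (sphere_proj k)) A = emeasure ?G (sphere_proj k -` A \<inter> space (gauss k))"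
    using emeasure_distr[OF pm A] by simp
  also have "\<dots> = emeasure (gauss k) (norm_shell k \<Gamma> \<inter> (sphere_proj k -` A \<inter> space (gauss k))) / emeasure (gauss k) (norm_shell k \<Gamma>)"
    using \<Gamma> measurable_sets[OF measurable_sphere_proj A] by (intro emeasure_uniform_measure) auto
  also have "norm_shell k \<Gamma> \<inter> (sphere_proj k -` A \<inter> space (gauss k))
     = {x \<in> space (gauss k). normalize_on k x \<in> A \<and> norm_on k x \<in> \<Gamma>}"
    using \<Gamma> by (auto simp: norm_shell_def sphere_proj_def split: if_splits)
  also have "emeasure (gauss k) \<dots> = emeasure (uniform_sphere k) A * emeasure (gauss k) (norm_shell k \<Gamma>)"
    unfolding norm_shell_def by (rule gauss_norm_direction_indep[OF A \<Gamma>(1)])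
  also have "\<dots> / emeasure (gauss k) (norm_shell k \<Gamma>) = emeasure (uniform_sphere k) A"
    using pos emeasure_finite[of "norm_shell k \<Gamma>"] by (intro mult_divide_eq_ennreal) auto
  finally show "emeasure (distr ?G (uniform_sphere k) (sphere_proj k)) A = emeasure (uniform_sphere k) A" .
qed simp

text \<open>On boxes both sides are the same quotient of products, so conditioning all points at
  once is conditioning each of them.\<close>

lemma PiM_uniform_measure:
  assumes M: "prob_space M" and G: "G \<in> sets M" "emeasure M G \<noteq> 0" and I: "finite I"
  shows "Pi\<^sub>M I (\<lambda>_. uniform_measure M G) = uniform_measure (Pi\<^sub>M I (\<lambda>_. M)) (Pi\<^sub>E I (\<lambda>_. G))"
proof -
  interpret M: prob_space M by fact
  interpret U: prob_space "uniform_measure M G"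
    using G by (intro prob_space_uniform_measure) auto
  interpret UP: product_sigma_finite "\<lambda>_. uniform_measure M G" by unfold_locales
  interpret MP: product_sigma_finite "\<lambda>_. M" by unfold_locales
  have g: "emeasure M G = ennreal (M.prob G)" "M.prob G > 0"
    using G by (auto simp: M.emeasure_eq_measure zero_less_measure_iff)
  have "uniform_measure (Pi\<^sub>M I (\<lambda>_. M)) (Pi\<^sub>E I (\<lambda>_. G)) = Pi\<^sub>M I (\<lambda>_. uniform_measure M G)"
  proof (rule UP.PiM_eqI[OF I])
    show "sets (uniform_measure (Pi\<^sub>M I (\<lambda>_. M)) (Pi\<^sub>E I (\<lambda>_. G))) = sets (Pi\<^sub>M I (\<lambda>_. uniform_measure M G))"
      by (simp, intro sets_PiM_cong) auto
    fix A assume "\<And>i. i \<in> I \<Longrightarrow> A i \<in> sets (uniform_measure M G)"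
    then have A: "\<And>i. i \<in> I \<Longrightarrow> A i \<in> sets M" by simp
    have "emeasure (uniform_measure (Pi\<^sub>M I (\<lambda>_. M)) (Pi\<^sub>E I (\<lambda>_. G))) (Pi\<^sub>E I A)
      = emeasure (Pi\<^sub>M I (\<lambda>_. M)) (Pi\<^sub>E I (\<lambda>_. G) \<inter> Pi\<^sub>E I A) / emeasure (Pi\<^sub>M I (\<lambda>_. M)) (Pi\<^sub>E I (\<lambda>_. G))"
      using G A I by (intro emeasure_uniform_measure sets_PiM_I_finite) auto
    also have "\<dots> = (\<Prod>i\<in>I. emeasure M (G \<inter> A i)) / (\<Prod>i\<in>I. emeasure M G)"
      using G A I by (simp add: PiE_Int MP.emeasure_PiM)
    also have "\<dots> = (\<Prod>i\<in>I. ennreal (M.prob (G \<inter> A i))) / (\<Prod>i\<in>I. ennreal (M.prob G))"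
      by (simp add: M.emeasure_eq_measure)
    also have "\<dots> = ennreal ((\<Prod>i\<in>I. M.prob (G \<inter> A i)) / (\<Prod>i\<in>I. M.prob G))"
      using g by (simp only: prod_ennreal measure_nonneg) (intro divide_ennreal prod_nonneg prod_pos, auto)
    also have "\<dots> = (\<Prod>i\<in>I. ennreal (M.prob (G \<inter> A i) / M.prob G))"
      by (simp only: prod_dividef prod_ennreal measure_nonneg divide_nonneg_nonneg)
    also have "\<dots> = (\<Prod>i\<in>I. emeasure (uniform_measure M G) (A i))"
      using g A G by (intro prod.cong) (simp_all add: M.emeasure_eq_measure divide_ennreal)
    finally show "emeasure (uniform_measure (Pi\<^sub>M I (\<lambda>_. M)) (Pi\<^sub>E I (\<lambda>_. G))) (Pi\<^sub>E I A)
      = (\<Prod>i\<in>I. emeasure (uniform_measure M G) (A i))" .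
  qed
  then show ?thesis by simp
qed

lemma inverse_antimono_ennreal: "a \<le> b \<Longrightarrow> inverse b \<le> inverse (a :: ennreal)"
  by (simp add: less_eq_ennreal.rep_eq inverse_ennreal.rep_eq ereal_inverse_antimono enn2ereal_nonneg)

text \<open>The colouring only depends on the directions of the points, so conditioning Gaussian points on
  an event for their norms does not change it.\<close>

lemma sphere_points_emeasure_le:
  assumes \<Gamma>: "\<Gamma> \<in> sets borel" "0 \<notin> \<Gamma>" and half: "emeasure (gauss k) (norm_shell k \<Gamma>) \<ge> ennreal (1/2)"
    and E: "E \<in> sets (sphere_points k n)" and F: "F \<in> sets (gauss_points k n)"
    and sub: "\<And>x. x \<in> space (gauss_points k n) \<Longrightarrow> (\<And>i. i < n \<Longrightarrow> norm_on k (x i) \<in> \<Gamma>) \<Longrightarrow>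
       (\<lambda>i\<in>{..<n}. sphere_proj k (x i)) \<in> E \<Longrightarrow> x \<in> F"
  shows "emeasure (sphere_points k n) E \<le> ennreal (2 ^ n) * emeasure (gauss_points k n) F"
proof -
  let ?S = "norm_shell k \<Gamma>"
  let ?G = "uniform_measure (gauss k) ?S"
  let ?T = "compose {..<n} (sphere_proj k)"
  interpret g: prob_space "gauss k" by (rule prob_space_gauss)
  interpret gp: product_sigma_finite "\<lambda>_::nat. gauss k" by (rule product_sigma_finite_gauss)
  have pos: "emeasure (gauss k) ?S \<noteq> 0" using half by (auto simp: ennreal_eq_0_iff)
  have GS: "prob_space ?G" using pos by (intro prob_space_uniform_measure) auto
  have meas: "sphere_proj k \<in> measurable ?G (uniform_sphere k)" using measurable_sphere_proj by simp
  have sp: "sphere_points k n = distr (Pi\<^sub>M {..<n} (\<lambda>_. ?G)) (Pi\<^sub>M {..<n} (\<lambda>_. uniform_sphere k)) ?T"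
    unfolding sphere_points_def
    by (subst distr_PiM_finite_prob_space')
       (auto intro!: GS prob_space_uniform_sphere meas simp: uniform_sphere_eq_distr[OF \<Gamma> pos])
  have T: "?T \<in> measurable (Pi\<^sub>M {..<n} (\<lambda>_. ?G)) (Pi\<^sub>M {..<n} (\<lambda>_. uniform_sphere k))"
    unfolding compose_def
    by (rule measurable_restrict, rule measurable_compose[OF _ meas], rule measurable_component_singleton)
  have E': "E \<in> sets (Pi\<^sub>M {..<n} (\<lambda>_. uniform_sphere k))" using E by (simp add: sphere_points_def)
  define H where "H = ?T -` E \<inter> space (Pi\<^sub>M {..<n} (\<lambda>_. ?G))"
  have H: "H \<in> sets (gauss_points k n)"
    using measurable_sets[OF T E'] unfolding H_def gauss_points_def
    by (subst sets_PiM_cong[of _ _ _ "\<lambda>_. ?G"]) auto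
  have S: "Pi\<^sub>E {..<n} (\<lambda>_. ?S) \<in> sets (gauss_points k n)"
    unfolding gauss_points_def using \<Gamma> by (intro sets_PiM_I_finite) auto
  have "emeasure (sphere_points k n) E = emeasure (Pi\<^sub>M {..<n} (\<lambda>_. ?G)) H"
    unfolding sp H_def by (rule emeasure_distr[OF T E'])
  also have "\<dots> = emeasure (uniform_measure (gauss_points k n) (Pi\<^sub>E {..<n} (\<lambda>_. ?S))) H"
    using \<Gamma> pos by (subst PiM_uniform_measure) (auto simp: gauss_points_def prob_space_gauss)
  also have "\<dots> = emeasure (gauss_points k n) (Pi\<^sub>E {..<n} (\<lambda>_. ?S) \<inter> H) / emeasure (gauss_points k n) (Pi\<^sub>E {..<n} (\<lambda>_. ?S))"
    by (rule emeasure_uniform_measure[OF S H])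
  also have "emeasure (gauss_points k n) (Pi\<^sub>E {..<n} (\<lambda>_. ?S)) = emeasure (gauss k) ?S ^ n"
    unfolding gauss_points_def using \<Gamma> by (subst gp.emeasure_PiM) auto
  \<comment> \<open>Every point satisfies the condition on its norm with probability at least 1/2;
    dividing by these probabilities is the whole price of passing to Gaussian points.\<close>
  also have "emeasure (gauss_points k n) (Pi\<^sub>E {..<n} (\<lambda>_. ?S) \<inter> H) / emeasure (gauss k) ?S ^ n
     \<le> emeasure (gauss_points k n) F / ennreal (1/2) ^ n"
    unfolding divide_ennreal_def
  proof (intro mult_mono inverse_antimono_ennreal)
    show "emeasure (gauss_points k n) (Pi\<^sub>E {..<n} (\<lambda>_. ?S) \<inter> H) \<le> emeasure (gauss_points k n) F"
    proof (rule emeasure_mono[OF _ F])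
      show "Pi\<^sub>E {..<n} (\<lambda>_. ?S) \<inter> H \<subseteq> F"
      proof
        fix x assume x: "x \<in> Pi\<^sub>E {..<n} (\<lambda>_. ?S) \<inter> H"
        then have "x \<in> space (gauss_points k n)" "(\<lambda>i\<in>{..<n}. sphere_proj k (x i)) \<in> E"
          by (auto simp: H_def compose_def gauss_points_def space_PiM)
        moreover have "norm_on k (x i) \<in> \<Gamma>" if "i < n" for i
          using x that by (auto simp: norm_shell_def PiE_iff)
        ultimately show "x \<in> F" using sub by blast
      qed
    qed
    show "ennreal (1/2) ^ n \<le> emeasure (gauss k) ?S ^ n" using half by (intro power_mono) auto
  qed auto
  also have "\<dots> = ennreal (2 ^ n) * emeasure (gauss_points k n) F"
  proof -
    have "ennreal (1/2) ^ n = ennreal ((1/2) ^ n)" by (rule ennreal_power) simp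
    then show ?thesis
      by (simp add: divide_ennreal_def inverse_ennreal power_one_over mult.commute)
  qed
  finally show ?thesis .
qed

definition typical_norms :: "nat \<Rightarrow> real \<Rightarrow> real set" where
  "typical_norms k \<delta> = {r. 0 < r \<and> \<bar>r\<^sup>2 / real k - 1\<bar> < \<delta>}"

lemma sets_typical_norms [measurable]: "typical_norms k \<delta> \<in> sets borel"
  unfolding typical_norms_def by measurable

text \<open>Markov's inequality for the exponential moment with parameter \<open>sqrt k\<close>, the
  order up to which it stays bounded. The two errors in
  \<open>gauss_nn_integral_exp_norm_deviation\<close> are then at most 1 and 8, whence
  \<open>exp 9\<close>; \<open>k \<ge> 16\<close> supplies its hypothesis
  \<open>4 * c \<le> \<kappa>\<^sup>2\<close>.\<close>

lemma gauss_typical_norms: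
  assumes k: "k \<ge> 16" and \<delta>: "0 < \<delta>" "\<delta> < 1"
  shows "measure (gauss k) (norm_shell k (typical_norms k \<delta>)) \<ge> 1 - 2 * exp 9 * exp (- sqrt k * \<delta>)"
proof -
  interpret g: prob_space "gauss k" by (rule prob_space_gauss)
  define c where "c = sqrt (real k)"
  have c2: "c\<^sup>2 = real k" by (simp add: c_def)
  have c4: "c \<ge> 4" using k real_le_rsqrt[of 4 "real k"] by (simp add: c_def)
  define A where "A = {x \<in> space (gauss k). \<delta> \<le> \<bar>inner_on k x x / c\<^sup>2 - 1\<bar>}"
  have A[measurable]: "A \<in> sets (gauss k)" unfolding A_def by measurable
  have "emeasure (gauss k) A = (\<integral>\<^sup>+x. indicator A x \<partial>gauss k)" by simp
  also have "\<dots> \<le> (\<integral>\<^sup>+x. ennreal (exp (- c * \<delta>)) * ennreal (exp (c * \<bar>inner_on k x x / c\<^sup>2 - 1\<bar>)) \<partial>gauss k)"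
  proof (rule nn_integral_mono)
    fix x
    show "indicator A x \<le> ennreal (exp (- c * \<delta>)) * ennreal (exp (c * \<bar>inner_on k x x / c\<^sup>2 - 1\<bar>))"
    proof (cases "x \<in> A")
      case True
      then have "c * \<delta> \<le> c * \<bar>inner_on k x x / c\<^sup>2 - 1\<bar>" using c4 by (intro mult_left_mono) (auto simp: A_def)
      then show ?thesis using True by (simp flip: ennreal_mult exp_add)
    qed simp
  qed
  also have "\<dots> = ennreal (exp (- c * \<delta>)) * (\<integral>\<^sup>+x. ennreal (exp (c * \<bar>inner_on k x x / c\<^sup>2 - 1\<bar>)) \<partial>gauss k)"
    by (rule nn_integral_cmult) measurable
  also have "\<dots> \<le> ennreal (exp (- c * \<delta>)) * ennreal (2 * exp 9)"
  proof (rule mult_left_mono)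
    have "4 * c \<le> c * c" using c4 by (intro mult_right_mono) auto
    then have "(\<integral>\<^sup>+x. ennreal (exp (c * \<bar>inner_on k x x / c\<^sup>2 - 1\<bar>)) \<partial>gauss k)
      \<le> ennreal (2 * exp (c * \<bar>real (Suc k) - c\<^sup>2\<bar> / c\<^sup>2 + 4 * real (Suc k) * (c / c\<^sup>2)\<^sup>2))"
      using c4 by (intro gauss_nn_integral_exp_norm_deviation) (auto simp: power2_eq_square)
    also have "\<dots> \<le> ennreal (2 * exp 9)"
    proof -
      have "\<bar>real (Suc k) - c\<^sup>2\<bar> = 1" using c2 by simp
      then have "c * \<bar>real (Suc k) - c\<^sup>2\<bar> / c\<^sup>2 = 1 / c" using c4 by (simp add: power2_eq_square)
      then have "c * \<bar>real (Suc k) - c\<^sup>2\<bar> / c\<^sup>2 \<le> 1" using c4 by simp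
      moreover have "4 * real (Suc k) * (c / c\<^sup>2)\<^sup>2 \<le> 8"
      proof -
        have "(c / c\<^sup>2)\<^sup>2 = 1 / c\<^sup>2" using c4 by (simp add: power2_eq_square)
        then have "4 * real (Suc k) * (c / c\<^sup>2)\<^sup>2 = 4 * real (Suc k) / real k" unfolding c2 by simp
        also have "\<dots> \<le> 8" using k by (simp add: divide_le_eq)
        finally show ?thesis .
      qed
      ultimately show ?thesis by (intro ennreal_leI) simp
    qed
    finally show "(\<integral>\<^sup>+x. ennreal (exp (c * \<bar>inner_on k x x / c\<^sup>2 - 1\<bar>)) \<partial>gauss k) \<le> ennreal (2 * exp 9)" .
  qed simp
  also have "\<dots> = ennreal (exp (- c * \<delta>) * (2 * exp 9))"
    by (rule ennreal_mult[symmetric]) auto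
  also have "exp (- c * \<delta>) * (2 * exp 9) = 2 * exp 9 * exp (- sqrt k * \<delta>)"
    by (simp only: c_def mult.commute)
  finally have "g.prob A \<le> 2 * exp 9 * exp (- sqrt k * \<delta>)"
    by (simp add: g.emeasure_eq_measure)
  moreover have "g.prob (space (gauss k) - A) = 1 - g.prob A" by (rule g.prob_compl[OF A])
  moreover have "g.prob (space (gauss k) - A) \<le> g.prob (norm_shell k (typical_norms k \<delta>))"
  proof (rule g.finite_measure_mono)
    show "space (gauss k) - A \<subseteq> norm_shell k (typical_norms k \<delta>)"
    proof
      fix x assume x: "x \<in> space (gauss k) - A"
      have "norm_on k x \<noteq> 0"
      proof
        assume "norm_on k x = 0"
        then have "inner_on k x x = 0" by (simp flip: norm_on_square)
        then show False using x \<delta> by (simp add: A_def)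
      qed
      then have "norm_on k x > 0" using norm_on_nonneg[of k x] by simp
      then show "x \<in> norm_shell k (typical_norms k \<delta>)"
        using x by (auto simp: A_def norm_shell_def typical_norms_def norm_on_square c2)
    qed
  qed measurable
  ultimately show ?thesis by linarith
qed

section \<open>Spherical caps\<close>

text \<open>The measure of a cap around the last axis, expressed by a Gaussian vector; multiplying
  by the norm avoids division at the origin, which has no direction.\<close>

definition cap_prob :: "nat \<Rightarrow> real \<Rightarrow> real" where
  "cap_prob k s = measure (gauss k) {x \<in> space (gauss k). 0 < norm_on k x \<and> x k \<le> s * norm_on k x}"

lemma measurable_coord_gauss [measurable]: "i \<le> k \<Longrightarrow> (\<lambda>x. x i) \<in> borel_measurable (gauss k)"
  unfolding measurable_cong_sets[OF sets_gauss refl] by (intro measurable_component_singleton) auto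

lemma sets_gauss_norm_pos_le:
  assumes "f \<in> borel_measurable (gauss k)" "g \<in> borel_measurable (gauss k)"
  shows "{x \<in> space (gauss k). 0 < norm_on k x \<and> f x \<le> (g x :: real)} \<in> sets (gauss k)"
  by (intro sets.sets_Collect_conj borel_measurable_less borel_measurable_le assms) auto

lemma gauss_norm_pos: "AE x in gauss k. 0 < norm_on k x"
proof -
  have "emeasure (gauss k) (PiE {..k} (\<lambda>_. {0})) = (\<Prod>i\<le>k. emeasure std_normal {0})"
    unfolding gauss_def by (rule std.emeasure_PiM) auto
  also have "emeasure std_normal {0} = 0"
  proof -
    have "emeasure std_normal {0} = (\<integral>\<^sup>+x. ennreal (std_normal_density x) * indicator {0} x \<partial>lborel)"
      by (rule emeasure_density) auto
    also have "\<dots> = (\<integral>\<^sup>+x. 0 \<partial>(lborel :: real measure))"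
      by (rule nn_integral_cong_AE) (use AE_lborel_singleton[of "0::real"] in eventually_elim, auto)
    finally show ?thesis by simp
  qed
  finally have "emeasure (gauss k) (PiE {..k} (\<lambda>_. {0})) = 0" by simp
  moreover have "{x \<in> space (gauss k). \<not> 0 < norm_on k x} \<subseteq> PiE {..k} (\<lambda>_. {0})"
  proof
    fix x assume x: "x \<in> {x \<in> space (gauss k). \<not> 0 < norm_on k x}"
    then have "norm_on k x = 0" using norm_on_nonneg[of k x] by auto
    moreover have "x \<in> {..k} \<rightarrow>\<^sub>E UNIV" using x by (simp add: space_gauss)
    ultimately show "x \<in> PiE {..k} (\<lambda>_. {0})" using norm_on_eq_0_iff by blast
  qed
  moreover have "PiE {..k} (\<lambda>_. {0}) \<in> sets (gauss k)"
    unfolding gauss_def by (intro sets_PiM_I_finite) auto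
  ultimately show ?thesis by (intro AE_I)
qed

text \<open>The direction of a Gaussian vector is uniform, and a rotation taking \<open>e\<close> to
  the last axis removes the dependence on \<open>e\<close>.\<close>

lemma measure_cap:
  assumes k: "k > 0" and e: "e \<in> unit_sphere k"
  shows "measure (uniform_sphere k) {x \<in> space (uniform_sphere k). inner_on k x e \<le> s} = cap_prob k s"
proof -
  interpret g: prob_space "gauss k" by (rule prob_space_gauss)
  define A where "A = {x \<in> space (uniform_sphere k). inner_on k x e \<le> s}"
  have A: "A \<in> sets (uniform_sphere k)"
  proof -
    have [measurable]: "e \<in> space (Pi\<^sub>M {..k} (\<lambda>_. borel))" using e by (auto simp: unit_sphere_def space_PiM)
    have "(\<lambda>x. x) \<in> measurable (uniform_sphere k) (Pi\<^sub>M {..k} (\<lambda>_. borel))"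
      by (subst measurable_cong_sets[OF sets_uniform_sphere refl]) (simp add: measurable_restrict_space1)
    note [measurable] = this
    show ?thesis unfolding A_def by measurable
  qed
  have ne: "norm_on k e = 1" using e by (simp add: unit_sphere_def)
  obtain R where R[measurable]: "R \<in> measurable (gauss k) (gauss k)" and dR: "distr (gauss k) (gauss k) R = gauss k"
    and RR: "\<And>x y. inner_on k (R x) (R y) = inner_on k x y" and Re: "\<And>x. inner_on k x e = R x k"
    using gauss_rotation[OF k, of 1 e] ne by auto
  define S where "S = {x \<in> space (gauss k). 0 < norm_on k x \<and> x k \<le> s * norm_on k x}"
  have S: "S \<in> sets (gauss k)" unfolding S_def by (intro sets_gauss_norm_pos_le) auto
  have nn: "norm_on k (R x) = norm_on k x" for x by (simp add: norm_on_def RR)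
  have one: "emeasure (gauss k) {x \<in> space (gauss k). norm_on k x \<in> {0<..}} = 1"
    using gauss_norm_pos[of k] by (intro g.emeasure_eq_1_AE) auto
  have "emeasure (uniform_sphere k) A = emeasure (gauss k) {x \<in> space (gauss k). normalize_on k x \<in> A \<and> norm_on k x \<in> {0<..}}"
    using gauss_norm_direction_indep[OF A, of "{0<..}"] one by simp
  also have "{x \<in> space (gauss k). normalize_on k x \<in> A \<and> norm_on k x \<in> {0<..}} = R -` S \<inter> space (gauss k)"
  proof -
    have "normalize_on k x \<in> A \<longleftrightarrow> R x k \<le> s * norm_on k x" if "norm_on k x > 0" for x
    proof -
      have "normalize_on k x \<in> unit_sphere k" using sphere_proj_in_unit_sphere[of k x] that by (simp add: sphere_proj_def)
      moreover have "inner_on k (normalize_on k x) e = inner_on k x e / norm_on k x"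
        by (simp add: inner_on_def normalize_on_def sum_divide_distrib)
      then have "inner_on k (normalize_on k x) e = R x k / norm_on k x" unfolding Re[of x] .
      ultimately show ?thesis using that by (simp add: A_def space_uniform_sphere pos_divide_le_eq)
    qed
    then show ?thesis using measurable_space[OF R] by (auto simp: S_def nn)
  qed
  also have "emeasure (gauss k) \<dots> = emeasure (distr (gauss k) (gauss k) R) S"
    by (rule emeasure_distr[OF R S, symmetric])
  also have "\<dots> = emeasure (gauss k) S" by (simp add: dR)
  finally show ?thesis by (simp add: measure_def cap_prob_def S_def A_def)
qed

lemma emeasure_std_normal_open_pos:
  assumes "open U" "a \<in> U"
  shows "emeasure std_normal U > 0"
proof -
  obtain e where e: "e > 0" "ball a e \<subseteq> U" using assms by (auto simp: open_contains_ball)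
  interpret prob_space std_normal by (rule prob_space_std_normal)
  have "0 < Phi a - Phi (a - e / 2)" using Phi_strict_mono[of "a - e/2" a] e by simp
  also have "\<dots> = prob ({..a} - {..a - e / 2})"
    unfolding Phi_def using e by (intro finite_measure_Diff[symmetric]) auto
  also have "\<dots> \<le> prob U"
    using e assms by (intro finite_measure_mono) (auto simp: dist_real_def subset_eq intro!: borel_open)
  finally show ?thesis by (simp add: emeasure_eq_measure)
qed

text \<open>When the other coordinates are fixed and not all 0, the admissible last coordinates
  contain a nonempty open set, which has positive probability.\<close>

lemma gauss_band_pos:
  assumes k: "k > 0" and t: "t1 < t2" "-1 < t2" "t2 \<le> 0"
  shows "measure (gauss k) {x \<in> space (gauss k). 0 < norm_on k x \<and> t1 * norm_on k x < x k \<and> x k \<le> t2 * norm_on k x} > 0"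
proof -
  obtain j where j: "k = Suc j" using k by (cases k) auto
  interpret g: prob_space "gauss k" by (rule prob_space_gauss)
  interpret gj: prob_space "gauss j" by (rule prob_space_gauss)
  define S where "S = {x \<in> space (gauss k). 0 < norm_on k x \<and> t1 * norm_on k x < x k \<and> x k \<le> t2 * norm_on k x}"
  have S: "S \<in> sets (gauss k)" unfolding S_def
    by (intro sets.sets_Collect_conj borel_measurable_less borel_measurable_le) auto
  \<comment> \<open>The larger of the midpoints of \<open>(t1, t2)\<close> and
    \<open>(-1, t2)\<close> lies in both intervals; a slope above -1 is attained by a finite last
    coordinate.\<close>
  define s where "s = max ((t1 + t2) / 2) ((t2 - 1) / 2)"
  have s: "t1 < s" "s < t2" "-1 < s" using t by (auto simp: s_def less_max_iff_disj)
  have s2: "0 < 1 - s\<^sup>2" using s t by (simp add: abs_square_less_1)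
  define f where "f y = (\<integral>\<^sup>+a. indicator S (y(k := a)) \<partial>std_normal)" for y
  have eqM: "gauss k = Pi\<^sub>M (insert k {..j}) (\<lambda>_. std_normal)"
    unfolding gauss_def j atMost_Suc ..
  have Sm: "indicator S \<in> borel_measurable (Pi\<^sub>M (insert k {..j}) (\<lambda>_. std_normal))"
    using S unfolding eqM[symmetric] by simp
  have pos: "f y > 0" if y: "y \<in> space (gauss j)" "norm_on j y > 0" for y
  proof -
    define r where "r = norm_on j y"
    have r: "r > 0" using y by (simp add: r_def)
    have nrm: "norm_on k (y(k := a)) = sqrt (r\<^sup>2 + a\<^sup>2)" for a
    proof -
      have "inner_on j (y(k := a)) (y(k := a)) = inner_on j y y" by (simp add: inner_on_def j)
      then have "inner_on k (y(k := a)) (y(k := a)) = r\<^sup>2 + a\<^sup>2"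
        by (simp add: j inner_on_Suc r_def norm_on_square) (simp add: power2_eq_square)
      then show ?thesis by (simp add: norm_on_def)
    qed
    define U where "U = {a. t1 * sqrt (r\<^sup>2 + a\<^sup>2) < a} \<inter> {a. a < t2 * sqrt (r\<^sup>2 + a\<^sup>2)}"
    have "open U" unfolding U_def by (intro open_Int open_Collect_less continuous_intros)
    \<comment> \<open>The solution of \<open>a = s * sqrt (r\<^sup>2 + a\<^sup>2)\<close>.\<close>
    define a where "a = r * s / sqrt (1 - s\<^sup>2)"
    have "r\<^sup>2 + a\<^sup>2 = r\<^sup>2 / (1 - s\<^sup>2)"
      using s2 by (simp add: a_def power_divide power_mult_distrib field_simps)
    then have sq: "sqrt (r\<^sup>2 + a\<^sup>2) = r / sqrt (1 - s\<^sup>2)"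
      using r by (simp add: real_sqrt_divide)
    have "a = s * sqrt (r\<^sup>2 + a\<^sup>2)" unfolding sq by (simp add: a_def)
    moreover have "0 < sqrt (r\<^sup>2 + a\<^sup>2)" using r by (simp add: add_pos_nonneg)
    then have "t1 * sqrt (r\<^sup>2 + a\<^sup>2) < s * sqrt (r\<^sup>2 + a\<^sup>2)" "s * sqrt (r\<^sup>2 + a\<^sup>2) < t2 * sqrt (r\<^sup>2 + a\<^sup>2)"
      using s by simp_all
    ultimately have "a \<in> U" unfolding U_def by simp
    have "0 < emeasure std_normal U" by (rule emeasure_std_normal_open_pos) fact+
    also have "emeasure std_normal U = (\<integral>\<^sup>+a. indicator U a \<partial>std_normal)" using \<open>open U\<close> by simp
    also have "\<dots> \<le> f y" unfolding f_def
    proof (rule nn_integral_mono)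
      fix a
      have "y(k := a) \<in> space (gauss k)" using y by (auto simp: space_gauss j PiE_iff extensional_def)
      moreover have "0 < sqrt (r\<^sup>2 + a\<^sup>2)" using r by (simp add: add_pos_nonneg)
      ultimately show "indicator U a \<le> (indicator S (y(k := a)) :: ennreal)"
        by (auto simp: indicator_def U_def S_def nrm)
    qed
    finally show ?thesis .
  qed
  have "emeasure (gauss k) S \<noteq> 0"
  proof
    assume "emeasure (gauss k) S = 0"
    moreover have "emeasure (gauss k) S = (\<integral>\<^sup>+x. indicator S x \<partial>gauss k)" using S by simp
    moreover have "(\<integral>\<^sup>+x. indicator S x \<partial>gauss k) = (\<integral>\<^sup>+y. f y \<partial>gauss j)"
      unfolding f_def eqM gauss_def[of j] by (rule std.product_nn_integral_insert[OF _ _ Sm]) (auto simp: j)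
    ultimately have 0: "(\<integral>\<^sup>+y. f y \<partial>gauss j) = 0" by simp
    have upd: "(\<lambda>p. (fst p)(k := snd p)) \<in> measurable (gauss j \<Otimes>\<^sub>M std_normal) (gauss k)"
      unfolding eqM gauss_def[of j] by (rule measurable_fun_upd[where J = "{..j}"]) auto
    have "case_prod (\<lambda>y a. indicator S (y(k := a)) :: ennreal) \<in> borel_measurable (gauss j \<Otimes>\<^sub>M std_normal)"
      using measurable_compose[OF upd borel_measurable_indicator[OF S]] by (simp add: case_prod_beta')
    then have "f \<in> borel_measurable (gauss j)"
      unfolding f_def by (rule sigma_finite_measure.borel_measurable_nn_integral[OF std.sigma_finite_measures])
    then have "AE y in gauss j. f y = 0" using 0 by (simp add: nn_integral_0_iff_AE)
    then have "AE y in gauss j. False"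
      using gauss_norm_pos[of j] AE_space[of "gauss j"] by eventually_elim (use pos in force)
    then show False using gj.AE_False by simp
  qed
  then show ?thesis by (simp add: S_def g.emeasure_eq_measure zero_less_measure_iff)
qed

text \<open>The band between the two caps has positive probability. Strictness is what makes the
  threshold in \<open>cap_const\<close> unique.\<close>

lemma cap_prob_strict_mono:
  assumes k: "k > 0" and t: "t1 < t2" "-1 < t2" "t2 \<le> 0"
  shows "cap_prob k t1 < cap_prob k t2"
proof -
  interpret g: prob_space "gauss k" by (rule prob_space_gauss)
  let ?S1 = "{x \<in> space (gauss k). 0 < norm_on k x \<and> x k \<le> t1 * norm_on k x}"
  let ?B = "{x \<in> space (gauss k). 0 < norm_on k x \<and> t1 * norm_on k x < x k \<and> x k \<le> t2 * norm_on k x}"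
  have "cap_prob k t1 < g.prob ?S1 + g.prob ?B" using gauss_band_pos[OF assms] by (simp add: cap_prob_def)
  also have "\<dots> = g.prob (?S1 \<union> ?B)"
    by (rule g.finite_measure_Union[symmetric])
       (auto intro!: sets.sets_Collect_conj borel_measurable_less borel_measurable_le)
  also have "\<dots> \<le> cap_prob k t2"
    unfolding cap_prob_def using t
    by (intro g.finite_measure_mono)
       (auto intro: order_trans[OF _ mult_right_mono[of t1 t2]] sets_gauss_norm_pos_le simp: less_imp_le)
  finally show ?thesis .
qed

text \<open>Reflected to the opposite side, the cap keeps its probability and is disjoint from the
  hemisphere, whose probability is strictly larger. Together they have probability at most
  1.\<close>

lemma cap_prob_less_half:
  assumes k: "k > 0" and t: "t < 0"
  shows "cap_prob k t < 1/2"
proof -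
  interpret g: prob_space "gauss k" by (rule prob_space_gauss)
  let ?S = "{x \<in> space (gauss k). 0 < norm_on k x \<and> x k \<le> t * norm_on k x}"
  let ?S' = "{x \<in> space (gauss k). 0 < norm_on k x \<and> - x k \<le> t * norm_on k x}"
  have "g.prob ?S' = g.prob ?S"
  proof -
    obtain R where R[measurable]: "R \<in> measurable (gauss k) (gauss k)" and dR: "distr (gauss k) (gauss k) R = gauss k"
      and RR: "\<And>x y. inner_on k (R x) (R y) = inner_on k x y"
      and Re: "\<And>x. inner_on k x (basis_vector k) = (-1) * norm_on k (basis_vector k) * R x k"
      using gauss_rotation[OF k, of "-1" "basis_vector k"] by auto
    have Rk: "R x k = - x k" for x
      using Re[of x] basis_vector_in_unit_sphere[of k] by (simp add: inner_on_basis_vector unit_sphere_def)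
    have nn: "norm_on k (R x) = norm_on k x" for x by (simp add: norm_on_def RR)
    have "g.prob ?S = measure (distr (gauss k) (gauss k) R) ?S" by (simp add: dR)
    also have "\<dots> = g.prob (R -` ?S \<inter> space (gauss k))" by (rule measure_distr[OF R], rule sets_gauss_norm_pos_le) auto
    also have "R -` ?S \<inter> space (gauss k) = ?S'" using measurable_space[OF R] by (auto simp: Rk nn)
    finally show ?thesis by simp
  qed
  moreover have "cap_prob k t < cap_prob k 0"
    by (rule cap_prob_strict_mono) (use assms in auto)
  moreover have "cap_prob k 0 + g.prob ?S' \<le> 1"
  proof -
    have "cap_prob k 0 + g.prob ?S' = g.prob ({x \<in> space (gauss k). 0 < norm_on k x \<and> x k \<le> 0 * norm_on k x} \<union> ?S')"
      unfolding cap_prob_def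
    proof (rule g.finite_measure_Union[symmetric])
      show "{x \<in> space (gauss k). 0 < norm_on k x \<and> x k \<le> 0 * norm_on k x} \<inter> ?S' = {}"
      proof (rule ccontr)
        assume "\<not> ?thesis"
        then obtain x where "0 < norm_on k x" "x k \<le> 0" "- x k \<le> t * norm_on k x" by auto
        moreover have "t * norm_on k x < 0" using t \<open>0 < norm_on k x\<close> by (rule mult_neg_pos)
        ultimately show False by linarith
      qed
    qed (auto intro!: sets_gauss_norm_pos_le)
    then show ?thesis using g.prob_le_1 by simp
  qed
  ultimately show ?thesis by (simp add: cap_prob_def)
qed

text \<open>Allows the threshold to be chosen first and \<open>p\<close> to be read off from it. By
  \<open>c < sqrt k\<close> the threshold stays above -1, where strict monotonicity applies.\<close>

lemma cap_const_cap_prob: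
  assumes k: "k > 0" and c: "0 < c" "c < sqrt k"
  shows "cap_const k (cap_prob k (- c / sqrt k)) = c"
  unfolding cap_const_def
proof (rule the_equality)
  show "c \<ge> 0 \<and> (\<forall>e\<in>unit_sphere k. measure (uniform_sphere k)
      {x \<in> space (uniform_sphere k). inner_on k x e \<le> - c / sqrt k} = cap_prob k (- c / sqrt k))"
    using c by (simp add: measure_cap[OF k])
  fix c' assume "c' \<ge> 0 \<and> (\<forall>e\<in>unit_sphere k. measure (uniform_sphere k)
      {x \<in> space (uniform_sphere k). inner_on k x e \<le> - c' / sqrt k} = cap_prob k (- c / sqrt k))"
  then have c': "c' \<ge> 0" "cap_prob k (- c' / sqrt k) = cap_prob k (- c / sqrt k)"
    using measure_cap[OF k basis_vector_in_unit_sphere] basis_vector_in_unit_sphere[of k] by force+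
  have lt: "- a / sqrt k < - b / sqrt k" if "b < a" for a b using that k by (simp add: divide_strict_right_mono)
  have "- 1 < - b / sqrt k" if "b < sqrt k" for b using that k by (simp add: field_simps)
  then show "c' = c"
    using cap_prob_strict_mono[OF k lt[of c c']] cap_prob_strict_mono[OF k lt[of c' c]] c c'
    by (cases c c' rule: linorder_cases) force+
qed

text \<open>For typical norms, which are at most \<open>(1 + \<delta>) * sqrt k\<close>, the
  half-space at \<open>- c * (1 + \<delta>)\<close> lies in the cone over the cap. This bound later
  puts \<open>p\<close> above \<open>p_crit\<close>.\<close>

lemma cap_prob_ge:
  assumes k: "k \<ge> 16" and c: "c > 0" and \<delta>: "0 < \<delta>" "\<delta> < 1"
  shows "cap_prob k (- c / sqrt k) \<ge> Phi (- c * (1 + \<delta>)) - 2 * exp 9 * exp (- sqrt k * \<delta>)"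
proof -
  interpret g: prob_space "gauss k" by (rule prob_space_gauss)
  let ?N = "norm_shell k (typical_norms k \<delta>)"
  let ?H = "{x \<in> space (gauss k). x k \<le> - c * (1 + \<delta>)}"
  have H: "g.prob ?H = Phi (- c * (1 + \<delta>))"
  proof -
    have "distr (gauss k) std_normal (\<lambda>x. x k) = std_normal"
      unfolding gauss_def by (rule distr_PiM_component) (auto intro: prob_space_std_normal)
    then have "Phi (- c * (1 + \<delta>)) = measure (distr (gauss k) std_normal (\<lambda>x. x k)) {..- c * (1 + \<delta>)}"
      by (simp add: Phi_def)
    also have "\<dots> = g.prob ((\<lambda>x. x k) -` {..- c * (1 + \<delta>)} \<inter> space (gauss k))"
    proof (rule measure_distr)
      show "(\<lambda>x. x k) \<in> measurable (gauss k) std_normal"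
        unfolding gauss_def by (rule measurable_component_singleton) simp
    qed simp
    also have "(\<lambda>x. x k) -` {..- c * (1 + \<delta>)} \<inter> space (gauss k) = ?H" by auto
    finally show ?thesis by simp
  qed
  have "g.prob ?H \<le> g.prob ((?H \<inter> ?N) \<union> (space (gauss k) - ?N))"
    by (intro g.finite_measure_mono) auto
  also have "\<dots> \<le> g.prob (?H \<inter> ?N) + g.prob (space (gauss k) - ?N)"
    by (intro measure_Un_le) (auto intro!: sets.Int borel_measurable_le)
  also have "g.prob (space (gauss k) - ?N) = 1 - g.prob ?N" by (intro g.prob_compl) auto
  also have "g.prob (?H \<inter> ?N) \<le> cap_prob k (- c / sqrt k)"
    unfolding cap_prob_def
  proof (rule g.finite_measure_mono)
    show "?H \<inter> ?N \<subseteq> {x \<in> space (gauss k). 0 < norm_on k x \<and> x k \<le> - c / sqrt k * norm_on k x}"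
    proof
      fix x assume x: "x \<in> ?H \<inter> ?N"
      then have r: "0 < norm_on k x" "(norm_on k x)\<^sup>2 / real k < 1 + \<delta>"
        by (auto simp: norm_shell_def typical_norms_def)
      have "(norm_on k x / sqrt k)\<^sup>2 \<le> (1 + \<delta>) * 1" using r by (simp add: power_divide)
      also have "\<dots> \<le> (1 + \<delta>)\<^sup>2" using \<delta> unfolding power2_eq_square by (intro mult_left_mono) auto
      finally have "norm_on k x / sqrt k \<le> 1 + \<delta>" by (rule power2_le_imp_le) (use \<delta> in simp)
      then have "c * (norm_on k x / sqrt k) \<le> c * (1 + \<delta>)" using c by (intro mult_left_mono) auto
      then show "x \<in> {x \<in> space (gauss k). 0 < norm_on k x \<and> x k \<le> - c / sqrt k * norm_on k x}"
        using x r by auto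
    qed
  qed (auto intro!: sets_gauss_norm_pos_le)
  finally show ?thesis using H gauss_typical_norms[OF k \<delta>] by linarith
qed

section \<open>From coloured points on the sphere to Gaussian clique events\<close>

lemma inner_on_sphere_proj:
  assumes "norm_on k x > 0" "norm_on k y > 0"
  shows "inner_on k (sphere_proj k x) (sphere_proj k y) = inner_on k x y / (norm_on k x * norm_on k y)"
proof -
  have "inner_on k (normalize_on k x) (normalize_on k y) = inner_on k x y / (norm_on k x * norm_on k y)"
    unfolding inner_on_def sum_divide_distrib by (intro sum.cong refl) (simp add: normalize_on_def)
  then show ?thesis using assms by (simp only: sphere_proj_def if_False less_imp_neq[symmetric])
qed

lemma typical_norms_mult:
  assumes "k > 0" "\<delta> < 1" "r \<in> typical_norms k \<delta>" "r' \<in> typical_norms k \<delta>"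
  shows "(1 - \<delta>) * real k \<le> r * r'" "r * r' \<le> (1 + \<delta>) * real k"
proof -
  have bounds: "0 < r" "(1 - \<delta>) * real k \<le> r\<^sup>2" "r\<^sup>2 \<le> (1 + \<delta>) * real k" if "r \<in> typical_norms k \<delta>" for r
  proof -
    have r: "0 < r" and d: "\<bar>r\<^sup>2 / real k - 1\<bar> < \<delta>" using that by (auto simp: typical_norms_def)
    have "1 - \<delta> \<le> r\<^sup>2 / real k" "r\<^sup>2 / real k \<le> 1 + \<delta>" using abs_less_iff[THEN iffD1, OF d] by linarith+
    then show "(1 - \<delta>) * real k \<le> r\<^sup>2" "r\<^sup>2 \<le> (1 + \<delta>) * real k"
      using assms(1) by (simp_all only: pos_le_divide_eq pos_divide_le_eq of_nat_0_less_iff)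
    show "0 < r" by (rule r)
  qed
  note r = bounds[OF assms(3)] and r' = bounds[OF assms(4)]
  have "((1 - \<delta>) * real k)\<^sup>2 \<le> (r * r')\<^sup>2"
    unfolding power_mult_distrib[of r] power2_eq_square[of "(1 - \<delta>) * real k"]
    using assms(2) by (intro mult_mono r(2) r'(2)) auto
  then show "(1 - \<delta>) * real k \<le> r * r'" 
    by (rule power2_le_imp_le) (use r(1) r'(1) in simp)
  have 0: "0 \<le> (1 + \<delta>) * real k" using r(3) zero_le_power2[of r] by linarith
  have "(r * r')\<^sup>2 \<le> ((1 + \<delta>) * real k)\<^sup>2"
    unfolding power_mult_distrib[of r] power2_eq_square[of "(1 + \<delta>) * real k"]
    by (rule mult_mono[OF r(3) r'(3) 0 zero_le_power2])
  then show "r * r' \<le> (1 + \<delta>) * real k" using 0 by (rule power2_le_imp_le)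
qed

definition clique_prob :: "nat \<Rightarrow> nat \<Rightarrow> real \<Rightarrow> real \<Rightarrow> ennreal" where
  "clique_prob k n \<sigma> t = emeasure (gauss_points k n) (clique_event k n \<sigma> (sqrt k) (\<lambda>_ _. t))"

lemma mono_clique_le_clique_prob:
  assumes half: "measure (gauss k) (norm_shell k (typical_norms k \<delta>)) \<ge> 1/2"
    and edge: "\<And>x y. norm_on k x \<in> typical_norms k \<delta> \<Longrightarrow> norm_on k y \<in> typical_norms k \<delta> \<Longrightarrow>
      edge_colour k p (sphere_proj k x) (sphere_proj k y) = col \<Longrightarrow> \<sigma> * inner_on k x y \<le> sqrt k * t"
  shows "ennreal (measure (sphere_points k n) {x \<in> space (sphere_points k n). mono_clique (sphere_graph k p x) col {..<n}})
    \<le> ennreal (2 ^ n) * clique_prob k n \<sigma> t"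
proof -
  let ?E = "{x \<in> space (sphere_points k n). mono_clique (sphere_graph k p x) col {..<n}}"
  interpret g: prob_space "gauss k" by (rule prob_space_gauss)
  interpret sp: prob_space "sphere_points k n"
    unfolding sphere_points_def by (intro prob_space_PiM prob_space_uniform_sphere)
  have "emeasure (sphere_points k n) ?E \<le> ennreal (2 ^ n) * clique_prob k n \<sigma> t"
    unfolding clique_prob_def
  proof (rule sphere_points_emeasure_le[of "typical_norms k \<delta>"])
    show "0 \<notin> typical_norms k \<delta>" by (simp add: typical_norms_def)
    show "ennreal (1/2) \<le> emeasure (gauss k) (norm_shell k (typical_norms k \<delta>))"
      unfolding g.emeasure_eq_measure by (rule ennreal_leI[OF half])
    fix x assume x: "x \<in> space (gauss_points k n)" and nx: "\<And>i. i < n \<Longrightarrow> norm_on k (x i) \<in> typical_norms k \<delta>"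
      and E: "(\<lambda>i\<in>{..<n}. sphere_proj k (x i)) \<in> ?E"
    have "\<sigma> * inner_on k (x i) (x j) \<le> sqrt k * t" if ij: "i < j" "j < n" for i j
    proof -
      have "edge_colour k p (sphere_proj k (x i)) (sphere_proj k (x j)) = col"
        using E ij by (auto simp: mono_clique_def sphere_graph_def)
      then show ?thesis using ij by (intro edge nx) auto
    qed
    then show "x \<in> clique_event k n \<sigma> (sqrt k) (\<lambda>_ _. t)" using x by (auto simp: clique_event_def)
  qed (auto simp: sets_clique_event sets_mono_clique)
  then show ?thesis by (simp add: sp.emeasure_eq_measure)
qed

text \<open>Undoing the normalisation multiplies the threshold by a product of two norms, which is
  between \<open>(1 - \<delta>) * k\<close> and \<open>(1 + \<delta>) * k\<close>. Each colour takes
  the end that enlarges its event.\<close>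

lemma
  assumes k: "k > 0" and c: "0 < c" "c < sqrt k" and \<delta>: "0 < \<delta>" "\<delta> < 1"
    and half: "measure (gauss k) (norm_shell k (typical_norms k \<delta>)) \<ge> 1/2"
  shows P_red_le: "ennreal (P_red k (cap_prob k (- c / sqrt k)) n) \<le> ennreal (2 ^ n) * clique_prob k n 1 (- c * (1 - \<delta>))"
    and P_blue_le: "ennreal (P_blue k (cap_prob k (- c / sqrt k)) n) \<le> ennreal (2 ^ n) * clique_prob k n (-1) (c * (1 + \<delta>))"
  unfolding P_red_def P_blue_def
proof -
  let ?p = "cap_prob k (- c / sqrt k)"
  have pos: "norm_on k x > 0" if "norm_on k x \<in> typical_norms k \<delta>" for x
    using that by (simp add: typical_norms_def)
  show "ennreal (measure (sphere_points k n) {x \<in> space (sphere_points k n). mono_clique (sphere_graph k ?p x) Red {..<n}})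
    \<le> ennreal (2 ^ n) * clique_prob k n 1 (- c * (1 - \<delta>))"
  proof (rule mono_clique_le_clique_prob[OF half])
    fix x y assume xy: "norm_on k x \<in> typical_norms k \<delta>" "norm_on k y \<in> typical_norms k \<delta>"
    assume "edge_colour k ?p (sphere_proj k x) (sphere_proj k y) = Red"
    then have "inner_on k x y / (norm_on k x * norm_on k y) \<le> - c / sqrt k"
      unfolding edge_colour_def cap_const_cap_prob[OF k c] inner_on_sphere_proj[OF pos[OF xy(1)] pos[OF xy(2)]]
      by (simp split: if_splits)
    then have "inner_on k x y \<le> - c / sqrt k * (norm_on k x * norm_on k y)"
      using pos[OF xy(1)] pos[OF xy(2)] by (simp add: pos_divide_le_eq)
    also have "\<dots> \<le> - c / sqrt k * ((1 - \<delta>) * real k)"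
      using typical_norms_mult(1)[OF k \<delta>(2) xy] c by (intro mult_left_mono_neg) auto
    also have "\<dots> = sqrt k * (- c * (1 - \<delta>))" using k by (simp add: field_simps)
    finally show "1 * inner_on k x y \<le> sqrt k * (- c * (1 - \<delta>))" by simp
  qed
  show "ennreal (measure (sphere_points k n) {x \<in> space (sphere_points k n). mono_clique (sphere_graph k ?p x) Blue {..<n}})
    \<le> ennreal (2 ^ n) * clique_prob k n (-1) (c * (1 + \<delta>))"
  proof (rule mono_clique_le_clique_prob[OF half])
    fix x y assume xy: "norm_on k x \<in> typical_norms k \<delta>" "norm_on k y \<in> typical_norms k \<delta>"
    assume "edge_colour k ?p (sphere_proj k x) (sphere_proj k y) = Blue"
    then have "- c / sqrt k \<le> inner_on k x y / (norm_on k x * norm_on k y)"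
      unfolding edge_colour_def cap_const_cap_prob[OF k c] inner_on_sphere_proj[OF pos[OF xy(1)] pos[OF xy(2)]]
      by (simp split: if_splits)
    then have "- inner_on k x y \<le> c / sqrt k * (norm_on k x * norm_on k y)"
      using pos[OF xy(1)] pos[OF xy(2)] by (simp add: pos_le_divide_eq)
    also have "\<dots> \<le> c / sqrt k * ((1 + \<delta>) * real k)"
      using typical_norms_mult(2)[OF k \<delta>(2) xy] c by (intro mult_left_mono) auto
    also have "\<dots> = sqrt k * (c * (1 + \<delta>))" using k by (simp add: field_simps)
    finally show "(-1) * inner_on k x y \<le> sqrt k * (c * (1 + \<delta>))" by simp
  qed
qed

section \<open>Asymptotics\<close>

lemma real_choose_two: "real (n choose 2) = real n * (real n - 1) / 2"
  by (induction n) (auto simp: numeral_2_eq_2 field_simps)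

lemma sum_lessThan_real: "(\<Sum>m<n. real m) = real (n choose 2)"
  unfolding real_choose_two by (induction n) (auto simp: field_simps)

lemma sum_lessThan_squares: "(\<Sum>m<n. (real m)\<^sup>2) = real (n choose 2) * (2 * real n - 1) / 3"
  unfolding real_choose_two by (induction n) (auto simp: field_simps power2_eq_square)

lemma sum_lessThan_cubes_le: "(\<Sum>m<n. real m ^ 3) \<le> real (n choose 2) * (real n)\<^sup>2 / 2"
proof -
  have "(\<Sum>m<n. real m ^ 3) = (real (n choose 2))\<^sup>2"
    unfolding real_choose_two by (induction n) (auto simp: field_simps power2_eq_square power3_eq_cube)
  also have "\<dots> = real (n choose 2) * (real n * (real n - 1) / 2)"
    by (simp add: real_choose_two power2_eq_square)
  also have "\<dots> \<le> real (n choose 2) * ((real n)\<^sup>2 / 2)"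
    by (intro mult_left_mono) (auto simp: power2_eq_square algebra_simps)
  finally show ?thesis by simp
qed

text \<open>Product of the level factors: the squares of the levels sum to about n / 3 times twice
  the number of edges, and the constants collect in \<open>B ^ n\<close>. Since \<open>B\<close>
  depends on \<open>R\<close> and \<open>t\<close> only, \<open>n\<close> and \<open>k\<close> can
  grow together afterwards.\<close>

lemma gauss_clique_bound:
  assumes R: "R > 0"
  obtains B where "B > 0"
    "\<And>k n \<sigma>. \<sigma> = 1 \<or> \<sigma> = -1 \<Longrightarrow> k \<ge> 1 \<Longrightarrow> n \<le> k \<Longrightarrow> real n \<le> R * sqrt k \<Longrightarrow> 2 * hazard t \<le> sqrt k \<Longrightarrow>
      2 * real n * hazard t \<le> sqrt k \<Longrightarrow> 4 * ((2 * tilt_slope t + (hazard t)\<^sup>2) * real n) \<le> real k \<Longrightarrow>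
      clique_prob k n \<sigma> t
      \<le> ennreal (B ^ n * exp (real (n choose 2) * (ln (Phi t) - \<sigma> * hazard t ^ 3 * ((2 * real n - 1) / (6 * sqrt k))
           + hazard t ^ 4 * ((real n)\<^sup>2 / (2 * real k)))))"
proof -
  define c2 where "c2 = 2 * tilt_slope t + (hazard t)\<^sup>2"
  have c2: "c2 \<ge> 0" using tilt_slope_nonneg[of t] by (simp add: c2_def)
  \<comment> \<open>Read off from \<open>gauss_nn_integral_exp_norm_deviation\<close>: its parameter
    is at most \<open>c2 * R * sqrt k\<close>, and at every stage the dimension differs from
    \<open>k\<close> by at most \<open>(R + 1) * sqrt k\<close>.\<close>
  define B0 where "B0 = 2 * exp (c2 * R * (R + 1) + 8 * (c2 * R)\<^sup>2)"
  define B where "B = B0 * exp (1 + 2 * tilt_slope t)"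
  have B0: "B0 > 0" by (simp add: B0_def)
  have "B > 0" using B0 by (simp add: B_def)
  moreover have "clique_prob k n \<sigma> t
      \<le> ennreal (B ^ n * exp (real (n choose 2) * (ln (Phi t) - \<sigma> * hazard t ^ 3 * ((2 * real n - 1) / (6 * sqrt k))
           + hazard t ^ 4 * ((real n)\<^sup>2 / (2 * real k)))))"
    if \<sigma>: "\<sigma> = 1 \<or> \<sigma> = -1" and k: "k \<ge> 1" "n \<le> k" and nR: "real n \<le> R * sqrt k" and h1: "2 * hazard t \<le> sqrt k"
      and h2: "2 * real n * hazard t \<le> sqrt k" and h3: "4 * (c2 * real n) \<le> real k" for k n \<sigma>
  proof -
    define \<kappa> where "\<kappa> = sqrt (real k)"
    have \<kappa>: "\<kappa> \<ge> 1" "\<kappa>\<^sup>2 = real k" using k by (auto simp: \<kappa>_def)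
    have int: "(\<integral>\<^sup>+v. ennreal (exp (c2 * real m * \<bar>inner_on k' v v / \<kappa>\<^sup>2 - 1\<bar>)) \<partial>gauss k') \<le> ennreal B0"
      if m: "m \<le> n" and k': "k - n \<le> k'" "k' \<le> k" for m k'
    proof -
      define c where "c = c2 * real m"
      have c0: "c \<ge> 0" using c2 by (simp add: c_def)
      have cn: "c \<le> c2 * real n" unfolding c_def using c2 m by (intro mult_left_mono) auto
      also have "\<dots> \<le> c2 * (R * \<kappa>)" unfolding \<kappa>_def using c2 nR by (intro mult_left_mono)
      finally have cR: "c \<le> c2 * R * \<kappa>" by simp
      have "(\<integral>\<^sup>+v. ennreal (exp (c * \<bar>inner_on k' v v / \<kappa>\<^sup>2 - 1\<bar>)) \<partial>gauss k')
        \<le> ennreal (2 * exp (c * \<bar>real (Suc k') - \<kappa>\<^sup>2\<bar> / \<kappa>\<^sup>2 + 4 * real (Suc k') * (c / \<kappa>\<^sup>2)\<^sup>2))"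
        using \<kappa> c0 cn h3 by (intro gauss_nn_integral_exp_norm_deviation) auto
      also have "\<dots> \<le> ennreal B0"
      proof -
        have "\<bar>real (Suc k') - \<kappa>\<^sup>2\<bar> \<le> real n + 1" unfolding \<kappa>(2) using k' k by (auto simp: abs_if)
        also have "\<dots> \<le> R * \<kappa> + \<kappa>" using nR \<kappa>(1) unfolding \<kappa>_def by linarith
        finally have "c * \<bar>real (Suc k') - \<kappa>\<^sup>2\<bar> \<le> (c2 * R * \<kappa>) * ((R + 1) * \<kappa>)"
          using cR c0 c2 R \<kappa> by (intro mult_mono) (auto simp: algebra_simps)
        then have 1: "c * \<bar>real (Suc k') - \<kappa>\<^sup>2\<bar> / \<kappa>\<^sup>2 \<le> c2 * R * (R + 1)"
          using \<kappa>(1) by (simp add: pos_divide_le_eq power2_eq_square mult_ac)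
        have "c\<^sup>2 \<le> (c2 * R * \<kappa>)\<^sup>2" using cR c0 by (intro power_mono)
        then have "c\<^sup>2 / \<kappa>\<^sup>2 \<le> (c2 * R)\<^sup>2" using \<kappa>(1) by (simp add: pos_divide_le_eq power_mult_distrib)
        moreover have "4 * real (Suc k') \<le> 8 * \<kappa>\<^sup>2" unfolding \<kappa>(2) using k' k by simp
        then have "4 * real (Suc k') * (c\<^sup>2 / \<kappa>\<^sup>2) \<le> 8 * \<kappa>\<^sup>2 * (c\<^sup>2 / \<kappa>\<^sup>2)" by (intro mult_right_mono) auto
        then have "4 * real (Suc k') * (c\<^sup>2 / \<kappa>\<^sup>2) / \<kappa>\<^sup>2 \<le> 8 * (c\<^sup>2 / \<kappa>\<^sup>2)"
          using \<kappa>(1) by (subst pos_divide_le_eq) (auto simp: mult_ac)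
        moreover have "4 * real (Suc k') * (c / \<kappa>\<^sup>2)\<^sup>2 = 4 * real (Suc k') * (c\<^sup>2 / \<kappa>\<^sup>2) / \<kappa>\<^sup>2"
          by (simp add: power_divide power2_eq_square)
        ultimately have 2: "4 * real (Suc k') * (c / \<kappa>\<^sup>2)\<^sup>2 \<le> 8 * (c2 * R)\<^sup>2" by linarith
        show ?thesis unfolding B0_def using 1 2 by (intro ennreal_leI mult_left_mono) auto
      qed
      finally show ?thesis by (simp add: c_def)
    qed
    \<comment> \<open>Every vertex brings one dimension, so the induction starts at
      \<open>k - n\<close> to end at \<open>k\<close>.\<close>
    have "emeasure (gauss_points (k - n + n) n) (clique_event (k - n + n) n \<sigma> \<kappa> (\<lambda>_ _. t))
      \<le> ennreal ((\<Prod>m<n. level_factor t \<sigma> \<kappa> B0 m) * exp (\<Sum>j<n. \<Sum>i<j. tilt_log t + hazard t * t))"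
    proof (rule clique_event_emeasure_le[OF \<sigma>, of \<kappa> t n B0 "k - n" n])
      show "(\<integral>\<^sup>+v. ennreal (exp ((2 * tilt_slope t + (hazard t)\<^sup>2) * real m * \<bar>inner_on k' v v / \<kappa>\<^sup>2 - 1\<bar>)) \<partial>gauss k') \<le> ennreal B0"
        if "m \<le> n" "k - n \<le> k'" "k' \<le> k - n + n" for m k'
        using int[of m k'] that k by (simp add: c2_def)
    qed (use \<kappa> h1 h2 B0 in \<open>auto simp: \<kappa>_def\<close>)
    also have "k - n + n = k" using k by simp
    \<comment> \<open>At its point of contact the tangent is exact, so every edge contributes
      \<open>ln (Phi t)\<close>.\<close>
    also have "(\<Sum>j<n. \<Sum>i<j. tilt_log t + hazard t * t) = real (n choose 2) * ln (Phi t)"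
      by (simp add: tilt_log_def flip: sum_distrib_right sum_lessThan_real)
    also have "(\<Prod>m<n. level_factor t \<sigma> \<kappa> B0 m) = B ^ n * exp (\<Sum>m<n. - \<sigma> * hazard t ^ 3 * (real m)\<^sup>2 / (2 * \<kappa>) + hazard t ^ 4 * real m ^ 3 / \<kappa>\<^sup>2)"
      unfolding level_factor_def B_def exp_add[of _ "1 + 2 * tilt_slope t"] exp_sum[OF finite_lessThan]
      by (simp add: prod.distrib power_mult_distrib)
    also have "(\<Sum>m<n. - \<sigma> * hazard t ^ 3 * (real m)\<^sup>2 / (2 * \<kappa>) + hazard t ^ 4 * real m ^ 3 / \<kappa>\<^sup>2)
      = - \<sigma> * hazard t ^ 3 / (2 * \<kappa>) * (\<Sum>m<n. (real m)\<^sup>2) + hazard t ^ 4 / \<kappa>\<^sup>2 * (\<Sum>m<n. real m ^ 3)"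
      by (simp add: sum.distrib sum_distrib_left sum_subtractf sum_negf)
    finally have main: "emeasure (gauss_points k n) (clique_event k n \<sigma> \<kappa> (\<lambda>_ _. t)) \<le>
      ennreal (B ^ n * exp (- \<sigma> * hazard t ^ 3 / (2 * \<kappa>) * (\<Sum>m<n. (real m)\<^sup>2) + hazard t ^ 4 / \<kappa>\<^sup>2 * (\<Sum>m<n. real m ^ 3))
        * exp (real (n choose 2) * ln (Phi t)))" .
    have "hazard t ^ 4 / \<kappa>\<^sup>2 * (\<Sum>m<n. real m ^ 3) \<le> hazard t ^ 4 / \<kappa>\<^sup>2 * (real (n choose 2) * (real n)\<^sup>2 / 2)"
      by (intro mult_left_mono sum_lessThan_cubes_le) auto
    also have "\<dots> = real (n choose 2) * (hazard t ^ 4 * ((real n)\<^sup>2 / (2 * \<kappa>\<^sup>2)))"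
      by (simp only: divide_inverse inverse_mult_distrib mult_ac)
    finally have cub: "hazard t ^ 4 / \<kappa>\<^sup>2 * (\<Sum>m<n. real m ^ 3) \<le> real (n choose 2) * (hazard t ^ 4 * ((real n)\<^sup>2 / (2 * \<kappa>\<^sup>2)))" .
    have sq: "- \<sigma> * hazard t ^ 3 / (2 * \<kappa>) * (\<Sum>m<n. (real m)\<^sup>2) = - (real (n choose 2) * (\<sigma> * hazard t ^ 3 * ((2 * real n - 1) / (6 * \<kappa>))))"
      unfolding sum_lessThan_squares by simp
    have "- \<sigma> * hazard t ^ 3 / (2 * \<kappa>) * (\<Sum>m<n. (real m)\<^sup>2) + hazard t ^ 4 / \<kappa>\<^sup>2 * (\<Sum>m<n. real m ^ 3) + real (n choose 2) * ln (Phi t)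
      \<le> real (n choose 2) * (ln (Phi t) - \<sigma> * hazard t ^ 3 * ((2 * real n - 1) / (6 * \<kappa>)) + hazard t ^ 4 * ((real n)\<^sup>2 / (2 * \<kappa>\<^sup>2)))"
    proof -
      have "- (E * S) + x + E * L \<le> E * (L - S + H)" if "x \<le> E * H" for E S x L H :: real
        using that by (simp add: algebra_simps)
      from this[OF cub] show ?thesis unfolding sq .
    qed
    then have "B ^ n * exp (- \<sigma> * hazard t ^ 3 / (2 * \<kappa>) * (\<Sum>m<n. (real m)\<^sup>2) + hazard t ^ 4 / \<kappa>\<^sup>2 * (\<Sum>m<n. real m ^ 3))
        * exp (real (n choose 2) * ln (Phi t))
      \<le> B ^ n * exp (real (n choose 2) * (ln (Phi t) - \<sigma> * hazard t ^ 3 * ((2 * real n - 1) / (6 * \<kappa>)) + hazard t ^ 4 * ((real n)\<^sup>2 / (2 * \<kappa>\<^sup>2))))"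
      unfolding mult.assoc exp_add[symmetric] using \<open>B > 0\<close> by (intro mult_left_mono) auto
    from order_trans[OF main ennreal_leI[OF this]] show ?thesis unfolding \<kappa>(2) unfolding \<kappa>_def clique_prob_def .
  qed
  ultimately show thesis using that[of B] unfolding c2_def by blast
qed

text \<open>The limit of the exponent per edge in \<open>gauss_clique_bound\<close> as
  \<open>n / sqrt k\<close> tends to \<rho>: independent edges, triangles, and the error of second
  order.\<close>

definition edge_rate :: "real \<Rightarrow> real \<Rightarrow> real \<Rightarrow> real" where
  "edge_rate \<sigma> \<rho> t = ln (Phi t) - \<sigma> * hazard t ^ 3 * (\<rho> / 3) + hazard t ^ 4 * (\<rho>\<^sup>2 / 2)"

text \<open>Spread over \<open>n choose 2\<close> edges, the factor \<open>(2 * B) ^ n\<close> adds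
  \<open>2 * ln (2 * B) / (n - 1)\<close> to the exponent per edge, which tends to 0. Hence a strict
  inequality between the limits decides for all large indices.\<close>

lemma gauss_clique_eventually_le:
  fixes n k :: "nat \<Rightarrow> nat" and z :: "nat \<Rightarrow> real"
  assumes \<sigma>: "\<sigma> = 1 \<or> \<sigma> = -1"
    and n: "filterlim n at_top sequentially" and k: "filterlim k at_top sequentially"
    and \<rho>: "((\<lambda>l. real (n l) / sqrt (real (k l))) \<longlongrightarrow> \<rho>) sequentially" "\<rho> > 0" "2 * \<rho> * hazard t < 1"
    and z: "(z \<longlongrightarrow> z0) sequentially" "z0 > 0"
    and less: "edge_rate \<sigma> \<rho> t < ln z0"
  shows "\<forall>\<^sub>F l in sequentially. ennreal (2 ^ n l) * clique_prob (k l) (n l) \<sigma> t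
    \<le> ennreal (z l ^ (n l choose 2))"
proof -
  define c2 where "c2 = 2 * tilt_slope t + (hazard t)\<^sup>2"
  have c2: "c2 \<ge> 0" using tilt_slope_nonneg[of t] by (simp add: c2_def)
  have "\<rho> + 1 > 0" using \<rho> by simp
  from gauss_clique_bound[OF this, of t] obtain B where B: "B > 0"
    and bound: "\<And>k n \<sigma>. \<sigma> = 1 \<or> \<sigma> = -1 \<Longrightarrow> k \<ge> 1 \<Longrightarrow> n \<le> k \<Longrightarrow> real n \<le> (\<rho> + 1) * sqrt k \<Longrightarrow> 2 * hazard t \<le> sqrt k \<Longrightarrow>
      2 * real n * hazard t \<le> sqrt k \<Longrightarrow> 4 * (c2 * real n) \<le> real k \<Longrightarrow>
      clique_prob k n \<sigma> t
      \<le> ennreal (B ^ n * exp (real (n choose 2) * (ln (Phi t) - \<sigma> * hazard t ^ 3 * ((2 * real n - 1) / (6 * sqrt k))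
           + hazard t ^ 4 * ((real n)\<^sup>2 / (2 * real k)))))"
    unfolding c2_def by blast
  have rn: "filterlim (\<lambda>l. real (n l)) at_top sequentially"
    by (rule filterlim_compose[OF filterlim_real_sequentially n])
  have rk: "filterlim (\<lambda>l. real (k l)) at_top sequentially"
    by (rule filterlim_compose[OF filterlim_real_sequentially k])
  have sk: "filterlim (\<lambda>l. sqrt (real (k l))) at_top sequentially"
    by (rule filterlim_compose[OF sqrt_at_top rk])
  have isk: "((\<lambda>l. inverse (sqrt (real (k l)))) \<longlongrightarrow> 0) sequentially"
    by (rule tendsto_inverse_0_at_top[OF sk])
  define b where "b l = ln (Phi t) - \<sigma> * hazard t ^ 3 * ((2 * real (n l) - 1) / (6 * sqrt (k l)))
           + hazard t ^ 4 * ((real (n l))\<^sup>2 / (2 * real (k l)))" for l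
  define a where "a l = 2 * ln (2 * B) * inverse (real (n l) - 1) + b l" for l
  have in1: "((\<lambda>l. inverse (real (n l) - 1)) \<longlongrightarrow> 0) sequentially"
  proof (rule tendsto_inverse_0_at_top)
    have "filterlim (\<lambda>l. - 1 + real (n l)) at_top sequentially"
      by (rule filterlim_tendsto_add_at_top[OF tendsto_const rn])
    then show "filterlim (\<lambda>l. real (n l) - 1) at_top sequentially" by simp
  qed
  have t1: "((\<lambda>l. (2 * real (n l) - 1) / (6 * sqrt (k l))) \<longlongrightarrow> \<rho> / 3) sequentially"
  proof -
    have "((\<lambda>l. (real (n l) / sqrt (k l)) / 3 - inverse (sqrt (k l)) / 6) \<longlongrightarrow> \<rho> / 3 - 0 / 6) sequentially"
      by (intro tendsto_intros \<rho> isk) auto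
    moreover have "(2 * x - 1) / (6 * s) = (x / s) / 3 - inverse s / 6" for x s :: real
      by (simp add: diff_divide_distrib inverse_eq_divide)
    ultimately show ?thesis by simp
  qed
  have t2: "((\<lambda>l. (real (n l))\<^sup>2 / (2 * real (k l))) \<longlongrightarrow> \<rho>\<^sup>2 / 2) sequentially"
  proof -
    have "((\<lambda>l. (real (n l) / sqrt (k l))\<^sup>2 / 2) \<longlongrightarrow> \<rho>\<^sup>2 / 2) sequentially"
      by (intro tendsto_intros \<rho>) auto
    moreover have "(real (n l) / sqrt (k l))\<^sup>2 / 2 = (real (n l))\<^sup>2 / (2 * real (k l))" for l
      by (simp add: power_divide)
    ultimately show ?thesis by (simp only:)
  qed
  have lim_b: "(b \<longlongrightarrow> edge_rate \<sigma> \<rho> t) sequentially"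
    unfolding b_def edge_rate_def by (intro tendsto_intros t1 t2)
  have lim_a: "(a \<longlongrightarrow> 2 * ln (2 * B) * 0 + edge_rate \<sigma> \<rho> t) sequentially"
    unfolding a_def by (intro tendsto_intros in1 lim_b)
  have "((\<lambda>l. ln (z l) - a l) \<longlongrightarrow> ln z0 - (2 * ln (2 * B) * 0 + edge_rate \<sigma> \<rho> t)) sequentially"
    using z by (intro tendsto_intros lim_a) auto
  then have ev_a: "\<forall>\<^sub>F l in sequentially. 0 < ln (z l) - a l"
    by (rule order_tendstoD) (use less in simp)
  have ev_z: "\<forall>\<^sub>F l in sequentially. 0 < z l" using z by (rule order_tendstoD)
  have ev_R: "\<forall>\<^sub>F l in sequentially. real (n l) / sqrt (real (k l)) < \<rho> + 1"
    using \<rho>(1) by (rule order_tendstoD) simp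
  have ev_h2: "\<forall>\<^sub>F l in sequentially. 2 * hazard t * (real (n l) / sqrt (real (k l))) < 1"
  proof -
    have "((\<lambda>l. 2 * hazard t * (real (n l) / sqrt (real (k l)))) \<longlongrightarrow> 2 * hazard t * \<rho>) sequentially"
      by (intro tendsto_intros \<rho>)
    then show ?thesis by (rule order_tendstoD) (use \<rho> in \<open>simp add: mult_ac\<close>)
  qed
  have nk: "((\<lambda>l. real (n l) / sqrt (real (k l)) * inverse (sqrt (real (k l)))) \<longlongrightarrow> \<rho> * 0) sequentially"
    by (intro tendsto_intros \<rho> isk)
  have ev_nk: "\<forall>\<^sub>F l in sequentially. real (n l) / sqrt (real (k l)) * inverse (sqrt (real (k l))) < 1 / (4 * c2 + 1)"
    using nk by (rule order_tendstoD) (use c2 in simp)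
  have ev_k: "\<forall>\<^sub>F l in sequentially. 1 \<le> k l" using k by (simp add: filterlim_at_top)
  have ev_n: "\<forall>\<^sub>F l in sequentially. 2 \<le> n l" using n by (simp add: filterlim_at_top)
  have ev_h1: "\<forall>\<^sub>F l in sequentially. 2 * hazard t \<le> sqrt (real (k l))" using sk by (simp add: filterlim_at_top)
  show ?thesis
    using ev_a ev_z ev_R ev_h2 ev_nk ev_k ev_n ev_h1
  proof eventually_elim
    case (elim l)
    have skp: "sqrt (real (k l)) > 0" using elim by simp
    have "real (n l) / sqrt (real (k l)) * inverse (sqrt (real (k l))) = real (n l) / (sqrt (real (k l)) * sqrt (real (k l)))"
      by (simp only: divide_inverse inverse_mult_distrib mult.assoc)
    then have nk1: "real (n l) / real (k l) < 1 / (4 * c2 + 1)"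
      using elim(5) by (simp only: real_sqrt_mult_self abs_of_nat)
    have aux: "w * x \<le> y" if "x / y < 1 / w" "y > 0" "w > 0" for x y w :: real
      using that by (simp add: field_simps)
    have nk': "(4 * c2 + 1) * real (n l) \<le> real (k l)"
      by (rule aux[OF nk1]) (use elim(6) c2 in auto)
    have nn: "0 \<le> 4 * (c2 * real (n l))" using c2 by simp
    have "real (n l) \<le> real (k l)" "4 * (c2 * real (n l)) \<le> real (k l)"
      using nk' nn of_nat_0_le_iff[of "n l", where 'a = real] unfolding distrib_right by linarith+
    moreover have "real (n l) \<le> (\<rho> + 1) * sqrt (real (k l))" using elim(3) skp by (simp add: pos_divide_less_eq)
    moreover have "2 * real (n l) * hazard t \<le> sqrt (real (k l))"
      using elim(4) skp by (simp add: pos_divide_less_eq mult_ac)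
    ultimately have "clique_prob (k l) (n l) \<sigma> t
      \<le> ennreal (B ^ n l * exp (real (n l choose 2) * b l))"
      unfolding b_def using elim \<sigma> by (intro bound) auto
    then have "ennreal (2 ^ n l) * clique_prob (k l) (n l) \<sigma> t
      \<le> ennreal (2 ^ n l) * ennreal (B ^ n l * exp (real (n l choose 2) * b l))"
      by (rule mult_left_mono) simp
    also have "\<dots> = ennreal ((2 * B) ^ n l * exp (real (n l choose 2) * b l))"
      using B by (subst ennreal_mult[symmetric]) (auto simp: power_mult_distrib mult.assoc)
    also have "\<dots> \<le> ennreal (z l ^ (n l choose 2))"
    proof (rule ennreal_leI)
      have "(2 * B) ^ n l = exp (real (n l) * ln (2 * B))" using B by (simp add: exp_of_nat_mult)
      also have "real (n l) * ln (2 * B) = real (n l choose 2) * (2 * ln (2 * B) * inverse (real (n l) - 1))"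
      proof -
        have "N * L = N * (N - 1) / 2 * (2 * L * inverse (N - 1))" if "N \<ge> 2" for N L :: real
          using that by (simp add: field_simps)
        from this[of "real (n l)" "ln (2 * B)"] show ?thesis using elim(7) unfolding real_choose_two by simp
      qed
      finally have "(2 * B) ^ n l * exp (real (n l choose 2) * b l) = exp (real (n l choose 2) * a l)"
        by (simp add: a_def distrib_left exp_add)
      also have "\<dots> \<le> exp (real (n l choose 2) * ln (z l))"
        using elim(1) by (simp add: mult_left_mono)
      also have "\<dots> = z l ^ (n l choose 2)" using elim(2) by (simp add: exp_of_nat_mult)
      finally show "(2 * B) ^ n l * exp (real (n l choose 2) * b l) \<le> z l ^ (n l choose 2)" .
    qed
    finally show ?case .
  qed
qed

section \<open>The critical probability and the choice of parameters\<close>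

lemma p_critD:
  assumes "C > 1"
  shows "0 < p_crit C" "p_crit C < 1/2" "C = ln (p_crit C) / ln (1 - p_crit C)"
  using theI'[OF p_crit_ex1[OF assms]] unfolding p_crit_def by auto

text \<open>At \<open>p_crit C\<close> the left side is \<open>C\<close>, and the inequality says
  that red gains more than blue loses. It comes from ln r < r - 1 for r = (1 - p) / p, combined with
  p \<le> - ln (1 - p).\<close>

lemma log_ratio_less:
  fixes p :: real
  assumes "0 < p" "p < 1/2"
  shows "ln p / ln (1 - p) < ((1 - p) / p)\<^sup>2"
proof -
  define s where "s = - ln (1 - p)"
  have s: "p \<le> s" using ln_le_minus_one[of "1 - p"] assms by (simp add: s_def)
  define r where "r = (1 - p) / p"
  have r: "r > 1" using assms by (simp add: r_def)
  have "ln r < r - 1" using r ln_le_minus_one[of r] ln_eq_minus_one[of r] by fastforce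
  also have "r - 1 = (1 - 2 * p) / p" using assms by (simp add: r_def field_simps)
  finally have "p\<^sup>2 * ln r < p\<^sup>2 * ((1 - 2 * p) / p)" using assms by (intro mult_strict_left_mono) auto
  also have "\<dots> = p * (1 - 2 * p)" using assms by (simp add: power2_eq_square)
  also have "\<dots> \<le> s * (1 - 2 * p)" using s assms by (intro mult_right_mono) auto
  finally have 1: "p\<^sup>2 * ln r < s * (1 - 2 * p)" .
  have lr: "ln r = - s - ln p" using assms by (simp add: r_def ln_div s_def)
  have "p\<^sup>2 * (- ln p) = p\<^sup>2 * ln r + p\<^sup>2 * s" unfolding lr by (simp add: algebra_simps)
  also have "\<dots> < s * (1 - 2 * p) + p\<^sup>2 * s" using 1 by simp
  also have "\<dots> = (1 - p)\<^sup>2 * s" by (simp add: power2_eq_square algebra_simps)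
  finally have "p\<^sup>2 * (- ln p) < (1 - p)\<^sup>2 * s" .
  then have "- ln p < (1 - p)\<^sup>2 * s / p\<^sup>2" using assms by (simp add: pos_less_divide_eq mult.commute)
  then have "(- ln p) / s < (1 - p)\<^sup>2 / p\<^sup>2" using assms s
    by (subst pos_divide_less_eq) (auto simp: mult.commute)
  then show ?thesis by (simp add: s_def power_divide)
qed

lemma Phi_surj:
  assumes "0 < p" "p < 1/2"
  obtains t where "t < 0" "Phi t = p"
proof -
  \<comment> \<open>The Chernoff bound of slope 1 gives an explicit left end for the intermediate
    value theorem.\<close>
  have "Phi (ln p - 1) \<le> exp (1 * (ln p - 1) + 1\<^sup>2 / 2)" by (rule Phi_chernoff) simp
  also have "1 * (ln p - 1) + 1\<^sup>2 / 2 = ln p + - 1 / 2" by simp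
  also have "exp (ln p + - 1 / 2) = p * exp (- 1 / 2)" unfolding exp_add using assms(1) by simp
  also have "\<dots> \<le> p" using assms by simp
  finally have lo: "Phi (ln p - 1) \<le> p" .
  have "ln p < 0" using assms by simp
  have "\<exists>t. ln p - 1 \<le> t \<and> t \<le> 0 \<and> Phi t = p"
  proof (rule IVT[of Phi "ln p - 1" p 0, OF lo])
    show "p \<le> Phi 0" using assms by (simp add: Phi_0)
    show "ln p - 1 \<le> 0" using \<open>ln p < 0\<close> by linarith
  qed (use Phi_has_derivative[THEN DERIV_isCont] in blast)
  then obtain t where t: "t \<le> 0" "Phi t = p" by blast
  then have "t \<noteq> 0" using assms by (auto simp: Phi_0)
  then show thesis by (intro that[of t]) (use t in auto)
qed

lemma isCont_hazard: "isCont hazard x"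
  by (rule DERIV_isCont[OF hazard_has_derivative])

lemma isCont_Phi: "isCont Phi x"
  by (rule DERIV_isCont[OF Phi_has_derivative])

text \<open>To first order in \<open>x = 1 / D\<close>, shifting the threshold by \<open>s * x\<close> costs \<open>s * hazard t * x\<close> per edge,
  while the triangles gain \<open>\<sigma> * \<rho> * hazard t ^ 3 * x / 3\<close>.\<close>

lemma edge_rate_less_near_zero:
  fixes s \<sigma> \<rho> \<epsilon> q t :: real
  assumes q: "q = Phi t" and neg: "s * hazard t - \<sigma> * \<rho> * hazard t ^ 3 / 3 + \<epsilon> / q < 0"
  shows "\<exists>d>0. \<forall>x. 0 < x \<and> x < d \<longrightarrow> edge_rate \<sigma> (\<rho> * x) (t + s * x) < ln (q - \<epsilon> * x)"
proof -
  define h' where "h' = - (std_normal_density t / (Phi t)\<^sup>2) * (std_normal_density t + t * Phi t)"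
  define f where "f x = edge_rate \<sigma> (\<rho> * x) (t + s * x) - ln (q - \<epsilon> * x)" for x
  have qp: "q > 0" using q Phi_pos by simp
  have inner: "((\<lambda>x. t + s * x) has_real_derivative s) (at 0)" by (auto intro!: derivative_eq_intros)
  have dP: "((\<lambda>x. Phi (t + s * x)) has_real_derivative std_normal_density t * s) (at 0)"
    using DERIV_chain2[of Phi "std_normal_density t" "\<lambda>x. t + s * x" 0 s UNIV] Phi_has_derivative[of t] inner by simp
  have dH: "((\<lambda>x. hazard (t + s * x)) has_real_derivative h' * s) (at 0)"
    using DERIV_chain2[of hazard h' "\<lambda>x. t + s * x" 0 s UNIV] hazard_has_derivative[of t] inner by (simp add: h'_def)
  \<comment> \<open>Neither the quadratic term of \<open>edge_rate\<close> nor the variation of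
    \<open>hazard\<close> in the cubic one contributes at 0. As \<open>f\<close> vanishes there, a
    negative derivative suffices.\<close>
  have "(f has_real_derivative (s * hazard t - \<sigma> * \<rho> * hazard t ^ 3 / 3 + \<epsilon> / q)) (at 0)"
    unfolding f_def[abs_def] edge_rate_def
    by (rule derivative_eq_intros dP dH refl | use qp Phi_pos[of t] in \<open>force simp: hazard_def\<close>)+
       (use qp Phi_pos[of t] in \<open>simp add: hazard_def field_simps\<close>)
  from has_real_derivative_neg_dec_right[OF this neg]
  obtain d where d: "d > 0" "\<And>h. 0 < h \<Longrightarrow> h < d \<Longrightarrow> f (0 + h) < f 0" by auto
  have "f 0 = 0" by (simp add: f_def edge_rate_def q)
  then have "f x < 0" if "0 < x" "x < d" for x using d(2)[of x] that by simp
  then show ?thesis using d(1) by (intro exI[of _ d]) (auto simp: f_def)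
qed

lemma nat_floor_mult_at_top:
  assumes "c > 0"
  shows "filterlim (\<lambda>l. nat \<lfloor>c * real l\<rfloor>) at_top sequentially"
    and "((\<lambda>l. real (nat \<lfloor>c * real l\<rfloor>) / real l) \<longlongrightarrow> c) sequentially"
proof -
  have "filterlim (\<lambda>l. c * real l) at_top sequentially"
    using assms by real_asymp
  then show "filterlim (\<lambda>l. nat \<lfloor>c * real l\<rfloor>) at_top sequentially"
    by (intro filterlim_compose[OF filterlim_nat_sequentially] filterlim_compose[OF filterlim_floor_sequentially])
  have "((\<lambda>l. real_of_int \<lfloor>c * real l\<rfloor> / real l) \<longlongrightarrow> c) sequentially"
    using assms by real_asymp
  moreover have "real (nat \<lfloor>c * real l\<rfloor>) = real_of_int \<lfloor>c * real l\<rfloor>" for l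
    using assms by simp
  ultimately show "((\<lambda>l. real (nat \<lfloor>c * real l\<rfloor>) / real l) \<longlongrightarrow> c) sequentially" by simp
qed

lemma nat_floor_square_at_top:
  assumes "D > 0"
  shows "filterlim (\<lambda>l. nat \<lfloor>D\<^sup>2 * (real l)\<^sup>2\<rfloor>) at_top sequentially"
    and "((\<lambda>l. real l / sqrt (real (nat \<lfloor>D\<^sup>2 * (real l)\<^sup>2\<rfloor>))) \<longlongrightarrow> 1 / D) sequentially"
proof -
  have "filterlim (\<lambda>l. D\<^sup>2 * (real l)\<^sup>2) at_top sequentially"
    using assms by real_asymp
  then show "filterlim (\<lambda>l. nat \<lfloor>D\<^sup>2 * (real l)\<^sup>2\<rfloor>) at_top sequentially"
    by (intro filterlim_compose[OF filterlim_nat_sequentially] filterlim_compose[OF filterlim_floor_sequentially])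
  have "((\<lambda>l. real l / sqrt (real_of_int \<lfloor>D\<^sup>2 * (real l)\<^sup>2\<rfloor>)) \<longlongrightarrow> inverse \<bar>D\<bar>) sequentially"
    using assms by real_asymp
  moreover have "inverse \<bar>D\<bar> = 1 / D" using assms by (simp add: inverse_eq_divide)
  moreover have "real (nat \<lfloor>D\<^sup>2 * (real l)\<^sup>2\<rfloor>) = real_of_int \<lfloor>D\<^sup>2 * (real l)\<^sup>2\<rfloor>" for l
    by simp
  ultimately show "((\<lambda>l. real l / sqrt (real (nat \<lfloor>D\<^sup>2 * (real l)\<^sup>2\<rfloor>))) \<longlongrightarrow> 1 / D) sequentially"
    by (simp only:)
qed

lemma tendsto_edge_rate:
  assumes "(f \<longlongrightarrow> t) F"
  shows "((\<lambda>x. edge_rate \<sigma> \<rho> (f x)) \<longlongrightarrow> edge_rate \<sigma> \<rho> t) F"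
  unfolding edge_rate_def using Phi_pos[of t]
  by (intro tendsto_intros isCont_tendsto_compose[OF isCont_hazard assms] isCont_tendsto_compose[OF isCont_Phi assms]) auto

theorem theorem3p1:
  fixes C :: real
  assumes "C > 1"
  shows "\<exists>\<epsilon>\<^sub>0>0. \<exists>D\<^sub>0::real. \<forall>D\<ge>D\<^sub>0. \<exists>L::nat. \<forall>l\<^sub>0\<ge>L. \<forall>l\<ge>l\<^sub>0. \<forall>k::nat.
    k = nat \<lfloor>D\<^sup>2 * (real l)\<^sup>2\<rfloor> \<longrightarrow>
    (\<exists>p. p_crit C < p \<and> p < 1/2 \<and>
      P_red k p l \<le> (p_crit C - \<epsilon>\<^sub>0 * (real l / sqrt (real k))) ^ (l choose 2) \<and>
      P_blue k p (nat \<lfloor>C * real l\<rfloor>)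
        \<le> (1 - p_crit C - \<epsilon>\<^sub>0 * (real l / sqrt (real k))) ^ (nat \<lfloor>C * real l\<rfloor> choose 2))"
proof -
  define p where "p = p_crit C"
  have p: "0 < p" "p < 1/2" "C = ln p / ln (1 - p)" unfolding p_def by (rule p_critD[OF assms])+
  obtain t where t: "t < 0" "Phi t = p" by (rule Phi_surj[OF p(1,2)])
  have t': "Phi (- t) = 1 - p" by (simp add: Phi_uminus t)
  define \<mu> \<nu> where "\<mu> = hazard t" and "\<nu> = hazard (- t)"
  have \<mu>: "\<mu> > 0" and \<nu>: "\<nu> > 0" by (simp_all add: \<mu>_def \<nu>_def hazard_pos)
  \<comment> \<open>The density is even, so the hazards at \<open>t\<close> and \<open>- t\<close>
    differ only in their denominators \<open>p\<close> and \<open>1 - p\<close>.\<close>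
  have ratio: "\<mu> = (1 - p) / p * \<nu>"
    unfolding \<mu>_def \<nu>_def hazard_def t t' std_normal_density_uminus using p by simp
  have "C * \<nu>\<^sup>2 < ((1 - p) / p)\<^sup>2 * \<nu>\<^sup>2"
    using log_ratio_less[OF p(1,2)] \<nu> unfolding p(3)[symmetric] by (intro mult_strict_right_mono) auto
  also have "\<dots> = \<mu>\<^sup>2" unfolding ratio power_mult_distrib ..
  finally have "C * \<nu>\<^sup>2 / 3 < \<mu>\<^sup>2 / 3" by simp
  \<comment> \<open>\<open>s\<close> is the shift of the threshold per unit of 1 / D. For red its
    cost \<open>s * \<mu>\<close> must stay below the gain \<open>\<mu> ^ 3 / 3\<close>; for blue
    its gain \<open>s * \<nu>\<close> must exceed the loss \<open>C * \<nu> ^ 3 / 3\<close>, where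
    \<open>C\<close> enters through the clique size.\<close>
  then obtain s where s: "C * \<nu>\<^sup>2 / 3 < s" "s < \<mu>\<^sup>2 / 3" using dense by blast
  have "0 < C * \<nu>\<^sup>2 / 3" using assms \<nu> by simp
  then have s0: "s > 0" using s by linarith
  \<comment> \<open>The slack in the two derivatives. The factors \<open>p\<close> and
    \<open>1 - p\<close> compensate those from differentiating
    \<open>ln (p - \<epsilon> * x)\<close> and \<open>ln (1 - p - \<epsilon> * x)\<close> at
    0.\<close>
  define e1 e2 where "e1 = (\<mu>\<^sup>2 / 3 - s) * \<mu> * p" and "e2 = (s - C * \<nu>\<^sup>2 / 3) * \<nu> * (1 - p)"
  define \<epsilon> where "\<epsilon> = min e1 e2 / 2"
  have e: "0 < e1" "0 < e2" using s \<mu> \<nu> p by (auto simp: e1_def e2_def)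
  then have \<epsilon>: "0 < \<epsilon>" "\<epsilon> < e1" "\<epsilon> < e2" by (auto simp: \<epsilon>_def)
  have neg1: "s * hazard t - 1 * 1 * hazard t ^ 3 / 3 + \<epsilon> / p < 0"
  proof -
    have "\<epsilon> / p < e1 / p" using \<epsilon> p by (simp add: divide_strict_right_mono)
    also have "e1 / p = (\<mu>\<^sup>2 / 3 - s) * \<mu>" using p by (simp add: e1_def)
    also have "\<dots> = \<mu> ^ 3 / 3 - s * \<mu>" by (simp add: power2_eq_square power3_eq_cube left_diff_distrib)
    finally show ?thesis by (simp add: \<mu>_def)
  qed
  have neg2: "(- s) * hazard (- t) - (- 1) * C * hazard (- t) ^ 3 / 3 + \<epsilon> / (1 - p) < 0"
  proof -
    have "\<epsilon> / (1 - p) < e2 / (1 - p)" using \<epsilon> p by (simp add: divide_strict_right_mono)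
    also have "e2 / (1 - p) = (s - C * \<nu>\<^sup>2 / 3) * \<nu>" using p by (simp add: e2_def)
    also have "\<dots> = s * \<nu> - C * \<nu> ^ 3 / 3" by (simp add: power2_eq_square power3_eq_cube left_diff_distrib)
    finally show ?thesis by (simp add: \<nu>_def)
  qed
  obtain d1 where d1: "d1 > 0" "\<And>x. 0 < x \<Longrightarrow> x < d1 \<Longrightarrow> edge_rate 1 (1 * x) (t + s * x) < ln (p - \<epsilon> * x)"
    using edge_rate_less_near_zero[OF t(2)[symmetric] neg1] by blast
  obtain d2 where d2: "d2 > 0" "\<And>x. 0 < x \<Longrightarrow> x < d2 \<Longrightarrow> edge_rate (- 1) (C * x) (- t + (- s) * x) < ln (1 - p - \<epsilon> * x)"
    using edge_rate_less_near_zero[OF t'[symmetric] neg2] by blast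
  \<comment> \<open>\<open>d1\<close> and \<open>d2\<close> secure the two rates,
    \<open>- t / s\<close> keeps the shifted threshold negative and hence the cap below 1/2,
    \<open>1 / (2 * C * \<mu>)\<close> keeps the columns in the range of their bounds, and
    \<open>p / \<epsilon>\<close> keeps both bases positive.\<close>
  define d where "d = Min {d1, d2, - t / s, 1 / (2 * C * \<mu>), p / \<epsilon>}"
  have d: "d > 0" using d1(1) d2(1) divide_neg_pos[OF t(1) s0] assms \<mu> p(1) \<epsilon>(1) by (simp add: d_def)
  have dle: "d \<le> d1" "d \<le> d2" "d \<le> - t / s" "d \<le> 1 / (2 * C * \<mu>)" "d \<le> p / \<epsilon>" by (simp_all add: d_def)
  have "\<exists>L::nat. \<forall>l\<^sub>0\<ge>L. \<forall>l\<ge>l\<^sub>0. \<forall>k::nat.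
    k = nat \<lfloor>D\<^sup>2 * (real l)\<^sup>2\<rfloor> \<longrightarrow>
    (\<exists>q. p < q \<and> q < 1/2 \<and>
      P_red k q l \<le> (p - \<epsilon> * (real l / sqrt (real k))) ^ (l choose 2) \<and>
      P_blue k q (nat \<lfloor>C * real l\<rfloor>)
        \<le> (1 - p - \<epsilon> * (real l / sqrt (real k))) ^ (nat \<lfloor>C * real l\<rfloor> choose 2))"
    if D: "D \<ge> 2 / d" for D :: real
  proof -
    have "0 < 2 / d" using d by simp
    then have D0: "D > 0" using D by linarith
    define x where "x = 1 / D"
    have x0: "x > 0" using D0 by (simp add: x_def)
    \<comment> \<open>The numerator 2 in \<open>2 / d\<close> makes \<open>x < d\<close>
      strict.\<close>
    have "x \<le> d / 2" using D D0 d by (simp add: x_def field_simps)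
    then have xd: "x < d" using d by linarith
    define T where "T = t + s * x"
    have T: "t < T" "T < 0"
    proof -
      show "t < T" using s0 x0 by (simp add: T_def)
      have "x < - t / s" using xd dle by linarith
      then have "s * x < - t" unfolding pos_less_divide_eq[OF s0] by (simp only: mult.commute)
      then show "T < 0" by (simp add: T_def)
    qed
    have xC: "2 * C * x * \<mu> < 1"
    proof -
      have "x < 1 / (2 * C * \<mu>)" using xd dle by linarith
      then show ?thesis using assms \<mu> by (simp add: pos_less_divide_eq mult_ac)
    qed
    have h: "hazard T \<le> \<mu>" "hazard (- T) \<le> \<mu>"
      unfolding \<mu>_def using T by (auto intro!: hazard_antimono)
    have x1: "2 * x * hazard T < 1"
    proof -
      have "1 * \<mu> \<le> C * \<mu>" using assms \<mu> by (intro mult_right_mono) auto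
      then have "(2 * x) * hazard T \<le> (2 * x) * (C * \<mu>)"
        using x0 h(1) by (intro mult_left_mono) auto
      then show ?thesis using xC by (simp add: mult_ac)
    qed
    have x2: "2 * (C * x) * hazard (- T) < 1"
    proof -
      have "(2 * (C * x)) * hazard (- T) \<le> (2 * (C * x)) * \<mu>"
        using x0 h(2) assms by (intro mult_left_mono) auto
      then show ?thesis using xC by (simp add: mult_ac)
    qed
    have z0: "p - \<epsilon> * x > 0" "1 - p - \<epsilon> * x > 0"
    proof -
      have "x < p / \<epsilon>" using xd dle by linarith
      then show "p - \<epsilon> * x > 0" using \<epsilon> by (simp add: pos_less_divide_eq mult.commute)
      then show "1 - p - \<epsilon> * x > 0" using p by linarith
    qed
    have r1: "edge_rate 1 x T < ln (p - \<epsilon> * x)"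
      using d1(2)[of x] x0 xd dle by (simp add: T_def)
    have r2: "edge_rate (- 1) (C * x) (- T) < ln (1 - p - \<epsilon> * x)"
      using d2(2)[of x] x0 xd dle by (simp add: T_def)
    \<comment> \<open>All requirements hold strictly at \<delta> = 0 and depend continuously on
      \<delta>, so they survive for some fixed \<delta> > 0. This \<delta> absorbs the deviation of
      the norms in the thresholds of both colours and in the lower bound for the cap.\<close>
    have "((\<lambda>\<delta>. T * (1 - \<delta>)) \<longlongrightarrow> T * (1 - 0)) (at_right 0)" by (intro tendsto_intros)
    then have lim1: "((\<lambda>\<delta>. T * (1 - \<delta>)) \<longlongrightarrow> T) (at_right 0)" by simp
    have "((\<lambda>\<delta>. - T * (1 + \<delta>)) \<longlongrightarrow> - T * (1 + 0)) (at_right 0)" by (intro tendsto_intros)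
    then have lim2: "((\<lambda>\<delta>. - T * (1 + \<delta>)) \<longlongrightarrow> - T) (at_right 0)" by simp
    have "((\<lambda>\<delta>. T * (1 + \<delta>)) \<longlongrightarrow> T * (1 + 0)) (at_right 0)" by (intro tendsto_intros)
    then have lim3: "((\<lambda>\<delta>. T * (1 + \<delta>)) \<longlongrightarrow> T) (at_right 0)" by simp
    have "\<forall>\<^sub>F \<delta> in at_right 0. \<delta> \<in> {0<..<1::real}" by (rule eventually_at_right_real) simp
    moreover have "\<forall>\<^sub>F \<delta> in at_right 0. edge_rate 1 x (T * (1 - \<delta>)) < ln (p - \<epsilon> * x)"
      using r1 by (rule order_tendstoD(2)[OF tendsto_edge_rate[OF lim1]])
    moreover have "\<forall>\<^sub>F \<delta> in at_right 0. edge_rate (- 1) (C * x) (- T * (1 + \<delta>)) < ln (1 - p - \<epsilon> * x)"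
      using r2 by (rule order_tendstoD(2)[OF tendsto_edge_rate[OF lim2]])
    moreover have "\<forall>\<^sub>F \<delta> in at_right 0. 2 * x * hazard (T * (1 - \<delta>)) < 1"
      using x1 by (rule order_tendstoD(2)[OF tendsto_mult_left[OF isCont_tendsto_compose[OF isCont_hazard lim1]]])
    moreover have "\<forall>\<^sub>F \<delta> in at_right 0. 2 * (C * x) * hazard (- T * (1 + \<delta>)) < 1"
      using x2 by (rule order_tendstoD(2)[OF tendsto_mult_left[OF isCont_tendsto_compose[OF isCont_hazard lim2]]])
    moreover have "\<forall>\<^sub>F \<delta> in at_right 0. p < Phi (T * (1 + \<delta>))"
      by (rule order_tendstoD(1)[OF isCont_tendsto_compose[OF isCont_Phi lim3]])
         (use Phi_strict_mono[OF T(1)] t in simp)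
    ultimately have "\<forall>\<^sub>F \<delta> in at_right 0. \<delta> \<in> {0<..<1::real}
      \<and> edge_rate 1 x (T * (1 - \<delta>)) < ln (p - \<epsilon> * x)
      \<and> edge_rate (- 1) (C * x) (- T * (1 + \<delta>)) < ln (1 - p - \<epsilon> * x)
      \<and> 2 * x * hazard (T * (1 - \<delta>)) < 1 \<and> 2 * (C * x) * hazard (- T * (1 + \<delta>)) < 1 \<and> p < Phi (T * (1 + \<delta>))"
      by (intro eventually_conj)
    from eventually_happens'[OF trivial_limit_at_right_real this] obtain \<delta> where \<delta>: "0 < \<delta>" "\<delta> < 1"
      and rr: "edge_rate 1 x (T * (1 - \<delta>)) < ln (p - \<epsilon> * x)"
      and rb: "edge_rate (- 1) (C * x) (- T * (1 + \<delta>)) < ln (1 - p - \<epsilon> * x)"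
      and hr: "2 * x * hazard (T * (1 - \<delta>)) < 1" and hb: "2 * (C * x) * hazard (- T * (1 + \<delta>)) < 1"
      and pT: "p < Phi (T * (1 + \<delta>))"
      unfolding greaterThanLessThan_iff by (elim exE conjE) (rule that)
    \<comment> \<open>The threshold \<open>c\<close> is the same for all \<open>l\<close>; only the
      resulting cap probability varies with the dimension.\<close>
    define c where "c = - T"
    have c: "c > 0" using T by (simp add: c_def)
    define k where "k = (\<lambda>l::nat. nat \<lfloor>D\<^sup>2 * (real l)\<^sup>2\<rfloor>)"
    define n where "n = (\<lambda>l::nat. nat \<lfloor>C * real l\<rfloor>)"
    have k: "filterlim k at_top sequentially" and lk: "((\<lambda>l. real l / sqrt (real (k l))) \<longlongrightarrow> x) sequentially"
      unfolding k_def x_def by (rule nat_floor_square_at_top[OF D0])+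
    have C0: "C > 0" using assms by simp
    have n: "filterlim n at_top sequentially" and ln: "((\<lambda>l. real (n l) / real l) \<longlongrightarrow> C) sequentially"
      unfolding n_def by (rule nat_floor_mult_at_top[OF C0])+
    have nk: "((\<lambda>l. real (n l) / sqrt (real (k l))) \<longlongrightarrow> C * x) sequentially"
    proof (rule Lim_transform_eventually[OF tendsto_mult[OF ln lk]])
      show "\<forall>\<^sub>F l in sequentially. real (n l) / real l * (real l / sqrt (real (k l))) = real (n l) / sqrt (real (k l))"
        using eventually_gt_at_top[of "0::nat"] by eventually_elim simp
    qed
    have z1: "((\<lambda>l. p - \<epsilon> * (real l / sqrt (real (k l)))) \<longlongrightarrow> p - \<epsilon> * x) sequentially"
      and z2: "((\<lambda>l. 1 - p - \<epsilon> * (real l / sqrt (real (k l)))) \<longlongrightarrow> 1 - p - \<epsilon> * x) sequentially"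
      by (intro tendsto_intros lk)+
    have ev_red: "\<forall>\<^sub>F l in sequentially. ennreal (2 ^ l) * clique_prob (k l) l 1 (T * (1 - \<delta>))
      \<le> ennreal ((p - \<epsilon> * (real l / sqrt (real (k l)))) ^ (l choose 2))"
      using gauss_clique_eventually_le[of 1 "\<lambda>l. l" k x "T * (1 - \<delta>)", OF _ filterlim_ident k lk x0 hr z1 z0(1) rr] by simp
    have ev_blue: "\<forall>\<^sub>F l in sequentially. ennreal (2 ^ n l) * clique_prob (k l) (n l) (- 1) (- T * (1 + \<delta>))
      \<le> ennreal ((1 - p - \<epsilon> * (real l / sqrt (real (k l)))) ^ (n l choose 2))"
      using gauss_clique_eventually_le[of "- 1" n k "C * x" "- T * (1 + \<delta>)", OF _ n k nk _ hb z2 z0(2) rb] C0 x0 by simp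
    have sk: "filterlim (\<lambda>l. sqrt (real (k l))) at_top sequentially"
      by (intro filterlim_compose[OF sqrt_at_top] filterlim_compose[OF filterlim_real_sequentially k])
    have "((\<lambda>y. 2 * exp 9 * exp (- y * \<delta>)) \<longlongrightarrow> 0) at_top"
      using \<delta>(1) by real_asymp
    from filterlim_compose[OF this sk]
    have dev: "((\<lambda>l. 2 * exp 9 * exp (- sqrt (real (k l)) * \<delta>)) \<longlongrightarrow> 0) sequentially" .
    have ev1: "\<forall>\<^sub>F l in sequentially. 2 * exp 9 * exp (- sqrt (real (k l)) * \<delta>) < 1/2"
      using dev by (rule order_tendstoD) simp
    have ev2: "\<forall>\<^sub>F l in sequentially. 2 * exp 9 * exp (- sqrt (real (k l)) * \<delta>) < Phi (T * (1 + \<delta>)) - p"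
      using dev by (rule order_tendstoD) (use pT in simp)
    have ev3: "\<forall>\<^sub>F l in sequentially. 16 \<le> k l" using k by (simp add: filterlim_at_top)
    have ev4: "\<forall>\<^sub>F l in sequentially. c + 1 \<le> sqrt (real (k l))" using sk by (simp add: filterlim_at_top)
    have ev5: "\<forall>\<^sub>F l in sequentially. 0 < p - \<epsilon> * (real l / sqrt (real (k l)))"
      using z1 z0(1) by (rule order_tendstoD)
    have ev6: "\<forall>\<^sub>F l in sequentially. 0 < 1 - p - \<epsilon> * (real l / sqrt (real (k l)))"
      using z2 z0(2) by (rule order_tendstoD)
    have "\<forall>\<^sub>F l in sequentially. \<exists>q. p < q \<and> q < 1/2 \<and>
      P_red (k l) q l \<le> (p - \<epsilon> * (real l / sqrt (real (k l)))) ^ (l choose 2) \<and>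
      P_blue (k l) q (n l) \<le> (1 - p - \<epsilon> * (real l / sqrt (real (k l)))) ^ (n l choose 2)"
      using ev_red ev_blue ev1 ev2 ev3 ev4 ev5 ev6
    proof eventually_elim
      case (elim l)
      have kl: "k l > 0" "c < sqrt (real (k l))" using elim by auto
      have half: "measure (gauss (k l)) (norm_shell (k l) (typical_norms (k l) \<delta>)) \<ge> 1/2"
        using gauss_typical_norms[OF elim(5) \<delta>] elim(3) by linarith
      define q where "q = cap_prob (k l) (- c / sqrt (real (k l)))"
      have "p < q" using cap_prob_ge[OF elim(5) c \<delta>] elim(4) by (simp add: q_def c_def)
      moreover have "q < 1/2"
        unfolding q_def by (rule cap_prob_less_half[OF kl(1)]) (use c kl in \<open>simp add: divide_neg_pos\<close>)
      moreover have "ennreal (P_red (k l) q l) \<le> ennreal ((p - \<epsilon> * (real l / sqrt (real (k l)))) ^ (l choose 2))"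
        using P_red_le[OF kl(1) c kl(2) \<delta> half, of l] elim(1) by (simp add: q_def c_def)
      then have "P_red (k l) q l \<le> (p - \<epsilon> * (real l / sqrt (real (k l)))) ^ (l choose 2)"
        using elim(7) by (subst (asm) ennreal_le_iff) auto
      moreover have "ennreal (P_blue (k l) q (n l)) \<le> ennreal ((1 - p - \<epsilon> * (real l / sqrt (real (k l)))) ^ (n l choose 2))"
        using P_blue_le[OF kl(1) c kl(2) \<delta> half, of "n l"] elim(2) by (simp add: q_def c_def)
      then have "P_blue (k l) q (n l) \<le> (1 - p - \<epsilon> * (real l / sqrt (real (k l)))) ^ (n l choose 2)"
        using elim(8) by (subst (asm) ennreal_le_iff) auto
      ultimately show ?case by blast
    qed
    then obtain L where L: "\<And>l. L \<le> l \<Longrightarrow> \<exists>q. p < q \<and> q < 1/2 \<and>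
      P_red (k l) q l \<le> (p - \<epsilon> * (real l / sqrt (real (k l)))) ^ (l choose 2) \<and>
      P_blue (k l) q (n l) \<le> (1 - p - \<epsilon> * (real l / sqrt (real (k l)))) ^ (n l choose 2)"
      unfolding eventually_sequentially by blast
    show ?thesis
    proof (intro exI[of _ L] allI impI)
      fix l\<^sub>0 l j assume "L \<le> l\<^sub>0" "l\<^sub>0 \<le> l" and j: "j = nat \<lfloor>D\<^sup>2 * (real l)\<^sup>2\<rfloor>"
      then have "L \<le> l" by simp
      from L[OF this] show "\<exists>q. p < q \<and> q < 1/2 \<and>
        P_red j q l \<le> (p - \<epsilon> * (real l / sqrt (real j))) ^ (l choose 2) \<and>
        P_blue j q (nat \<lfloor>C * real l\<rfloor>) \<le> (1 - p - \<epsilon> * (real l / sqrt (real j))) ^ (nat \<lfloor>C * real l\<rfloor> choose 2)"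
        unfolding k_def n_def j .
    qed
  qed
  then show ?thesis unfolding p_def using \<epsilon>(1) by blast
qed

end
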